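(* Let $A$ be a commutative ring and let $\mathfrak{g}$ be a Lie algebra over $A$ which as an $A$-module is projective and locally of finite rank, and whose Killing form $\mathcal{K}_{\mathfrak{g}}$ is perfect. Then the group scheme $\mathrm{Aut}(\mathfrak{g})$ over $\mathrm{Spec}(A)$ of Lie algebra automorphisms of $\mathfrak{g}$ is smooth and locally of finite presentation.
   Context: The Killing form is $\mathcal{K}_{\mathfrak{g}}(a,b)=\mathrm{Tr}(\mathrm{ad}(a)\circ\mathrm{ad}(b))$ for $a,b\in\mathfrak{g}$; it is perfect if the induced $A$-linear map $\mathfrak{g}\to\mathrm{Hom}_A(\mathfrak{g},A)$ is an isomorphism. $\mathrm{Aut}(\mathfrak{g})$ is the closed subgroup scheme of $GL_{\mathfrak{g}}$ whose $B$-valued points (for $A$-algebras $B$) are the $B$-linear Lie automorphisms of $\mathfrak{g}\otimes_A B$. *)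

theory Defs
  imports "HOL-Algebra.Algebra"
begin

section \<open>Linear maps, projective modules, traces\<close>

definition mod_hom ::
  "('a, 'm) ring_scheme \<Rightarrow> ('a, 'g, 'k) module_scheme \<Rightarrow> ('a, 'h, 'l) module_scheme \<Rightarrow> ('g \<Rightarrow> 'h) set"
  where "mod_hom A M N =
    {h \<in> carrier M \<rightarrow>\<^sub>E carrier N.
       (\<forall>x\<in>carrier M. \<forall>y\<in>carrier M. h (x \<oplus>\<^bsub>M\<^esub> y) = h x \<oplus>\<^bsub>N\<^esub> h y) \<and>
       (\<forall>a\<in>carrier A. \<forall>x\<in>carrier M. h (a \<odot>\<^bsub>M\<^esub> x) = a \<odot>\<^bsub>N\<^esub> h x)}"

definition self_module :: "('a, 'm) ring_scheme \<Rightarrow> ('a, 'a) module"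
  where "self_module A =
    \<lparr>carrier = carrier A, monoid.mult = (\<otimes>\<^bsub>A\<^esub>), one = \<one>\<^bsub>A\<^esub>,
     ring.zero = \<zero>\<^bsub>A\<^esub>, ring.add = (\<oplus>\<^bsub>A\<^esub>), smult = (\<otimes>\<^bsub>A\<^esub>)\<rparr>"

definition dual :: "('a, 'm) ring_scheme \<Rightarrow> ('a, 'g, 'k) module_scheme \<Rightarrow> ('g \<Rightarrow> 'a) set"
  where "dual A M = mod_hom A M (self_module A)"

text \<open>The record type of modules extends that of rings; the fields \<open>mult\<close> and \<open>one\<close> play no
  role for a module and are left undefined in the constructions of modules below.\<close>

definition free_module :: "('a, 'm) ring_scheme \<Rightarrow> 'i set \<Rightarrow> ('a, 'i \<Rightarrow> 'a) module"
  where "free_module A I =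
    \<lparr>carrier = {c. (\<forall>i\<in>I. c i \<in> carrier A) \<and> (\<forall>i. i \<notin> I \<longrightarrow> c i = \<zero>\<^bsub>A\<^esub>) \<and> finite {i. c i \<noteq> \<zero>\<^bsub>A\<^esub>}},
     monoid.mult = undefined, one = undefined,
     ring.zero = (\<lambda>i. \<zero>\<^bsub>A\<^esub>), ring.add = (\<lambda>c d i. c i \<oplus>\<^bsub>A\<^esub> d i), smult = (\<lambda>a c i. a \<otimes>\<^bsub>A\<^esub> c i)\<rparr>"

text \<open>Projective: a direct summand of a free module. Taking the index set inside the type of the
  elements of \<open>M\<close> is no restriction, since a projective module is a direct summand of the free
  module on its own underlying set.\<close>

definition projective_module :: "('a, 'm) ring_scheme \<Rightarrow> ('a, 'g, 'k) module_scheme \<Rightarrow> bool"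
  where "projective_module A M \<longleftrightarrow> module A M \<and>
    (\<exists>(I :: 'g set). \<exists>s \<in> mod_hom A M (free_module A I). \<exists>p \<in> mod_hom A (free_module A I) M.
       \<forall>x\<in>carrier M. p (s x) = x)"

text \<open>The trace \<open>End(M) \<cong> M\<^sup>* \<otimes> M \<rightarrow> A\<close> for a finitely generated projective \<open>M\<close>:
  if \<open>T = \<Sum>i<n. \<phi>\<^sub>i(-) e\<^sub>i\<close>, then \<open>Tr T = \<Sum>i<n. \<phi>\<^sub>i(e\<^sub>i)\<close>.\<close>

definition mod_trace ::
  "('a, 'm) ring_scheme \<Rightarrow> ('a, 'g, 'k) module_scheme \<Rightarrow> ('g \<Rightarrow> 'g) \<Rightarrow> 'a"
  where "mod_trace A M T =
    (THE t. \<exists>(n::nat) e \<phi>. (\<forall>i<n. e i \<in> carrier M \<and> \<phi> i \<in> dual A M) \<and>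
       (\<forall>x\<in>carrier M. T x = (\<Oplus>\<^bsub>M\<^esub>i\<in>{..<n}. \<phi> i x \<odot>\<^bsub>M\<^esub> e i)) \<and>
       t = (\<Oplus>\<^bsub>A\<^esub>i\<in>{..<n}. \<phi> i (e i)))"


section \<open>Modules locally of finite rank\<close>

text \<open>The fraction \<open>m / f\<^sup>i\<close>, as the class of all \<open>(n, j)\<close> with \<open>m / f\<^sup>i = n / f\<^sup>j\<close>.\<close>

definition fraction ::
  "('a, 'm) ring_scheme \<Rightarrow> ('a, 'g, 'k) module_scheme \<Rightarrow> 'a \<Rightarrow> 'g \<Rightarrow> nat \<Rightarrow> ('g \<times> nat) set"
  where "fraction A M f m i =
    {(n, j). n \<in> carrier M \<and>
       (\<exists>k::nat. (f [^]\<^bsub>A\<^esub> (k + j)) \<odot>\<^bsub>M\<^esub> m = (f [^]\<^bsub>A\<^esub> (k + i)) \<odot>\<^bsub>M\<^esub> n)}"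

definition loc_ring :: "('a, 'm) ring_scheme \<Rightarrow> 'a \<Rightarrow> ('a \<times> nat) set ring"
  where "loc_ring A f =
    \<lparr>carrier = {fraction A (self_module A) f a i | a i. a \<in> carrier A},
     monoid.mult = (\<lambda>U V. {z. \<exists>(a, i)\<in>U. \<exists>(b, j)\<in>V.
        z \<in> fraction A (self_module A) f (a \<otimes>\<^bsub>A\<^esub> b) (i + j)}),
     one = fraction A (self_module A) f \<one>\<^bsub>A\<^esub> 0,
     ring.zero = fraction A (self_module A) f \<zero>\<^bsub>A\<^esub> 0,
     ring.add = (\<lambda>U V. {z. \<exists>(a, i)\<in>U. \<exists>(b, j)\<in>V.
        z \<in> fraction A (self_module A) f ((f [^]\<^bsub>A\<^esub> j) \<otimes>\<^bsub>A\<^esub> a \<oplus>\<^bsub>A\<^esub> (f [^]\<^bsub>A\<^esub> i) \<otimes>\<^bsub>A\<^esub> b) (i + j)})\<rparr>"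

definition loc_module ::
  "('a, 'm) ring_scheme \<Rightarrow> ('a, 'g, 'k) module_scheme \<Rightarrow> 'a \<Rightarrow> (('a \<times> nat) set, ('g \<times> nat) set) module"
  where "loc_module A M f =
    \<lparr>carrier = {fraction A M f m i | m i. m \<in> carrier M},
     monoid.mult = undefined, one = undefined,
     ring.zero = fraction A M f \<zero>\<^bsub>M\<^esub> 0,
     ring.add = (\<lambda>U V. {z. \<exists>(m, i)\<in>U. \<exists>(n, j)\<in>V.
        z \<in> fraction A M f ((f [^]\<^bsub>A\<^esub> j) \<odot>\<^bsub>M\<^esub> m \<oplus>\<^bsub>M\<^esub> (f [^]\<^bsub>A\<^esub> i) \<odot>\<^bsub>M\<^esub> n) (i + j)}),
     smult = (\<lambda>U V. {z. \<exists>(a, i)\<in>U. \<exists>(m, j)\<in>V.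
        z \<in> fraction A M f (a \<odot>\<^bsub>M\<^esub> m) (i + j)})\<rparr>"

definition free_of_finite_rank :: "('a, 'm) ring_scheme \<Rightarrow> ('a, 'g, 'k) module_scheme \<Rightarrow> bool"
  where "free_of_finite_rank A M \<longleftrightarrow>
    (\<exists>(n::nat) e. (\<forall>i<n. e i \<in> carrier M) \<and>
       (\<forall>x\<in>carrier M. \<exists>!c. c \<in> {..<n} \<rightarrow>\<^sub>E carrier A \<and> x = (\<Oplus>\<^bsub>M\<^esub>i\<in>{..<n}. c i \<odot>\<^bsub>M\<^esub> e i)))"

text \<open>Every point of \<open>Spec A\<close> has a basic open neighbourhood \<open>D(f)\<close> over which \<open>M\<close> is free of
  finite rank.\<close>

definition locally_of_finite_rank :: "('a, 'm) ring_scheme \<Rightarrow> ('a, 'g, 'k) module_scheme \<Rightarrow> bool"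
  where "locally_of_finite_rank A M \<longleftrightarrow>
    (\<forall>P. primeideal P A \<longrightarrow>
       (\<exists>f \<in> carrier A - P. free_of_finite_rank (loc_ring A f) (loc_module A M f)))"


section \<open>Lie algebras and the Killing form\<close>

record ('a, 'g) lie_alg = "('a, 'g) module" +
  lie :: "['g, 'g] \<Rightarrow> 'g"

locale lie_algebra = module A L
  for A :: "('a, 'm) ring_scheme" (structure) and L :: "('a, 'g, 'k) lie_alg_scheme" (structure) +
  assumes lie_closed: "\<lbrakk>x \<in> carrier L; y \<in> carrier L\<rbrakk> \<Longrightarrow> lie L x y \<in> carrier L"
    and lie_add_left: "\<lbrakk>x \<in> carrier L; y \<in> carrier L; z \<in> carrier L\<rbrakk> \<Longrightarrow>
      lie L (x \<oplus>\<^bsub>L\<^esub> y) z = lie L x z \<oplus>\<^bsub>L\<^esub> lie L y z"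
    and lie_add_right: "\<lbrakk>x \<in> carrier L; y \<in> carrier L; z \<in> carrier L\<rbrakk> \<Longrightarrow>
      lie L x (y \<oplus>\<^bsub>L\<^esub> z) = lie L x y \<oplus>\<^bsub>L\<^esub> lie L x z"
    and lie_smult_left: "\<lbrakk>a \<in> carrier A; x \<in> carrier L; y \<in> carrier L\<rbrakk> \<Longrightarrow>
      lie L (a \<odot>\<^bsub>L\<^esub> x) y = a \<odot>\<^bsub>L\<^esub> lie L x y"
    and lie_smult_right: "\<lbrakk>a \<in> carrier A; x \<in> carrier L; y \<in> carrier L\<rbrakk> \<Longrightarrow>
      lie L x (a \<odot>\<^bsub>L\<^esub> y) = a \<odot>\<^bsub>L\<^esub> lie L x y"
    and lie_self: "x \<in> carrier L \<Longrightarrow> lie L x x = \<zero>\<^bsub>L\<^esub>"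
    and jacobi: "\<lbrakk>x \<in> carrier L; y \<in> carrier L; z \<in> carrier L\<rbrakk> \<Longrightarrow>
      lie L x (lie L y z) \<oplus>\<^bsub>L\<^esub> lie L y (lie L z x) \<oplus>\<^bsub>L\<^esub> lie L z (lie L x y) = \<zero>\<^bsub>L\<^esub>"

definition killing_form ::
  "('a, 'm) ring_scheme \<Rightarrow> ('a, 'g, 'k) lie_alg_scheme \<Rightarrow> 'g \<Rightarrow> 'g \<Rightarrow> 'a"
  where "killing_form A L a b = mod_trace A L (lie L a \<circ> lie L b)"

definition perfect_killing_form ::
  "('a, 'm) ring_scheme \<Rightarrow> ('a, 'g, 'k) lie_alg_scheme \<Rightarrow> bool"
  where "perfect_killing_form A L \<longleftrightarrow>
    bij_betw (\<lambda>a. \<lambda>b\<in>carrier L. killing_form A L a b) (carrier L) (dual A L)"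

definition lie_aut ::
  "('a, 'm) ring_scheme \<Rightarrow> ('a, 'g, 'k) lie_alg_scheme \<Rightarrow> ('g \<Rightarrow> 'g) set"
  where "lie_aut A L =
    {\<sigma> \<in> mod_hom A L L. bij_betw \<sigma> (carrier L) (carrier L) \<and>
       (\<forall>x\<in>carrier L. \<forall>y\<in>carrier L. \<sigma> (lie L x y) = lie L (\<sigma> x) (\<sigma> y))}"


section \<open>Base change of a Lie algebra\<close>

text \<open>Lists over \<open>M \<times> N\<close> represent finite sums of pure tensors. \<open>tensor_eq\<close> is the congruence
  generated by commutativity and the bilinearity relations; additive inverses
  exist in the quotient because \<open>(\<ominus>m) \<otimes> n\<close> is inverse to \<open>m \<otimes> n\<close>.\<close>

inductive tensor_eq ::
  "('a, 'm) ring_scheme \<Rightarrow> ('a, 'g, 'k) module_scheme \<Rightarrow> ('a, 'h, 'l) module_scheme \<Rightarrow>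
   ('g \<times> 'h) list \<Rightarrow> ('g \<times> 'h) list \<Rightarrow> bool"
  for A M N where
  refl: "set xs \<subseteq> carrier M \<times> carrier N \<Longrightarrow> tensor_eq A M N xs xs"
| sym: "tensor_eq A M N xs ys \<Longrightarrow> tensor_eq A M N ys xs"
| trans: "\<lbrakk>tensor_eq A M N xs ys; tensor_eq A M N ys zs\<rbrakk> \<Longrightarrow> tensor_eq A M N xs zs"
| append: "\<lbrakk>tensor_eq A M N xs xs'; tensor_eq A M N ys ys'\<rbrakk> \<Longrightarrow>
    tensor_eq A M N (xs @ ys) (xs' @ ys')"
| comm: "\<lbrakk>set xs \<subseteq> carrier M \<times> carrier N; set ys \<subseteq> carrier M \<times> carrier N\<rbrakk> \<Longrightarrow>
    tensor_eq A M N (xs @ ys) (ys @ xs)"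
| add_left: "\<lbrakk>m \<in> carrier M; m' \<in> carrier M; n \<in> carrier N\<rbrakk> \<Longrightarrow>
    tensor_eq A M N [(m \<oplus>\<^bsub>M\<^esub> m', n)] [(m, n), (m', n)]"
| add_right: "\<lbrakk>m \<in> carrier M; n \<in> carrier N; n' \<in> carrier N\<rbrakk> \<Longrightarrow>
    tensor_eq A M N [(m, n \<oplus>\<^bsub>N\<^esub> n')] [(m, n), (m, n')]"
| balanced: "\<lbrakk>a \<in> carrier A; m \<in> carrier M; n \<in> carrier N\<rbrakk> \<Longrightarrow>
    tensor_eq A M N [(a \<odot>\<^bsub>M\<^esub> m, n)] [(m, a \<odot>\<^bsub>N\<^esub> n)]"
| zero_left: "n \<in> carrier N \<Longrightarrow> tensor_eq A M N [(\<zero>\<^bsub>M\<^esub>, n)] []"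

text \<open>The Lie algebra \<open>L \<otimes>\<^sub>A B\<close> over \<open>B\<close>, for an \<open>A\<close>-algebra \<open>B\<close>; its bracket is
  \<open>[x \<otimes> b, y \<otimes> c] = [x, y] \<otimes> b c\<close>.\<close>

definition base_change ::
  "('a, 'm) ring_scheme \<Rightarrow> ('a, 'g, 'k) lie_alg_scheme \<Rightarrow> ('a, 'b, 'l) module_scheme \<Rightarrow>
   ('b, ('g \<times> 'b) list set) lie_alg"
  where "base_change A L B =
    \<lparr>carrier = {{zs. tensor_eq A L B xs zs} | xs. set xs \<subseteq> carrier L \<times> carrier B},
     monoid.mult = undefined, one = undefined,
     ring.zero = {zs. tensor_eq A L B [] zs},
     ring.add = (\<lambda>U V. {zs. \<exists>xs\<in>U. \<exists>ys\<in>V. tensor_eq A L B (xs @ ys) zs}),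
     smult = (\<lambda>b U. {zs. \<exists>xs\<in>U. tensor_eq A L B (map (\<lambda>(x, c). (x, b \<otimes>\<^bsub>B\<^esub> c)) xs) zs}),
     lie = (\<lambda>U V. {zs. \<exists>xs\<in>U. \<exists>ys\<in>V.
        tensor_eq A L B [(lie L x y, b \<otimes>\<^bsub>B\<^esub> c). (x, b) \<leftarrow> xs, (y, c) \<leftarrow> ys] zs})\<rparr>"

text \<open>\<open>id \<otimes> h : L \<otimes>\<^sub>A R \<rightarrow> L \<otimes>\<^sub>A B\<close> for a homomorphism of \<open>A\<close>-algebras \<open>h : R \<rightarrow> B\<close>.\<close>

definition base_change_map ::
  "('a, 'm) ring_scheme \<Rightarrow> ('a, 'g, 'k) lie_alg_scheme \<Rightarrow> ('a, 'b, 'l) module_scheme \<Rightarrow>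
   ('r \<Rightarrow> 'b) \<Rightarrow> ('g \<times> 'r) list set \<Rightarrow> ('g \<times> 'b) list set"
  where "base_change_map A L B h U =
    {zs. \<exists>xs\<in>U. tensor_eq A L B (map (\<lambda>(x, r). (x, h r)) xs) zs}"


section \<open>Smooth and finitely presented algebras\<close>

definition alg_hom ::
  "('a, 'm) ring_scheme \<Rightarrow> ('a, 'b, 'k) module_scheme \<Rightarrow> ('a, 'c, 'l) module_scheme \<Rightarrow> ('b \<Rightarrow> 'c) set"
  where "alg_hom A B C = ring_hom B C \<inter> mod_hom A B C"

text \<open>The polynomial ring \<open>A[x\<^sub>0,\<dots>,x\<^bsub>n-1\<^esub>]\<close>; monomials are multisets of indices.\<close>

definition mpoly_ring :: "('a, 'm) ring_scheme \<Rightarrow> nat \<Rightarrow> ('a, nat multiset \<Rightarrow> 'a) module"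
  where "mpoly_ring A n =
    \<lparr>carrier = {p. (\<forall>m. p m \<in> carrier A) \<and> finite {m. p m \<noteq> \<zero>\<^bsub>A\<^esub>} \<and>
        (\<forall>m. p m \<noteq> \<zero>\<^bsub>A\<^esub> \<longrightarrow> set_mset m \<subseteq> {..<n})},
     monoid.mult = (\<lambda>p q m. \<Oplus>\<^bsub>A\<^esub>k\<in>{k. k \<subseteq># m}. p k \<otimes>\<^bsub>A\<^esub> q (m - k)),
     one = (\<lambda>m. if m = {#} then \<one>\<^bsub>A\<^esub> else \<zero>\<^bsub>A\<^esub>),
     ring.zero = (\<lambda>m. \<zero>\<^bsub>A\<^esub>),
     ring.add = (\<lambda>p q m. p m \<oplus>\<^bsub>A\<^esub> q m),
     smult = (\<lambda>a p m. a \<otimes>\<^bsub>A\<^esub> p m)\<rparr>"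

definition finitely_presented_algebra ::
  "('a, 'm) ring_scheme \<Rightarrow> ('a, 'r, 'k) module_scheme \<Rightarrow> bool"
  where "finitely_presented_algebra A R \<longleftrightarrow> algebra A R \<and>
    (\<exists>n. \<exists>h \<in> alg_hom A (mpoly_ring A n) R. h ` carrier (mpoly_ring A n) = carrier R \<and>
       (\<exists>F. finite F \<and> F \<subseteq> carrier (mpoly_ring A n) \<and>
          a_kernel (mpoly_ring A n) R h = genideal (mpoly_ring A n) F))"

definition quot_algebra :: "('a, 'b, 'k) module_scheme \<Rightarrow> 'b set \<Rightarrow> ('a, 'b set) module"
  where "quot_algebra B J =
    \<lparr>carrier = carrier (B Quot J), monoid.mult = (\<otimes>\<^bsub>B Quot J\<^esub>), one = \<one>\<^bsub>B Quot J\<^esub>,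
     ring.zero = \<zero>\<^bsub>B Quot J\<^esub>, ring.add = (\<oplus>\<^bsub>B Quot J\<^esub>),
     smult = (\<lambda>a U. \<Union>x\<in>U. J +>\<^bsub>B\<^esub> (a \<odot>\<^bsub>B\<^esub> x))\<rparr>"

text \<open>The infinitesimal lifting property. The type argument is the type in which the elements of
  the test algebras \<open>B\<close> live; it is meant to be left arbitrary.\<close>

definition formally_smooth_algebra ::
  "'b itself \<Rightarrow> ('a, 'm) ring_scheme \<Rightarrow> ('a, 'r, 'k) module_scheme \<Rightarrow> bool"
  where "formally_smooth_algebra _ A R \<longleftrightarrow> algebra A R \<and>
    (\<forall>(B :: ('a, 'b) module) J.
       algebra A B \<and> ideal J B \<and> (\<forall>x\<in>J. \<forall>y\<in>J. x \<otimes>\<^bsub>B\<^esub> y = \<zero>\<^bsub>B\<^esub>) \<longrightarrow>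
       (\<forall>h \<in> alg_hom A R (quot_algebra B J). \<exists>k \<in> alg_hom A R B.
          \<forall>r\<in>carrier R. J +>\<^bsub>B\<^esub> k r = h r))"

text \<open>For affine schemes: a morphism is smooth iff it is formally smooth and locally of finite
  presentation (the definition in EGA IV 17.3.1), and \<open>Spec R \<rightarrow> Spec A\<close> is locally of finite
  presentation iff \<open>R\<close> is a finitely presented \<open>A\<close>-algebra.\<close>

definition smooth_algebra ::
  "'b itself \<Rightarrow> ('a, 'm) ring_scheme \<Rightarrow> ('a, 'r, 'k) module_scheme \<Rightarrow> bool"
  where "smooth_algebra T A R \<longleftrightarrow> formally_smooth_algebra T A R \<and> finitely_presented_algebra A R"


section \<open>The scheme of Lie algebra automorphisms\<close>

text \<open>\<open>Spec R\<close> represents the functor \<open>B \<mapsto> Aut\<^sub>B(L \<otimes>\<^sub>A B)\<close> on \<open>A\<close>-algebras, with universal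
  automorphism \<open>u\<close>: each \<open>\<sigma>\<close> over \<open>B\<close> is the base change \<open>h\<^sub>*u\<close> along exactly one \<open>h : R \<rightarrow> B\<close>.
  Here \<open>h\<^sub>*u = \<sigma>\<close> is expressed by \<open>\<sigma> \<circ> (id \<otimes> h) = (id \<otimes> h) \<circ> u\<close>, which determines \<open>\<sigma>\<close> because
  the image of \<open>id \<otimes> h\<close> spans \<open>L \<otimes>\<^sub>A B\<close> over \<open>B\<close>. The group structure of the scheme is
  the one induced from the functor. As above, the type argument is that of the test algebras.\<close>

definition represents_Aut ::
  "'b itself \<Rightarrow> ('a, 'm) ring_scheme \<Rightarrow> ('a, 'g, 'k) lie_alg_scheme \<Rightarrow> ('a, 'r) module \<Rightarrow>
   (('g \<times> 'r) list set \<Rightarrow> ('g \<times> 'r) list set) \<Rightarrow> bool"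
  where "represents_Aut _ A L R u \<longleftrightarrow> algebra A R \<and> u \<in> lie_aut R (base_change A L R) \<and>
    (\<forall>B :: ('a, 'b) module. algebra A B \<longrightarrow>
      (\<forall>\<sigma> \<in> lie_aut B (base_change A L B).
        \<exists>!h. h \<in> alg_hom A R B \<and>
          (\<forall>U \<in> carrier (base_change A L R).
             \<sigma> (base_change_map A L B h U) = base_change_map A L B h (u U))))"

text \<open>A type with room for all quotients of polynomial rings \<open>A[x\<^sub>0,\<dots>,x\<^bsub>n-1\<^esub>]\<close>, hence, up to
  isomorphism, for every \<open>A\<close>-algebra of finite type.\<close>

type_synonym 'a fin_type_alg = "(nat multiset \<Rightarrow> 'a) set"

end

theory Submission
  imports Defs
begin

text \<open>As \<open>\<gg>\<close> is projective and finitely generated, it has a finite dual basis, and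
  \<open>Aut(\<gg>)\<close> is cut out by finitely many polynomial equations between the matrix entries of an
  automorphism and of its inverse; so it is represented by a finitely presented algebra. Smoothness is the infinitesimal lifting property. Let \<open>J\<close> be an
  ideal of square zero in \<open>B\<close>. An automorphism modulo \<open>J\<close> lifts to a linear map \<open>\<theta>\<close> of
  \<open>\<gg> \<otimes> B\<close>, and \<open>c(x, y) = [\<theta> x, \<theta> y] - \<theta> [x, y]\<close> is a 2-cocycle with values in
  \<open>\<gg> \<otimes> J\<close>. If \<open>e\<^sub>i\<close> and \<open>e'\<^sub>i\<close> are dual for the Killing form, the Casimir element
  \<open>\<Sum> e\<^sub>i e'\<^sub>i\<close> acts as the identity on the adjoint representation, and hence
  \<open>\<psi>(x) = \<Sum> [\<theta> e\<^sub>i, c(e'\<^sub>i, x)]\<close> satisfies \<open>d\<psi> = c\<close>: this is the standard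
  homotopy that shows \<open>H\<^sup>2 = 0\<close>. So \<open>\<theta> - \<psi>\<close> is an automorphism that lifts the given one.\<close>

section \<open>Sums in modules\<close>

text \<open>Perfectness enters only through the Casimir element. If the family e' represents the
  functionals \<phi> through the Killing form K, invariance gives K(sum of [e_i, [e'_i, x]], y) =
  sum of \<phi>_i([x, [y, e_i]]), which is the trace that defines K(x, y). So the eigenvalue is
  exactly 1, nothing is divided by, and every characteristic is allowed. The properties of e' are
  then stated without the Killing form, because in that shape they pass to every base change. One
  obstacle is that the module is projective and not free: matrices with respect to generators are
  not unique, the role of the unit matrix falls to an idempotent, and the inverse gets variables of
  its own. Another is that \<theta> is no homomorphism, so the J-part must be made a module through
  \<theta>; this works because the errors have coordinates in J and two such elements bracket to
  zero. Finite generation must itself be proved: the coordinates in an ambient free module are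
  supported in a finite set locally, and a prime ideal argument makes this global.\<close>

lemma additive_zero:
  assumes "abelian_group M" "abelian_group N" "h \<in> carrier M \<rightarrow> carrier N"
    and "\<And>x y. \<lbrakk>x \<in> carrier M; y \<in> carrier M\<rbrakk> \<Longrightarrow> h (x \<oplus>\<^bsub>M\<^esub> y) = h x \<oplus>\<^bsub>N\<^esub> h y"
  shows "h \<zero>\<^bsub>M\<^esub> = \<zero>\<^bsub>N\<^esub>"
proof -
  interpret M: abelian_group M by fact
  interpret N: abelian_group N by fact
  have "h \<zero>\<^bsub>M\<^esub> \<in> carrier N" using assms(3) by auto
  moreover have "h \<zero>\<^bsub>M\<^esub> = h \<zero>\<^bsub>M\<^esub> \<oplus>\<^bsub>N\<^esub> h \<zero>\<^bsub>M\<^esub>"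
    using assms(4)[of "\<zero>\<^bsub>M\<^esub>" "\<zero>\<^bsub>M\<^esub>"] by simp
  ultimately show ?thesis by (metis N.add.r_cancel_one')
qed

lemma additive_neg:
  assumes "abelian_group M" "abelian_group N" "h \<in> carrier M \<rightarrow> carrier N"
    and "\<And>x y. \<lbrakk>x \<in> carrier M; y \<in> carrier M\<rbrakk> \<Longrightarrow> h (x \<oplus>\<^bsub>M\<^esub> y) = h x \<oplus>\<^bsub>N\<^esub> h y"
    and "x \<in> carrier M"
  shows "h (\<ominus>\<^bsub>M\<^esub> x) = \<ominus>\<^bsub>N\<^esub> h x"
proof -
  interpret M: abelian_group M by fact
  interpret N: abelian_group N by fact
  have "h (\<ominus>\<^bsub>M\<^esub> x) \<oplus>\<^bsub>N\<^esub> h x = \<zero>\<^bsub>N\<^esub>"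
    using assms(4)[of "\<ominus>\<^bsub>M\<^esub> x" x] assms(5) additive_zero[OF assms(1-4)]
    by (simp add: M.l_neg)
  then show ?thesis
    using assms(3,5) by (intro N.minus_equality[symmetric]) auto
qed

lemma additive_finsum:
  assumes "abelian_group M" "abelian_group N" "h \<in> carrier M \<rightarrow> carrier N"
    and "\<And>x y. \<lbrakk>x \<in> carrier M; y \<in> carrier M\<rbrakk> \<Longrightarrow> h (x \<oplus>\<^bsub>M\<^esub> y) = h x \<oplus>\<^bsub>N\<^esub> h y"
    and "\<And>i. i \<in> I \<Longrightarrow> f i \<in> carrier M"
  shows "h (finsum M f I) = finsum N (\<lambda>i. h (f i)) I"
proof -
  interpret M: abelian_group M by fact
  interpret N: abelian_group N by fact
  show ?thesis using assms(5)
  proof (induct I rule: infinite_finite_induct)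
    case (infinite I)
    then show ?case using additive_zero[OF assms(1-4)] by simp
  next
    case empty
    then show ?case using additive_zero[OF assms(1-4)] by simp
  next
    case (insert i I)
    then have "h \<in> carrier M \<rightarrow> carrier N" "f \<in> I \<rightarrow> carrier M" "(\<lambda>i. h (f i)) \<in> I \<rightarrow> carrier N"
      using assms(3) by auto
    with insert show ?case using assms(3) by (simp add: assms(4) Pi_iff)
  qed
qed

lemma (in abelian_monoid) finsum_swap:
  assumes "finite I" "finite J" "\<And>i j. \<lbrakk>i \<in> I; j \<in> J\<rbrakk> \<Longrightarrow> f i j \<in> carrier G"
  shows "finsum G (\<lambda>i. finsum G (f i) J) I = finsum G (\<lambda>j. finsum G (\<lambda>i. f i j) I) J"
  using assms(1,3)
proof (induct I)
  case (insert i I)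
  have "finsum G (\<lambda>i. finsum G (f i) J) (insert i I)
      = finsum G (f i) J \<oplus> finsum G (\<lambda>j. finsum G (\<lambda>i. f i j) I) J"
    using insert by (subst finsum_insert) (auto intro!: finsum_closed)
  also have "\<dots> = finsum G (\<lambda>j. f i j \<oplus> finsum G (\<lambda>i. f i j) I) J"
    using insert by (subst finsum_addf) (auto intro!: finsum_closed)
  also have "\<dots> = finsum G (\<lambda>j. finsum G (\<lambda>i. f i j) (insert i I)) J"
    using insert by (intro finsum_cong') (auto intro!: finsum_closed)
  finally show ?case .
qed auto

lemma (in abelian_monoid) finsum_cong_closed:
  assumes "\<And>i. i \<in> I \<Longrightarrow> f i = g i" "\<And>i. i \<in> I \<Longrightarrow> g i \<in> carrier G"
  shows "finsum G f I = finsum G g I"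
  using assms by (intro finsum_cong') auto

section \<open>Lie algebras with a finite dual basis\<close>

context lie_algebra
begin

lemma L_abelian: "abelian_group L" and A_abelian: "abelian_group A"
  by (simp_all add: M.abelian_group_axioms R.abelian_group_axioms)

lemma lie_zero_right [simp]: "y \<in> carrier L \<Longrightarrow> lie L y \<zero>\<^bsub>L\<^esub> = \<zero>\<^bsub>L\<^esub>"
  by (rule additive_zero[OF L_abelian L_abelian, where h = "\<lambda>x. lie L y x"]) (auto simp: lie_closed lie_add_right)

lemma lie_neg_left: "\<lbrakk>x \<in> carrier L; y \<in> carrier L\<rbrakk> \<Longrightarrow> lie L (\<ominus>\<^bsub>L\<^esub> x) y = \<ominus>\<^bsub>L\<^esub> lie L x y"
  by (rule additive_neg[OF L_abelian L_abelian, where h = "\<lambda>x. lie L x y"]) (auto simp: lie_closed lie_add_left)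

lemma lie_neg_right: "\<lbrakk>x \<in> carrier L; y \<in> carrier L\<rbrakk> \<Longrightarrow> lie L y (\<ominus>\<^bsub>L\<^esub> x) = \<ominus>\<^bsub>L\<^esub> lie L y x"
  by (rule additive_neg[OF L_abelian L_abelian, where h = "\<lambda>x. lie L y x"]) (auto simp: lie_closed lie_add_right)

lemma lie_minus_left:
  "\<lbrakk>x \<in> carrier L; x' \<in> carrier L; y \<in> carrier L\<rbrakk> \<Longrightarrow> lie L (x \<ominus>\<^bsub>L\<^esub> x') y = lie L x y \<ominus>\<^bsub>L\<^esub> lie L x' y"
  by (simp add: a_minus_def lie_add_left lie_neg_left)

lemma lie_minus_right:
  "\<lbrakk>x \<in> carrier L; x' \<in> carrier L; y \<in> carrier L\<rbrakk> \<Longrightarrow> lie L y (x \<ominus>\<^bsub>L\<^esub> x') = lie L y x \<ominus>\<^bsub>L\<^esub> lie L y x'"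
  by (simp add: a_minus_def lie_add_right lie_neg_right)

lemma lie_finsum_right:
  "\<lbrakk>\<And>i. i \<in> I \<Longrightarrow> f i \<in> carrier L; y \<in> carrier L\<rbrakk> \<Longrightarrow> lie L y (finsum L f I) = (\<Oplus>\<^bsub>L\<^esub>i\<in>I. lie L y (f i))"
  by (rule additive_finsum[OF L_abelian L_abelian, where h = "\<lambda>x. lie L y x"]) (auto simp: lie_closed lie_add_right)

lemma lie_anti:
  assumes "x \<in> carrier L" "y \<in> carrier L"
  shows "lie L x y = \<ominus>\<^bsub>L\<^esub> lie L y x"
proof -
  have "lie L (x \<oplus>\<^bsub>L\<^esub> y) (x \<oplus>\<^bsub>L\<^esub> y) = \<zero>\<^bsub>L\<^esub>"
    using assms by (simp add: lie_self)
  moreover have "lie L (x \<oplus>\<^bsub>L\<^esub> y) (x \<oplus>\<^bsub>L\<^esub> y) = lie L x y \<oplus>\<^bsub>L\<^esub> lie L y x"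
    using assms by (simp add: lie_add_left lie_add_right lie_closed lie_self[of x] lie_self[of y] M.a_comm)
  ultimately have "lie L x y \<oplus>\<^bsub>L\<^esub> lie L y x = \<zero>\<^bsub>L\<^esub>"
    by simp
  then show ?thesis
    using assms by (intro M.minus_equality[symmetric]) (auto simp: lie_closed)
qed

text \<open>Antisymmetry turns the cyclic Jacobi sum into the statement that \<open>lie L x\<close>
  is a derivation, the form used from here on.\<close>

lemma leibniz:
  assumes "x \<in> carrier L" "y \<in> carrier L" "z \<in> carrier L"
  shows "lie L x (lie L y z) = lie L (lie L x y) z \<oplus>\<^bsub>L\<^esub> lie L y (lie L x z)"
proof -
  let ?a = "lie L x (lie L y z)" and ?b = "lie L y (lie L x z)" and ?c = "lie L (lie L x y) z"
  have "lie L y (lie L z x) = \<ominus>\<^bsub>L\<^esub> ?b"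
    using assms lie_anti[of z x] by (simp add: lie_closed lie_neg_right)
  moreover have "lie L z (lie L x y) = \<ominus>\<^bsub>L\<^esub> ?c"
    using assms lie_anti[of z "lie L x y"] by (simp add: lie_closed)
  ultimately have *: "?a \<oplus>\<^bsub>L\<^esub> \<ominus>\<^bsub>L\<^esub> ?b \<oplus>\<^bsub>L\<^esub> \<ominus>\<^bsub>L\<^esub> ?c = \<zero>\<^bsub>L\<^esub>"
    using jacobi[OF assms] by simp
  have cl: "?a \<in> carrier L" "?b \<in> carrier L" "?c \<in> carrier L"
    using assms by (auto simp: lie_closed)
  have "?a = (?a \<oplus>\<^bsub>L\<^esub> \<ominus>\<^bsub>L\<^esub> ?b \<oplus>\<^bsub>L\<^esub> \<ominus>\<^bsub>L\<^esub> ?c) \<oplus>\<^bsub>L\<^esub> (?c \<oplus>\<^bsub>L\<^esub> ?b)"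
    using cl by (simp add: M.a_ac M.r_neg M.r_neg1 M.r_neg2 M.l_neg)
  then show ?thesis using cl by (simp add: *)
qed

text \<open>\<open>mod_hom\<close> asks for extensional functions. Here the values off the carrier
  are left free, so that composites and lambda terms qualify without being restricted.\<close>

definition endo :: "('g \<Rightarrow> 'g) \<Rightarrow> bool"
  where "endo f \<longleftrightarrow> f \<in> carrier L \<rightarrow> carrier L \<and>
    (\<forall>x\<in>carrier L. \<forall>y\<in>carrier L. f (x \<oplus>\<^bsub>L\<^esub> y) = f x \<oplus>\<^bsub>L\<^esub> f y) \<and>
    (\<forall>a\<in>carrier A. \<forall>x\<in>carrier L. f (a \<odot>\<^bsub>L\<^esub> x) = a \<odot>\<^bsub>L\<^esub> f x)"

lemma endoI:
  assumes "\<And>x. x \<in> carrier L \<Longrightarrow> f x \<in> carrier L"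
    and "\<And>x y. \<lbrakk>x \<in> carrier L; y \<in> carrier L\<rbrakk> \<Longrightarrow> f (x \<oplus>\<^bsub>L\<^esub> y) = f x \<oplus>\<^bsub>L\<^esub> f y"
    and "\<And>a x. \<lbrakk>a \<in> carrier A; x \<in> carrier L\<rbrakk> \<Longrightarrow> f (a \<odot>\<^bsub>L\<^esub> x) = a \<odot>\<^bsub>L\<^esub> f x"
  shows "endo f"
  using assms by (auto simp: endo_def)

lemma
  assumes "endo f"
  shows endo_closed: "x \<in> carrier L \<Longrightarrow> f x \<in> carrier L"
    and endo_add: "\<lbrakk>x \<in> carrier L; y \<in> carrier L\<rbrakk> \<Longrightarrow> f (x \<oplus>\<^bsub>L\<^esub> y) = f x \<oplus>\<^bsub>L\<^esub> f y"
    and endo_smult: "\<lbrakk>a \<in> carrier A; x \<in> carrier L\<rbrakk> \<Longrightarrow> f (a \<odot>\<^bsub>L\<^esub> x) = a \<odot>\<^bsub>L\<^esub> f x"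
  using assms by (auto simp: endo_def)

lemma endo_neg: "\<lbrakk>endo f; x \<in> carrier L\<rbrakk> \<Longrightarrow> f (\<ominus>\<^bsub>L\<^esub> x) = \<ominus>\<^bsub>L\<^esub> f x"
  by (rule additive_neg[OF L_abelian L_abelian]) (auto simp: endo_add endo_closed)

lemma endo_zero: "endo f \<Longrightarrow> f \<zero>\<^bsub>L\<^esub> = \<zero>\<^bsub>L\<^esub>"
  by (rule additive_zero[OF L_abelian L_abelian]) (auto simp: endo_add endo_closed)

lemma endo_minus: "\<lbrakk>endo f; x \<in> carrier L; y \<in> carrier L\<rbrakk> \<Longrightarrow> f (x \<ominus>\<^bsub>L\<^esub> y) = f x \<ominus>\<^bsub>L\<^esub> f y"
  by (simp add: a_minus_def endo_add endo_neg)

lemma endo_finsum: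
  "\<lbrakk>endo h; \<And>i. i \<in> I \<Longrightarrow> f i \<in> carrier L\<rbrakk> \<Longrightarrow> h (finsum L f I) = (\<Oplus>\<^bsub>L\<^esub>i\<in>I. h (f i))"
  by (rule additive_finsum[OF L_abelian L_abelian]) (auto simp: endo_add endo_closed)

lemma endo_comp: "\<lbrakk>endo f; endo g\<rbrakk> \<Longrightarrow> endo (\<lambda>x. f (g x))"
  by (intro endoI) (auto simp: endo_closed endo_add endo_smult)

lemma endo_diff: "\<lbrakk>endo f; endo g\<rbrakk> \<Longrightarrow> endo (\<lambda>x. f x \<ominus>\<^bsub>L\<^esub> g x)"
  by (intro endoI)
    (auto simp: endo_closed endo_add endo_smult a_minus_def M.minus_add M.a_ac smult_r_distr smult_r_minus)

lemma endo_ad: "x \<in> carrier L \<Longrightarrow> endo (lie L x)"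
  by (intro endoI) (auto simp: lie_closed lie_add_right lie_smult_right)

lemma endo_ad': "x \<in> carrier L \<Longrightarrow> endo (\<lambda>y. lie L y x)"
  by (intro endoI) (auto simp: lie_closed lie_add_left lie_smult_left)

lemma endo_id: "endo (\<lambda>x. x)"
  by (intro endoI) auto

lemma endo_smult_const:
  assumes "\<And>x. x \<in> carrier L \<Longrightarrow> g x \<in> carrier A" "v \<in> carrier L"
    and "\<And>x y. \<lbrakk>x \<in> carrier L; y \<in> carrier L\<rbrakk> \<Longrightarrow> g (x \<oplus>\<^bsub>L\<^esub> y) = g x \<oplus> g y"
    and "\<And>a x. \<lbrakk>a \<in> carrier A; x \<in> carrier L\<rbrakk> \<Longrightarrow> g (a \<odot>\<^bsub>L\<^esub> x) = a \<otimes> g x"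
  shows "endo (\<lambda>x. g x \<odot>\<^bsub>L\<^esub> v)"
  using assms by (intro endoI) (auto simp: smult_l_distr smult_assoc1)

lemma endo_sum:
  assumes "finite I" "\<And>i. i \<in> I \<Longrightarrow> endo (f i)"
  shows "endo (\<lambda>x. \<Oplus>\<^bsub>L\<^esub>i\<in>I. f i x)"
proof (intro endoI)
  fix x y assume "x \<in> carrier L" "y \<in> carrier L"
  then have "(\<Oplus>\<^bsub>L\<^esub>i\<in>I. f i (x \<oplus>\<^bsub>L\<^esub> y)) = (\<Oplus>\<^bsub>L\<^esub>i\<in>I. f i x \<oplus>\<^bsub>L\<^esub> f i y)"
    using assms by (intro M.finsum_cong_closed) (auto simp: endo_closed endo_add)
  then show "(\<Oplus>\<^bsub>L\<^esub>i\<in>I. f i (x \<oplus>\<^bsub>L\<^esub> y)) = (\<Oplus>\<^bsub>L\<^esub>i\<in>I. f i x) \<oplus>\<^bsub>L\<^esub> (\<Oplus>\<^bsub>L\<^esub>i\<in>I. f i y)"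
    using assms \<open>x \<in> carrier L\<close> \<open>y \<in> carrier L\<close> by (simp add: M.finsum_addf endo_closed)
next
  fix a x assume "a \<in> carrier A" "x \<in> carrier L"
  then show "(\<Oplus>\<^bsub>L\<^esub>i\<in>I. f i (a \<odot>\<^bsub>L\<^esub> x)) = a \<odot>\<^bsub>L\<^esub> (\<Oplus>\<^bsub>L\<^esub>i\<in>I. f i x)"
    using assms by (subst finsum_smult_ldistr) (auto simp: endo_closed endo_smult intro!: M.finsum_cong_closed)
qed (auto intro!: M.finsum_closed simp: assms endo_closed)

end

text \<open>A finite dual basis, the substitute for a basis in a finitely generated projective
  module. The \<open>e i\<close> may be linearly dependent, so \<open>\<phi> i (e j)\<close> need
  not be the Kronecker delta.\<close>

locale lie_fg = lie_algebra A L
  for A :: "('a, 'm) ring_scheme" (structure) and L :: "('a, 'g, 'k) lie_alg_scheme" (structure) +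
  fixes n :: nat and e :: "nat \<Rightarrow> 'g" and \<phi> :: "nat \<Rightarrow> 'g \<Rightarrow> 'a"
  assumes e_closed [simp]: "i < n \<Longrightarrow> e i \<in> carrier L"
    and phi_closed [simp]: "\<lbrakk>i < n; x \<in> carrier L\<rbrakk> \<Longrightarrow> \<phi> i x \<in> carrier A"
    and phi_add: "\<lbrakk>i < n; x \<in> carrier L; y \<in> carrier L\<rbrakk> \<Longrightarrow> \<phi> i (x \<oplus>\<^bsub>L\<^esub> y) = \<phi> i x \<oplus> \<phi> i y"
    and phi_smult: "\<lbrakk>i < n; a \<in> carrier A; x \<in> carrier L\<rbrakk> \<Longrightarrow> \<phi> i (a \<odot>\<^bsub>L\<^esub> x) = a \<otimes> \<phi> i x"
    and expand: "x \<in> carrier L \<Longrightarrow> (\<Oplus>\<^bsub>L\<^esub>i\<in>{..<n}. \<phi> i x \<odot>\<^bsub>L\<^esub> e i) = x"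
begin

lemma phi_zero: "i < n \<Longrightarrow> \<phi> i \<zero>\<^bsub>L\<^esub> = \<zero>"
  by (rule additive_zero[OF L_abelian A_abelian]) (auto simp: phi_add)

lemma phi_neg: "\<lbrakk>i < n; x \<in> carrier L\<rbrakk> \<Longrightarrow> \<phi> i (\<ominus>\<^bsub>L\<^esub> x) = \<ominus> \<phi> i x"
  by (rule additive_neg[OF L_abelian A_abelian]) (auto simp: phi_add)

lemma phi_minus: "\<lbrakk>i < n; x \<in> carrier L; y \<in> carrier L\<rbrakk> \<Longrightarrow> \<phi> i (x \<ominus>\<^bsub>L\<^esub> y) = \<phi> i x \<ominus> \<phi> i y"
  by (simp add: a_minus_def phi_add phi_neg)

lemma phi_finsum:
  "\<lbrakk>j < n; \<And>i. i \<in> I \<Longrightarrow> f i \<in> carrier L\<rbrakk> \<Longrightarrow> \<phi> j (finsum L f I) = (\<Oplus>i\<in>I. \<phi> j (f i))"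
  by (rule additive_finsum[OF L_abelian A_abelian]) (auto simp: phi_add)

text \<open>By \<open>expand\<close> an element is rebuilt from its coordinates. Equations in
  \<open>L\<close> can therefore be checked in \<open>A\<close>.\<close>

lemma eq_by_phi:
  assumes "x \<in> carrier L" "y \<in> carrier L" "\<And>i. i < n \<Longrightarrow> \<phi> i x = \<phi> i y"
  shows "x = y"
proof -
  have "(\<Oplus>\<^bsub>L\<^esub>i\<in>{..<n}. \<phi> i x \<odot>\<^bsub>L\<^esub> e i) = (\<Oplus>\<^bsub>L\<^esub>i\<in>{..<n}. \<phi> i y \<odot>\<^bsub>L\<^esub> e i)"
    using assms by (intro M.finsum_cong_closed) auto
  then show ?thesis using assms by (simp add: expand)
qed

lemma endo_expand:
  assumes "endo f" "x \<in> carrier L"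
  shows "f x = (\<Oplus>\<^bsub>L\<^esub>i\<in>{..<n}. \<phi> i x \<odot>\<^bsub>L\<^esub> f (e i))"
proof -
  have "f x = f (\<Oplus>\<^bsub>L\<^esub>i\<in>{..<n}. \<phi> i x \<odot>\<^bsub>L\<^esub> e i)"
    using assms by (simp add: expand)
  also have "\<dots> = (\<Oplus>\<^bsub>L\<^esub>i\<in>{..<n}. f (\<phi> i x \<odot>\<^bsub>L\<^esub> e i))"
    using assms by (intro endo_finsum) auto
  also have "\<dots> = (\<Oplus>\<^bsub>L\<^esub>i\<in>{..<n}. \<phi> i x \<odot>\<^bsub>L\<^esub> f (e i))"
    using assms by (intro M.finsum_cong_closed) (auto simp: endo_smult endo_closed)
  finally show ?thesis .
qed

lemma functional_expand:
  assumes "\<And>x. x \<in> carrier L \<Longrightarrow> g x \<in> carrier A" "x \<in> carrier L"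
    and "\<And>x y. \<lbrakk>x \<in> carrier L; y \<in> carrier L\<rbrakk> \<Longrightarrow> g (x \<oplus>\<^bsub>L\<^esub> y) = g x \<oplus> g y"
    and "\<And>a x. \<lbrakk>a \<in> carrier A; x \<in> carrier L\<rbrakk> \<Longrightarrow> g (a \<odot>\<^bsub>L\<^esub> x) = a \<otimes> g x"
  shows "g x = (\<Oplus>i\<in>{..<n}. \<phi> i x \<otimes> g (e i))"
proof -
  have "g x = g (\<Oplus>\<^bsub>L\<^esub>i\<in>{..<n}. \<phi> i x \<odot>\<^bsub>L\<^esub> e i)"
    using assms by (simp add: expand)
  also have "\<dots> = (\<Oplus>i\<in>{..<n}. g (\<phi> i x \<odot>\<^bsub>L\<^esub> e i))"
    using assms by (intro additive_finsum[OF L_abelian A_abelian]) auto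
  also have "\<dots> = (\<Oplus>i\<in>{..<n}. \<phi> i x \<otimes> g (e i))"
    using assms by (intro R.finsum_cong_closed) auto
  finally show ?thesis .
qed

lemma endo_eqI:
  assumes "endo f" "endo g" "\<And>j. j < n \<Longrightarrow> f (e j) = g (e j)" "x \<in> carrier L"
  shows "f x = g x"
proof -
  have "f x = (\<Oplus>\<^bsub>L\<^esub>i\<in>{..<n}. \<phi> i x \<odot>\<^bsub>L\<^esub> f (e i))"
    using assms by (simp add: endo_expand)
  also have "\<dots> = (\<Oplus>\<^bsub>L\<^esub>i\<in>{..<n}. \<phi> i x \<odot>\<^bsub>L\<^esub> g (e i))"
    using assms by (intro M.finsum_cong_closed) (auto simp: endo_closed)
  finally show ?thesis using assms by (simp add: endo_expand)
qed

end

section \<open>The trace, the Killing form and the Casimir element\<close>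

context lie_fg
begin

text \<open>The trace read off from the presentation of \<open>f\<close> in
  \<open>endo_expand\<close>; by \<open>tr_rank_one_sum\<close> every other presentation gives the
  same value.\<close>

definition tr :: "('g \<Rightarrow> 'g) \<Rightarrow> 'a"
  where "tr f = (\<Oplus>i\<in>{..<n}. \<phi> i (f (e i)))"

lemma tr_closed [simp]: "endo f \<Longrightarrow> tr f \<in> carrier A"
  by (auto simp: tr_def endo_closed intro!: R.finsum_closed)

text \<open>Both sides are the double sum of \<open>\<psi> k (e i) \<otimes> \<phi> i (v k)\<close>:
  summing over \<open>k\<close> first uses the presentation of \<open>f\<close>, summing over
  \<open>i\<close> first uses the expansion of \<open>v k\<close> in the generators.\<close>

lemma tr_rank_one_sum:
  fixes m :: nat
  assumes "endo f"
    and "\<And>k. k < m \<Longrightarrow> v k \<in> carrier L"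
    and "\<And>k x. \<lbrakk>k < m; x \<in> carrier L\<rbrakk> \<Longrightarrow> \<psi> k x \<in> carrier A"
    and "\<And>k x y. \<lbrakk>k < m; x \<in> carrier L; y \<in> carrier L\<rbrakk> \<Longrightarrow> \<psi> k (x \<oplus>\<^bsub>L\<^esub> y) = \<psi> k x \<oplus> \<psi> k y"
    and "\<And>k a x. \<lbrakk>k < m; a \<in> carrier A; x \<in> carrier L\<rbrakk> \<Longrightarrow> \<psi> k (a \<odot>\<^bsub>L\<^esub> x) = a \<otimes> \<psi> k x"
    and "\<And>x. x \<in> carrier L \<Longrightarrow> f x = (\<Oplus>\<^bsub>L\<^esub>k\<in>{..<m}. \<psi> k x \<odot>\<^bsub>L\<^esub> v k)"
  shows "tr f = (\<Oplus>k\<in>{..<m}. \<psi> k (v k))"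
proof -
  have "tr f = (\<Oplus>i\<in>{..<n}. \<Oplus>k\<in>{..<m}. \<psi> k (e i) \<otimes> \<phi> i (v k))"
    unfolding tr_def
  proof (intro R.finsum_cong_closed)
    fix i assume i: "i \<in> {..<n}"
    have "\<phi> i (f (e i)) = \<phi> i (\<Oplus>\<^bsub>L\<^esub>k\<in>{..<m}. \<psi> k (e i) \<odot>\<^bsub>L\<^esub> v k)"
      using i by (simp only: assms(6) e_closed lessThan_iff)
    also have "\<dots> = (\<Oplus>k\<in>{..<m}. \<phi> i (\<psi> k (e i) \<odot>\<^bsub>L\<^esub> v k))"
      using i assms(2,3) by (intro phi_finsum) auto
    also have "\<dots> = (\<Oplus>k\<in>{..<m}. \<psi> k (e i) \<otimes> \<phi> i (v k))"
      using i assms(2,3) by (intro R.finsum_cong_closed) (auto simp: phi_smult)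
    finally show "\<phi> i (f (e i)) = (\<Oplus>k\<in>{..<m}. \<psi> k (e i) \<otimes> \<phi> i (v k))" .
  qed (use assms(2,3) in \<open>auto intro!: R.finsum_closed\<close>)
  also have "\<dots> = (\<Oplus>k\<in>{..<m}. \<Oplus>i\<in>{..<n}. \<psi> k (e i) \<otimes> \<phi> i (v k))"
    using assms by (intro R.finsum_swap) auto
  also have "\<dots> = (\<Oplus>k\<in>{..<m}. \<psi> k (v k))"
  proof (intro R.finsum_cong_closed)
    fix k assume k: "k \<in> {..<m}"
    have "(\<Oplus>i\<in>{..<n}. \<psi> k (e i) \<otimes> \<phi> i (v k)) = (\<Oplus>i\<in>{..<n}. \<phi> i (v k) \<otimes> \<psi> k (e i))"
      using assms k by (intro R.finsum_cong_closed) (auto simp: R.m_comm)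
    also have "\<dots> = \<psi> k (v k)"
      using assms k by (intro functional_expand[symmetric]) auto
    finally show "(\<Oplus>i\<in>{..<n}. \<psi> k (e i) \<otimes> \<phi> i (v k)) = \<psi> k (v k)" .
  qed (use assms in auto)
  finally show ?thesis .
qed

lemma tr_cong: "(\<And>x. x \<in> carrier L \<Longrightarrow> f x = g x) \<Longrightarrow> endo g \<Longrightarrow> tr f = tr g"
  unfolding tr_def by (intro R.finsum_cong_closed) (auto simp: endo_closed)

lemma tr_add:
  assumes "endo f" "endo g"
  shows "tr (\<lambda>x. f x \<oplus>\<^bsub>L\<^esub> g x) = tr f \<oplus> tr g"
proof -
  have "tr (\<lambda>x. f x \<oplus>\<^bsub>L\<^esub> g x) = (\<Oplus>i\<in>{..<n}. \<phi> i (f (e i)) \<oplus> \<phi> i (g (e i)))"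
    unfolding tr_def using assms by (intro R.finsum_cong_closed) (auto simp: endo_closed phi_add)
  then show ?thesis
    using assms by (simp add: tr_def R.finsum_addf endo_closed)
qed

lemma tr_minus:
  assumes "endo f" "endo g"
  shows "tr (\<lambda>x. f x \<ominus>\<^bsub>L\<^esub> g x) = tr f \<ominus> tr g"
proof -
  have "tr (\<lambda>x. f x \<ominus>\<^bsub>L\<^esub> g x) \<oplus> tr g = tr (\<lambda>x. (f x \<ominus>\<^bsub>L\<^esub> g x) \<oplus>\<^bsub>L\<^esub> g x)"
    using assms endo_diff[OF assms] by (simp add: tr_add)
  also have "\<dots> = tr f"
    using assms by (intro tr_cong) (auto simp: endo_closed a_minus_def M.a_assoc M.l_neg)
  finally have "tr f = tr (\<lambda>x. f x \<ominus>\<^bsub>L\<^esub> g x) \<oplus> tr g" by simp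
  then show ?thesis
    using tr_closed[OF endo_diff[OF assms]] tr_closed[OF assms(2)]
    by (simp add: a_minus_def R.a_assoc R.r_neg)
qed

lemma tr_smult:
  assumes "endo f" "a \<in> carrier A"
  shows "tr (\<lambda>x. a \<odot>\<^bsub>L\<^esub> f x) = a \<otimes> tr f"
  unfolding tr_def using assms
  by (subst R.finsum_rdistr) (auto simp: endo_closed phi_smult intro!: R.finsum_cong_closed)

text \<open>The composite is presented by the functionals \<open>\<phi> k (g x)\<close> and the
  vectors \<open>f (e k)\<close>; the trace of this presentation is literally the trace of the other
  composite.\<close>

lemma tr_comm:
  assumes "endo f" "endo g"
  shows "tr (\<lambda>x. f (g x)) = tr (\<lambda>x. g (f x))"
proof -
  have "tr (\<lambda>x. f (g x)) = (\<Oplus>k\<in>{..<n}. \<phi> k (g (f (e k))))"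
  proof (rule tr_rank_one_sum[where \<psi> = "\<lambda>k x. \<phi> k (g x)" and v = "\<lambda>k. f (e k)"])
    fix x assume "x \<in> carrier L"
    then show "f (g x) = (\<Oplus>\<^bsub>L\<^esub>k\<in>{..<n}. \<phi> k (g x) \<odot>\<^bsub>L\<^esub> f (e k))"
      using assms by (simp add: endo_closed flip: endo_expand)
  qed (use assms in \<open>auto intro: endo_comp simp: endo_closed endo_add endo_smult phi_add phi_smult\<close>)
  then show ?thesis by (simp add: tr_def)
qed

lemma phi_dual: "i < n \<Longrightarrow> (\<lambda>x\<in>carrier L. \<phi> i x) \<in> dual A L"
  by (auto simp: dual_def mod_hom_def self_module_def phi_add phi_smult)

lemma dualD:
  assumes "\<psi> \<in> dual A L"
  shows "x \<in> carrier L \<Longrightarrow> \<psi> x \<in> carrier A"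
    and "\<lbrakk>x \<in> carrier L; y \<in> carrier L\<rbrakk> \<Longrightarrow> \<psi> (x \<oplus>\<^bsub>L\<^esub> y) = \<psi> x \<oplus> \<psi> y"
    and "\<lbrakk>a \<in> carrier A; x \<in> carrier L\<rbrakk> \<Longrightarrow> \<psi> (a \<odot>\<^bsub>L\<^esub> x) = a \<otimes> \<psi> x"
  using assms by (auto simp: dual_def mod_hom_def self_module_def)

text \<open>In the definite description of \<open>mod_trace\<close>, existence comes from
  \<open>endo_expand\<close> and uniqueness from \<open>tr_rank_one_sum\<close>.\<close>

lemma mod_trace_eq:
  assumes "endo f"
  shows "mod_trace A L f = tr f"
  unfolding mod_trace_def
proof (rule the_equality)
  show "\<exists>(m::nat) v \<psi>. (\<forall>i<m. v i \<in> carrier L \<and> \<psi> i \<in> dual A L) \<and>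
       (\<forall>x\<in>carrier L. f x = (\<Oplus>\<^bsub>L\<^esub>i\<in>{..<m}. \<psi> i x \<odot>\<^bsub>L\<^esub> v i)) \<and> tr f = (\<Oplus>i\<in>{..<m}. \<psi> i (v i))"
  \<comment> \<open>Members of \<open>dual\<close> are extensional, hence the restricted
    functionals.\<close>
  proof (rule exI[of _ n], rule exI[of _ "\<lambda>i. f (e i)"], rule exI[of _ "\<lambda>i. \<lambda>x\<in>carrier L. \<phi> i x"], intro conjI ballI allI impI)
    fix x assume "x \<in> carrier L"
    then have "f x = (\<Oplus>\<^bsub>L\<^esub>i\<in>{..<n}. \<phi> i x \<odot>\<^bsub>L\<^esub> f (e i))"
      using assms by (simp add: endo_expand)
    then show "f x = (\<Oplus>\<^bsub>L\<^esub>i\<in>{..<n}. (\<lambda>x\<in>carrier L. \<phi> i x) x \<odot>\<^bsub>L\<^esub> f (e i))"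
      using \<open>x \<in> carrier L\<close> by simp
  qed (use assms in \<open>auto simp: endo_closed tr_def phi_dual intro!: R.finsum_cong_closed\<close>)
next
  fix t
  assume "\<exists>(m::nat) v \<psi>. (\<forall>i<m. v i \<in> carrier L \<and> \<psi> i \<in> dual A L) \<and>
       (\<forall>x\<in>carrier L. f x = (\<Oplus>\<^bsub>L\<^esub>i\<in>{..<m}. \<psi> i x \<odot>\<^bsub>L\<^esub> v i)) \<and> t = (\<Oplus>i\<in>{..<m}. \<psi> i (v i))"
  then obtain m :: nat and v \<psi> where *: "\<forall>i<m. v i \<in> carrier L \<and> \<psi> i \<in> dual A L"
    "\<forall>x\<in>carrier L. f x = (\<Oplus>\<^bsub>L\<^esub>i\<in>{..<m}. \<psi> i x \<odot>\<^bsub>L\<^esub> v i)" "t = (\<Oplus>i\<in>{..<m}. \<psi> i (v i))"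
    by (elim exE conjE)
  have "tr f = (\<Oplus>i\<in>{..<m}. \<psi> i (v i))"
  proof (rule tr_rank_one_sum[OF assms])
    fix k assume k: "k < m"
    then have \<psi>: "\<psi> k \<in> dual A L" using *(1) by blast
    show "v k \<in> carrier L" using *(1) k by blast
    show "\<psi> k x \<in> carrier A" if "x \<in> carrier L" for x
      using dualD(1)[OF \<psi>] that .
    show "\<psi> k (x \<oplus>\<^bsub>L\<^esub> y) = \<psi> k x \<oplus> \<psi> k y" if "x \<in> carrier L" "y \<in> carrier L" for x y
      using dualD(2)[OF \<psi>] that .
    show "\<psi> k (a \<odot>\<^bsub>L\<^esub> x) = a \<otimes> \<psi> k x" if "a \<in> carrier A" "x \<in> carrier L" for a x
      using dualD(3)[OF \<psi>] that .
  qed (use *(2) in blast)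
  then show "t = tr f" using *(3) by simp
qed

abbreviation \<kappa> :: "'g \<Rightarrow> 'g \<Rightarrow> 'a"
  where "\<kappa> x y \<equiv> tr (\<lambda>z. lie L x (lie L y z))"

lemma endo_ad_ad: "\<lbrakk>x \<in> carrier L; y \<in> carrier L\<rbrakk> \<Longrightarrow> endo (\<lambda>z. lie L x (lie L y z))"
  by (rule endo_comp[OF endo_ad endo_ad])

lemma killing_form_eq: "\<lbrakk>x \<in> carrier L; y \<in> carrier L\<rbrakk> \<Longrightarrow> killing_form A L x y = \<kappa> x y"
  unfolding killing_form_def using mod_trace_eq[OF endo_ad_ad] by (simp add: comp_def)

lemma kappa_comm: "\<lbrakk>x \<in> carrier L; y \<in> carrier L\<rbrakk> \<Longrightarrow> \<kappa> x y = \<kappa> y x"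
  by (intro tr_comm endo_ad)

lemma kappa_add:
  assumes "x \<in> carrier L" "y \<in> carrier L" "z \<in> carrier L"
  shows "\<kappa> (x \<oplus>\<^bsub>L\<^esub> y) z = \<kappa> x z \<oplus> \<kappa> y z"
proof -
  have "\<kappa> (x \<oplus>\<^bsub>L\<^esub> y) z = tr (\<lambda>w. lie L x (lie L z w) \<oplus>\<^bsub>L\<^esub> lie L y (lie L z w))"
    using assms by (intro tr_cong) (auto simp: endo_def lie_add_left lie_add_right lie_closed lie_smult_right M.a_ac smult_r_distr)
  then show ?thesis using assms by (simp add: tr_add endo_ad_ad)
qed

lemma kappa_smult:
  assumes "a \<in> carrier A" "x \<in> carrier L" "z \<in> carrier L"
  shows "\<kappa> (a \<odot>\<^bsub>L\<^esub> x) z = a \<otimes> \<kappa> x z"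
proof -
  have "\<kappa> (a \<odot>\<^bsub>L\<^esub> x) z = tr (\<lambda>w. a \<odot>\<^bsub>L\<^esub> lie L x (lie L z w))"
    using assms by (intro tr_cong) (auto simp: endo_def lie_smult_left lie_add_right lie_closed lie_smult_right smult_r_distr smult_assoc1[symmetric] R.m_comm)
  then show ?thesis using assms by (simp add: tr_smult endo_ad_ad)
qed

lemma kappa_finsum:
  "\<lbrakk>\<And>i. i \<in> I \<Longrightarrow> f i \<in> carrier L; y \<in> carrier L\<rbrakk> \<Longrightarrow> \<kappa> (finsum L f I) y = (\<Oplus>i\<in>I. \<kappa> (f i) y)"
  by (rule additive_finsum[OF L_abelian A_abelian, where h = "\<lambda>x. \<kappa> x y"]) (auto simp: kappa_add endo_ad_ad)

text \<open>Write ad [x, y] as the commutator of ad x and ad y. In the term with ad y in front,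
  cyclicity of the trace moves ad y to the end, which leaves ad x composed with ad [y, z].\<close>

lemma kappa_invariant:
  assumes "x \<in> carrier L" "y \<in> carrier L" "z \<in> carrier L"
  shows "\<kappa> (lie L x y) z = \<kappa> x (lie L y z)"
proof -
  have l: "lie L (lie L x y) w = lie L x (lie L y w) \<ominus>\<^bsub>L\<^esub> lie L y (lie L x w)"
    if "x \<in> carrier L" "y \<in> carrier L" "w \<in> carrier L" for x y w
    using leibniz[of x y w] that by (simp add: a_minus_def lie_closed M.a_assoc M.r_neg)
  have E: "endo (\<lambda>w. lie L a (lie L b (lie L c w)))" if "a \<in> carrier L" "b \<in> carrier L" "c \<in> carrier L" for a b c
    using that by (rule endo_comp[OF endo_ad endo_ad_ad])
  have "\<kappa> (lie L x y) z = tr (\<lambda>w. lie L x (lie L y (lie L z w)) \<ominus>\<^bsub>L\<^esub> lie L y (lie L x (lie L z w)))"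
    using assms by (intro tr_cong) (auto simp: l lie_closed intro!: endo_diff E)
  also have "\<dots> = tr (\<lambda>w. lie L x (lie L y (lie L z w))) \<ominus> tr (\<lambda>w. lie L y (lie L x (lie L z w)))"
    using assms by (intro tr_minus E)
  also have "tr (\<lambda>w. lie L y (lie L x (lie L z w))) = tr (\<lambda>w. lie L x (lie L z (lie L y w)))"
    using assms by (intro tr_comm[where g = "\<lambda>w. lie L x (lie L z w)"] endo_ad endo_ad_ad)
  also have "tr (\<lambda>w. lie L x (lie L y (lie L z w))) \<ominus> tr (\<lambda>w. lie L x (lie L z (lie L y w)))
    = tr (\<lambda>w. lie L x (lie L y (lie L z w)) \<ominus>\<^bsub>L\<^esub> lie L x (lie L z (lie L y w)))"
    using assms by (intro tr_minus[symmetric] E)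
  also have "\<dots> = \<kappa> x (lie L y z)"
    using assms by (intro tr_cong) (auto simp: l lie_closed lie_minus_right intro!: endo_ad_ad)
  finally show ?thesis .
qed

text \<open>The second clause says that the Casimir element acts as the identity on the adjoint
  module; the third that the tensor sum of e_i (x) e'_i is invariant, with the matrix
  \<open>k\<close> of x on the e_i reappearing transposed on the e'_i. No bilinear form is
  mentioned, so that both clauses survive base change by linearity.\<close>

definition casimir :: "(nat \<Rightarrow> 'g) \<Rightarrow> bool"
  where "casimir e' \<longleftrightarrow> (\<forall>i<n. e' i \<in> carrier L) \<and>
    (\<forall>x\<in>carrier L. (\<Oplus>\<^bsub>L\<^esub>i\<in>{..<n}. lie L (e i) (lie L (e' i) x)) = x) \<and>
    (\<forall>x\<in>carrier L. \<exists>k. (\<forall>i<n. \<forall>j<n. k i j \<in> carrier A) \<and>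
      (\<forall>i<n. lie L (e i) x = (\<Oplus>\<^bsub>L\<^esub>j\<in>{..<n}. k i j \<odot>\<^bsub>L\<^esub> e j)) \<and>
      (\<forall>j<n. lie L x (e' j) = (\<Oplus>\<^bsub>L\<^esub>i\<in>{..<n}. k i j \<odot>\<^bsub>L\<^esub> e' i)))"

text \<open>\<open>e' i\<close> is the element that represents \<open>\<phi> i\<close> through the
  Killing form. Since the form separates points, identities between elements are checked by pairing
  with a test element.\<close>

lemma casimir_exists:
  assumes "perfect_killing_form A L"
  shows "\<exists>e'. casimir e'"
proof -
  let ?K = "\<lambda>a. \<lambda>b\<in>carrier L. killing_form A L a b"
  have bij: "bij_betw ?K (carrier L) (dual A L)"
    using assms by (simp add: perfect_killing_form_def)
  have inj: "x = y" if "x \<in> carrier L" "y \<in> carrier L" "\<And>z. z \<in> carrier L \<Longrightarrow> \<kappa> x z = \<kappa> y z" for x y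
  proof -
    have "?K x = ?K y" using that by (auto simp: killing_form_eq)
    then show ?thesis using bij that by (auto simp: bij_betw_def inj_on_def)
  qed
  have "\<forall>i\<in>{..<n}. \<exists>v\<in>carrier L. ?K v = (\<lambda>x\<in>carrier L. \<phi> i x)"
  proof
    fix i assume "i \<in> {..<n}"
    then have "(\<lambda>x\<in>carrier L. \<phi> i x) \<in> ?K ` carrier L"
      using bij phi_dual by (simp add: bij_betw_def)
    then show "\<exists>v\<in>carrier L. ?K v = (\<lambda>x\<in>carrier L. \<phi> i x)"
      by (metis (no_types, lifting) image_iff)
  qed
  then obtain e' where e': "\<And>i. i < n \<Longrightarrow> e' i \<in> carrier L"
    and K: "\<And>i. i < n \<Longrightarrow> ?K (e' i) = (\<lambda>x\<in>carrier L. \<phi> i x)"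
    by (metis lessThan_iff)
  have phi: "\<kappa> (e' i) x = \<phi> i x" if "i < n" "x \<in> carrier L" for i x
    using fun_cong[OF K[OF that(1)], of x] that e' by (simp add: killing_form_eq)
  have cl: "\<kappa> x y \<in> carrier A" if "x \<in> carrier L" "y \<in> carrier L" for x y
    using that by (simp add: endo_ad_ad)
  \<comment> \<open>The \<open>e' i\<close> and the functionals \<open>\<kappa> (e i)\<close> form a
    second dual basis: pairing with \<open>z\<close> gives the expansion of the functional
    \<open>\<kappa> z x\<close> of \<open>z\<close>.\<close>
  have expand': "(\<Oplus>\<^bsub>L\<^esub>i\<in>{..<n}. \<kappa> (e i) x \<odot>\<^bsub>L\<^esub> e' i) = x" if x: "x \<in> carrier L" for x
  proof (rule inj)
    fix z assume z: "z \<in> carrier L"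
    have "\<kappa> (\<Oplus>\<^bsub>L\<^esub>i\<in>{..<n}. \<kappa> (e i) x \<odot>\<^bsub>L\<^esub> e' i) z = (\<Oplus>i\<in>{..<n}. \<kappa> (\<kappa> (e i) x \<odot>\<^bsub>L\<^esub> e' i) z)"
      using x z e' cl by (intro kappa_finsum) auto
    also have "\<dots> = (\<Oplus>i\<in>{..<n}. \<phi> i z \<otimes> \<kappa> (e i) x)"
      using x z e' cl by (intro R.finsum_cong_closed) (auto simp: kappa_smult phi R.m_comm)
    also have "\<dots> = \<kappa> z x"
      using x z cl by (intro functional_expand[symmetric, where g = "\<lambda>z. \<kappa> z x"]) (auto simp: kappa_add kappa_smult)
    finally show "\<kappa> (\<Oplus>\<^bsub>L\<^esub>i\<in>{..<n}. \<kappa> (e i) x \<odot>\<^bsub>L\<^esub> e' i) z = \<kappa> x z"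
      using x z by (simp add: kappa_comm)
  qed (use x e' cl in \<open>auto intro!: M.finsum_closed\<close>)
  \<comment> \<open>Moving brackets across the form turns the i-th term, paired with
    \<open>y\<close>, into the i-th diagonal entry of ad x composed with ad y. The sum is the trace
    \<kappa>(x, y) itself, so the eigenvalue is 1.\<close>
  have cas: "(\<Oplus>\<^bsub>L\<^esub>i\<in>{..<n}. lie L (e i) (lie L (e' i) x)) = x" if x: "x \<in> carrier L" for x
  proof (rule inj)
    fix y assume y: "y \<in> carrier L"
    have "\<kappa> (lie L (e i) (lie L (e' i) x)) y = \<phi> i (lie L x (lie L y (e i)))" if i: "i < n" for i
    proof -
      have "\<kappa> (lie L (e i) (lie L (e' i) x)) y = \<kappa> (lie L (lie L (e' i) x) y) (e i)"
        using x y i e' kappa_comm[of "e i"] by (simp add: kappa_invariant lie_closed)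
      also have "\<dots> = \<kappa> (e' i) (lie L x (lie L y (e i)))"
        using x y i e' by (simp add: kappa_invariant lie_closed)
      finally show ?thesis using x y i by (simp add: phi lie_closed)
    qed
    then have "\<kappa> (\<Oplus>\<^bsub>L\<^esub>i\<in>{..<n}. lie L (e i) (lie L (e' i) x)) y = (\<Oplus>i\<in>{..<n}. \<phi> i (lie L x (lie L y (e i))))"
      using x y e' by (subst kappa_finsum) (auto simp: lie_closed intro!: R.finsum_cong_closed)
    then show "\<kappa> (\<Oplus>\<^bsub>L\<^esub>i\<in>{..<n}. lie L (e i) (lie L (e' i) x)) y = \<kappa> x y"
      by (simp add: tr_def)
  qed (use x e' in \<open>auto intro!: M.finsum_closed lie_closed\<close>)
  have "\<exists>k. (\<forall>i<n. \<forall>j<n. k i j \<in> carrier A) \<and>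
      (\<forall>i<n. lie L (e i) x = (\<Oplus>\<^bsub>L\<^esub>j\<in>{..<n}. k i j \<odot>\<^bsub>L\<^esub> e j)) \<and>
      (\<forall>j<n. lie L x (e' j) = (\<Oplus>\<^bsub>L\<^esub>i\<in>{..<n}. k i j \<odot>\<^bsub>L\<^esub> e' i))" if x: "x \<in> carrier L" for x
  \<comment> \<open>The first relation is \<open>expand\<close> for [e_i, x]. By invariance the same
    coefficients are \<open>\<kappa> (e i) (lie L x (e' j))\<close>, the coordinates in
    \<open>expand'\<close>.\<close>
  proof (intro exI[of _ "\<lambda>i j. \<phi> j (lie L (e i) x)"] conjI allI impI)
    fix j assume j: "j < n"
    have "\<phi> j (lie L (e i) x) = \<kappa> (e i) (lie L x (e' j))" if i: "i < n" for i
    proof -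
      have "\<phi> j (lie L (e i) x) = \<kappa> (lie L (e i) x) (e' j)"
        using x i j e' by (simp add: lie_closed kappa_comm flip: phi)
      then show ?thesis using x i j e' by (simp add: kappa_invariant)
    qed
    then have "(\<Oplus>\<^bsub>L\<^esub>i\<in>{..<n}. \<phi> j (lie L (e i) x) \<odot>\<^bsub>L\<^esub> e' i) = (\<Oplus>\<^bsub>L\<^esub>i\<in>{..<n}. \<kappa> (e i) (lie L x (e' j)) \<odot>\<^bsub>L\<^esub> e' i)"
      using x j e' cl by (intro M.finsum_cong_closed) (auto simp: lie_closed)
    then show "lie L x (e' j) = (\<Oplus>\<^bsub>L\<^esub>i\<in>{..<n}. \<phi> j (lie L (e i) x) \<odot>\<^bsub>L\<^esub> e' i)"
      using x j e' by (simp add: expand' lie_closed)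
  qed (use x in \<open>auto simp: lie_closed expand\<close>)
  then have "casimir e'"
    using e' cas by (simp add: casimir_def)
  then show ?thesis by blast
qed

end

section \<open>Lifting approximate automorphisms\<close>

lemma (in abelian_group) eq_if_minus_zero:
  assumes "x \<ominus> y = \<zero>" "x \<in> carrier G" "y \<in> carrier G"
  shows "x = y"
proof -
  have "x = (x \<ominus> y) \<oplus> y"
    using assms(2,3) by (simp add: a_minus_def a_assoc l_neg)
  then show ?thesis using assms by simp
qed

section \<open>Elements with coordinates in an ideal; lifting modulo an ideal of square zero\<close>

context lie_fg
begin

text \<open>For an ideal \<open>J\<close> this is the submodule \<open>J\<close> L: by
  \<open>expand\<close> such an element is a combination of the generators with coefficients in
  \<open>J\<close>, and linearity of the \<open>\<phi> i\<close> gives the converse.\<close>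

definition ext :: "'a set \<Rightarrow> 'g set"
  where "ext J = {x \<in> carrier L. \<forall>i<n. \<phi> i x \<in> J}"

lemma ext_carrier: "x \<in> ext J \<Longrightarrow> x \<in> carrier L"
  by (simp add: ext_def)

text \<open>For the zero ideal, congruence modulo \<open>ext J\<close> becomes equality; exact
  statements are obtained in this way from approximate ones.\<close>

lemma ext_zero_ideal: "ext {\<zero>} = {\<zero>\<^bsub>L\<^esub>}"
proof -
  have "x = \<zero>\<^bsub>L\<^esub>" if "x \<in> ext {\<zero>}" for x
    using that by (intro eq_by_phi) (auto simp: ext_def phi_zero)
  then show ?thesis by (auto simp: ext_def phi_zero)
qed

context
  fixes J
  assumes J: "ideal J A"
begin

lemma J_carrier: "a \<in> J \<Longrightarrow> a \<in> carrier A"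
  using additive_subgroup.a_subset[OF ideal.axioms(1)[OF J]] by auto

lemma J_add: "\<lbrakk>a \<in> J; b \<in> J\<rbrakk> \<Longrightarrow> a \<oplus> b \<in> J"
  by (rule additive_subgroup.a_closed[OF ideal.axioms(1)[OF J]])

lemma J_neg: "a \<in> J \<Longrightarrow> \<ominus> a \<in> J"
  by (rule additive_subgroup.a_inv_closed[OF ideal.axioms(1)[OF J]])

lemma J_zero: "\<zero> \<in> J"
  by (rule additive_subgroup.zero_closed[OF ideal.axioms(1)[OF J]])

lemma J_mult: "\<lbrakk>a \<in> J; b \<in> carrier A\<rbrakk> \<Longrightarrow> a \<otimes> b \<in> J" "\<lbrakk>a \<in> J; b \<in> carrier A\<rbrakk> \<Longrightarrow> b \<otimes> a \<in> J"
  by (rule ideal.I_r_closed[OF J] ideal.I_l_closed[OF J]; assumption)+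

lemma ext_add: "\<lbrakk>x \<in> ext J; y \<in> ext J\<rbrakk> \<Longrightarrow> x \<oplus>\<^bsub>L\<^esub> y \<in> ext J"
  by (simp add: ext_def phi_add J_add)

lemma ext_neg: "x \<in> ext J \<Longrightarrow> \<ominus>\<^bsub>L\<^esub> x \<in> ext J"
  by (simp add: ext_def phi_neg J_neg)

lemma ext_zero: "\<zero>\<^bsub>L\<^esub> \<in> ext J"
  by (simp add: ext_def phi_zero J_zero)

lemma ext_smult: "\<lbrakk>a \<in> carrier A; x \<in> ext J\<rbrakk> \<Longrightarrow> a \<odot>\<^bsub>L\<^esub> x \<in> ext J"
  by (simp add: ext_def phi_smult J_mult)

lemma ext_smult': "\<lbrakk>a \<in> J; x \<in> carrier L\<rbrakk> \<Longrightarrow> a \<odot>\<^bsub>L\<^esub> x \<in> ext J"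
  by (simp add: ext_def phi_smult J_mult J_carrier)

lemma ext_finsum:
  assumes "\<And>i. i \<in> I \<Longrightarrow> f i \<in> ext J"
  shows "finsum L f I \<in> ext J"
  using assms
proof (induct I rule: infinite_finite_induct)
  case (insert i I)
  then have "f \<in> I \<rightarrow> carrier L" "f i \<in> carrier L" using ext_carrier by blast+
  with insert show ?case by (simp add: ext_add)
qed (auto simp: ext_zero)

text \<open>In \<open>endo_expand\<close> the coefficients of \<open>f x\<close> are the coordinates
  of \<open>x\<close>, which lie in \<open>J\<close>.\<close>

lemma endo_ext:
  assumes "endo f" "x \<in> ext J"
  shows "f x \<in> ext J"
proof -
  have "(\<Oplus>\<^bsub>L\<^esub>i\<in>{..<n}. \<phi> i x \<odot>\<^bsub>L\<^esub> f (e i)) \<in> ext J"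
    using assms by (intro ext_finsum ext_smult') (auto simp: ext_def endo_closed)
  then show ?thesis using assms by (simp add: ext_carrier flip: endo_expand)
qed

lemma lie_ext: "\<lbrakk>x \<in> carrier L; y \<in> ext J\<rbrakk> \<Longrightarrow> lie L x y \<in> ext J" "\<lbrakk>x \<in> carrier L; y \<in> ext J\<rbrakk> \<Longrightarrow> lie L y x \<in> ext J"
  by (auto intro: endo_ext[OF endo_ad] endo_ext[OF endo_ad'])

lemma endo_ext_range:
  assumes "endo f" "\<And>j. j < n \<Longrightarrow> f (e j) \<in> ext J" "x \<in> carrier L"
  shows "f x \<in> ext J"
proof -
  have "(\<Oplus>\<^bsub>L\<^esub>i\<in>{..<n}. \<phi> i x \<odot>\<^bsub>L\<^esub> f (e i)) \<in> ext J"
    using assms by (intro ext_finsum ext_smult) auto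
  then show ?thesis using assms by (simp flip: endo_expand)
qed

context
  assumes J2: "\<And>a b. \<lbrakk>a \<in> J; b \<in> J\<rbrakk> \<Longrightarrow> a \<otimes> b = \<zero>"
begin

lemma smult_ext_null:
  assumes "a \<in> J" "x \<in> ext J"
  shows "a \<odot>\<^bsub>L\<^esub> x = \<zero>\<^bsub>L\<^esub>"
  using assms by (intro eq_by_phi) (auto simp: ext_def J_carrier phi_smult phi_zero J2)

text \<open>In \<open>endo_expand\<close> the coefficients lie in \<open>J\<close> and the vectors
  in \<open>ext J\<close>, so every term has coordinates in the square of \<open>J\<close>. This is
  how the square-zero condition is used below.\<close>

lemma endo_ext_null:
  assumes "endo f" "\<And>x. x \<in> carrier L \<Longrightarrow> f x \<in> ext J" "x \<in> ext J"
  shows "f x = \<zero>\<^bsub>L\<^esub>"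
proof -
  have "f x = (\<Oplus>\<^bsub>L\<^esub>i\<in>{..<n}. \<phi> i x \<odot>\<^bsub>L\<^esub> f (e i))"
    using assms by (intro endo_expand) (auto simp: ext_carrier)
  also have "\<dots> = (\<Oplus>\<^bsub>L\<^esub>i\<in>{..<n}. \<zero>\<^bsub>L\<^esub>)"
    using assms by (intro M.finsum_cong_closed smult_ext_null) (auto simp: ext_def)
  finally show ?thesis by (simp add: M.finsum_zero)
qed

lemma lie_ext_ext: "\<lbrakk>x \<in> ext J; y \<in> ext J\<rbrakk> \<Longrightarrow> lie L x y = \<zero>\<^bsub>L\<^esub>"
  by (rule endo_ext_null[OF endo_ad]) (auto intro: lie_ext simp: ext_carrier)

text \<open>The two composites are 1 + \<nu> and 1 + \<mu>, where \<nu> and \<mu> take values in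
  \<open>ext J\<close> and vanish there. A kernel element x has \<mu> x = -x, so it lies in
  \<open>ext J\<close>, where \<mu> is zero; hence x = 0.\<close>

lemma near_inverse_bij:
  assumes \<tau>: "endo \<tau>" and \<delta>: "endo \<delta>"
    and r: "\<And>x. x \<in> carrier L \<Longrightarrow> \<tau> (\<delta> x) \<ominus>\<^bsub>L\<^esub> x \<in> ext J"
    and l: "\<And>x. x \<in> carrier L \<Longrightarrow> \<delta> (\<tau> x) \<ominus>\<^bsub>L\<^esub> x \<in> ext J"
  shows "bij_betw \<tau> (carrier L) (carrier L)"
proof -
  define \<nu> where "\<nu> x = \<tau> (\<delta> x) \<ominus>\<^bsub>L\<^esub> x" for x
  define \<mu> where "\<mu> x = \<delta> (\<tau> x) \<ominus>\<^bsub>L\<^esub> x" for x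
  have \<nu>: "endo \<nu>" unfolding \<nu>_def by (rule endo_diff[OF endo_comp[OF \<tau> \<delta>] endo_id])
  have \<mu>: "endo \<mu>" unfolding \<mu>_def by (rule endo_diff[OF endo_comp[OF \<delta> \<tau>] endo_id])
  have \<nu>J: "\<nu> x \<in> ext J" and \<mu>J: "\<mu> x \<in> ext J" if "x \<in> carrier L" for x
    using l r that by (auto simp: \<nu>_def \<mu>_def)
  note cl = endo_closed[OF \<tau>] endo_closed[OF \<delta>]
  have inj: "x = \<zero>\<^bsub>L\<^esub>" if x: "x \<in> carrier L" "\<tau> x = \<zero>\<^bsub>L\<^esub>" for x
  proof -
    have \<mu>x: "\<mu> x = \<ominus>\<^bsub>L\<^esub> x"
      using x by (simp add: \<mu>_def endo_zero[OF \<delta>] a_minus_def)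
    then have "\<ominus>\<^bsub>L\<^esub> (\<ominus>\<^bsub>L\<^esub> x) \<in> ext J" using \<mu>J[OF x(1)] ext_neg by simp
    then have "\<mu> x = \<zero>\<^bsub>L\<^esub>" using x(1) by (intro endo_ext_null[OF \<mu> \<mu>J]) auto
    then have "\<ominus>\<^bsub>L\<^esub> x = \<zero>\<^bsub>L\<^esub>" using \<mu>x by simp
    then show ?thesis using x(1) M.add.inv_eq_1_iff by blast
  qed
  have "inj_on \<tau> (carrier L)"
  proof (rule inj_onI)
    fix x y assume xy: "x \<in> carrier L" "y \<in> carrier L" "\<tau> x = \<tau> y"
    have "x \<ominus>\<^bsub>L\<^esub> y = \<zero>\<^bsub>L\<^esub>"
      by (rule inj) (use xy in \<open>auto simp: endo_minus[OF \<tau>] cl M.r_neg a_minus_def[of L "\<tau> y"]\<close>)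
    then show "x = y" by (rule M.eq_if_minus_zero) (rule xy)+
  qed
  moreover have "\<tau> ` carrier L = carrier L"
  proof
    show "\<tau> ` carrier L \<subseteq> carrier L" using cl by auto
    show "carrier L \<subseteq> \<tau> ` carrier L"
    proof
      fix y assume y: "y \<in> carrier L"
      have ny: "\<nu> y \<in> carrier L" using y \<nu>J ext_carrier by blast
      have td: "\<tau> (\<delta> x) = x \<oplus>\<^bsub>L\<^esub> \<nu> x" if "x \<in> carrier L" for x
        using that by (simp add: \<nu>_def a_minus_def cl M.a_ac M.r_neg2 M.r_neg1 M.r_neg M.l_neg)
      \<comment> \<open>As the square of \<nu> vanishes, 1 - \<nu> inverts 1 + \<nu>; so applying
        \<delta> to y - \<nu> y gives a preimage of y.\<close>
      have "\<nu> (\<nu> y) = \<zero>\<^bsub>L\<^esub>" by (rule endo_ext_null[OF \<nu> \<nu>J \<nu>J[OF y]])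
      then have "\<nu> (y \<ominus>\<^bsub>L\<^esub> \<nu> y) = \<nu> y"
        using y ny by (simp add: endo_minus[OF \<nu>]) (simp add: a_minus_def)
      then have "\<tau> (\<delta> (y \<ominus>\<^bsub>L\<^esub> \<nu> y)) = y"
        using y ny by (simp add: td) (simp add: a_minus_def M.a_assoc M.l_neg)
      then show "y \<in> \<tau> ` carrier L"
        using y ny cl by (metis M.minus_closed imageI)
    qed
  qed
  ultimately show ?thesis by (simp add: bij_betw_def)
qed

text \<open>Invariance of the tensor sum of e_i (x) e'_i under ad x, evaluated on a bilinear map
  \<beta>. Both sides expand to the same double sum over the matrix \<open>k\<close> of
  \<open>x\<close>.\<close>

lemma casimir_swap:
  assumes cas: "casimir e'" and x: "x \<in> carrier L"
    and b1: "\<And>y. y \<in> carrier L \<Longrightarrow> endo (\<lambda>z. \<beta> z y)" and b2: "\<And>y. y \<in> carrier L \<Longrightarrow> endo (\<beta> y)"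
  shows "(\<Oplus>\<^bsub>L\<^esub>i\<in>{..<n}. \<beta> (lie L (e i) x) (e' i)) = (\<Oplus>\<^bsub>L\<^esub>i\<in>{..<n}. \<beta> (e i) (lie L x (e' i)))"
proof -
  have "\<exists>k. (\<forall>i<n. \<forall>j<n. k i j \<in> carrier A) \<and>
      (\<forall>i<n. lie L (e i) x = (\<Oplus>\<^bsub>L\<^esub>j\<in>{..<n}. k i j \<odot>\<^bsub>L\<^esub> e j)) \<and>
      (\<forall>j<n. lie L x (e' j) = (\<Oplus>\<^bsub>L\<^esub>i\<in>{..<n}. k i j \<odot>\<^bsub>L\<^esub> e' i))"
    using cas x unfolding casimir_def by (elim conjE) (drule (1) bspec)+
  then obtain k where "\<forall>i<n. \<forall>j<n. k i j \<in> carrier A"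
    "\<forall>i<n. lie L (e i) x = (\<Oplus>\<^bsub>L\<^esub>j\<in>{..<n}. k i j \<odot>\<^bsub>L\<^esub> e j)"
    "\<forall>j<n. lie L x (e' j) = (\<Oplus>\<^bsub>L\<^esub>i\<in>{..<n}. k i j \<odot>\<^bsub>L\<^esub> e' i)"
    by (elim exE conjE)
  note k = this(1)[rule_format] and k1 = this(2)[rule_format] and k2 = this(3)[rule_format]
  have e': "\<And>i. i < n \<Longrightarrow> e' i \<in> carrier L" using cas by (simp add: casimir_def)
  have cl: "\<beta> y z \<in> carrier L" if "y \<in> carrier L" "z \<in> carrier L" for y z
    using endo_closed[OF b2] that by simp
  have "(\<Oplus>\<^bsub>L\<^esub>i\<in>{..<n}. \<beta> (lie L (e i) x) (e' i)) = (\<Oplus>\<^bsub>L\<^esub>i\<in>{..<n}. \<Oplus>\<^bsub>L\<^esub>j\<in>{..<n}. k i j \<odot>\<^bsub>L\<^esub> \<beta> (e j) (e' i))"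
  proof (intro M.finsum_cong_closed)
    fix i assume i: "i \<in> {..<n}"
    have "\<beta> (lie L (e i) x) (e' i) = (\<Oplus>\<^bsub>L\<^esub>j\<in>{..<n}. \<beta> (k i j \<odot>\<^bsub>L\<^esub> e j) (e' i))"
      using endo_finsum[OF b1[of "e' i"], of "{..<n}" "\<lambda>j. k i j \<odot>\<^bsub>L\<^esub> e j"] i e' k by (simp add: k1)
    also have "\<dots> = (\<Oplus>\<^bsub>L\<^esub>j\<in>{..<n}. k i j \<odot>\<^bsub>L\<^esub> \<beta> (e j) (e' i))"
      using i e' k cl by (intro M.finsum_cong_closed) (auto simp: endo_smult[OF b1])
    finally show "\<beta> (lie L (e i) x) (e' i) = (\<Oplus>\<^bsub>L\<^esub>j\<in>{..<n}. k i j \<odot>\<^bsub>L\<^esub> \<beta> (e j) (e' i))" .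
  qed (use e' k cl in \<open>auto intro!: M.finsum_closed\<close>)
  also have "\<dots> = (\<Oplus>\<^bsub>L\<^esub>j\<in>{..<n}. \<Oplus>\<^bsub>L\<^esub>i\<in>{..<n}. k i j \<odot>\<^bsub>L\<^esub> \<beta> (e j) (e' i))"
    using e' k cl by (intro M.finsum_swap) auto
  also have "\<dots> = (\<Oplus>\<^bsub>L\<^esub>j\<in>{..<n}. \<beta> (e j) (lie L x (e' j)))"
  proof (intro M.finsum_cong_closed)
    fix j assume j: "j \<in> {..<n}"
    have "\<beta> (e j) (lie L x (e' j)) = (\<Oplus>\<^bsub>L\<^esub>i\<in>{..<n}. \<beta> (e j) (k i j \<odot>\<^bsub>L\<^esub> e' i))"
      using endo_finsum[OF b2[of "e j"], of "{..<n}" "\<lambda>i. k i j \<odot>\<^bsub>L\<^esub> e' i"] j e' k by (simp add: k2)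
    also have "\<dots> = (\<Oplus>\<^bsub>L\<^esub>i\<in>{..<n}. k i j \<odot>\<^bsub>L\<^esub> \<beta> (e j) (e' i))"
      using j e' k cl by (intro M.finsum_cong_closed) (auto simp: endo_smult[OF b2])
    finally show "(\<Oplus>\<^bsub>L\<^esub>i\<in>{..<n}. k i j \<odot>\<^bsub>L\<^esub> \<beta> (e j) (e' i)) = \<beta> (e j) (lie L x (e' j))" by simp
  qed (use x e' cl in \<open>auto simp: lie_closed\<close>)
  finally show ?thesis .
qed

text \<open>\<delta> is an inverse of \<theta> only modulo \<open>ext J\<close>. It serves to
  transport the Casimir identity to \<open>ext J\<close> with the action through \<theta>, and to
  prove that the corrected map is bijective.\<close>

lemma lift_automorphism:
  assumes cas: "casimir e'" and \<theta>: "endo \<theta>" and \<delta>: "endo \<delta>"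
    and r: "\<And>x. x \<in> carrier L \<Longrightarrow> \<theta> (\<delta> x) \<ominus>\<^bsub>L\<^esub> x \<in> ext J"
    and l: "\<And>x. x \<in> carrier L \<Longrightarrow> \<delta> (\<theta> x) \<ominus>\<^bsub>L\<^esub> x \<in> ext J"
    and br: "\<And>x y. \<lbrakk>x \<in> carrier L; y \<in> carrier L\<rbrakk> \<Longrightarrow> \<theta> (lie L x y) \<ominus>\<^bsub>L\<^esub> lie L (\<theta> x) (\<theta> y) \<in> ext J"
  obtains \<tau> where "endo \<tau>" "bij_betw \<tau> (carrier L) (carrier L)"
    "\<And>x y. \<lbrakk>x \<in> carrier L; y \<in> carrier L\<rbrakk> \<Longrightarrow> \<tau> (lie L x y) = lie L (\<tau> x) (\<tau> y)"
    "\<And>x. x \<in> carrier L \<Longrightarrow> \<tau> x \<ominus>\<^bsub>L\<^esub> \<theta> x \<in> ext J"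
proof -
  define c where "c x y = lie L (\<theta> x) (\<theta> y) \<ominus>\<^bsub>L\<^esub> \<theta> (lie L x y)" for x y
  define \<psi> where "\<psi> x = (\<Oplus>\<^bsub>L\<^esub>i\<in>{..<n}. lie L (\<theta> (e i)) (c (e' i) x))" for x
  note e' = cas[unfolded casimir_def, THEN conjunct1, rule_format]
  note s = endo_closed[OF \<theta>]
  have cJ: "c x y \<in> ext J" if "x \<in> carrier L" "y \<in> carrier L" for x y
  proof -
    have "c x y = \<ominus>\<^bsub>L\<^esub> (\<theta> (lie L x y) \<ominus>\<^bsub>L\<^esub> lie L (\<theta> x) (\<theta> y))"
      using that by (simp add: c_def a_minus_def M.minus_add M.a_comm s lie_closed)
    then show ?thesis using br[OF that] by (simp add: ext_neg)
  qed
  note cc = ext_carrier[OF cJ]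
  have c_endo: "endo (c x)" if "x \<in> carrier L" for x
    unfolding c_def using that by (intro endo_diff endo_comp[OF endo_ad \<theta>] endo_comp[OF \<theta> endo_ad] s)
  have c_endo': "endo (\<lambda>x. c x y)" if "y \<in> carrier L" for y
    unfolding c_def using that by (intro endo_diff endo_comp[OF endo_ad' \<theta>] endo_comp[OF \<theta> endo_ad'] s)
  have c_anti: "c x y = \<ominus>\<^bsub>L\<^esub> c y x" if "x \<in> carrier L" "y \<in> carrier L" for x y
    using that lie_anti[of x y] lie_anti[of "\<theta> x" "\<theta> y"]
    by (simp add: c_def a_minus_def M.minus_add s lie_closed endo_neg[OF \<theta>])
  have \<psi>_endo: "endo \<psi>"
    unfolding \<psi>_def using e' by (intro endo_sum endo_comp[OF endo_ad c_endo]) (auto simp: s)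
  have \<psi>J: "\<psi> x \<in> ext J" if "x \<in> carrier L" for x
    unfolding \<psi>_def using that e' by (intro ext_finsum lie_ext cJ) (auto simp: s)
  \<comment> \<open>The error of \<delta> as a right inverse takes values in \<open>ext J\<close>,
    so it vanishes on \<open>ext J\<close>: there \<delta> is an exact section of \<theta>.\<close>
  have sec: "\<theta> (\<delta> v) = v" if v: "v \<in> ext J" for v
  proof -
    have "\<theta> (\<delta> v) \<ominus>\<^bsub>L\<^esub> v = \<zero>\<^bsub>L\<^esub>"
      by (rule endo_ext_null[OF endo_diff[OF endo_comp[OF \<theta> \<delta>] endo_id]]) (use r v in auto)
    then show ?thesis
      by (rule M.eq_if_minus_zero) (use s endo_closed[OF \<delta>] ext_carrier[OF v] in auto)
  qed
  \<comment> \<open>The defect \<open>c x\<close> maps into \<open>ext J\<close> and so kills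
    \<open>ext J\<close>; with one argument there, \<theta> respects the bracket exactly.\<close>
  have twist: "\<theta> (lie L x w) = lie L (\<theta> x) (\<theta> w)" if x: "x \<in> carrier L" and w: "w \<in> ext J" for x w
  proof -
    have "c x w = \<zero>\<^bsub>L\<^esub>" by (rule endo_ext_null[OF c_endo[OF x] cJ[OF x] w])
    then show ?thesis
      using x ext_carrier[OF w] M.eq_if_minus_zero[of "lie L (\<theta> x) (\<theta> w)" "\<theta> (lie L x w)"]
      by (simp add: c_def s lie_closed)
  qed
  \<comment> \<open>Write v as the image of w = \<delta> v under \<theta>. Two applications of
    \<open>twist\<close> pull \<theta> out of the sum, and the Casimir identity applies to
    w.\<close>
  have cas1: "(\<Oplus>\<^bsub>L\<^esub>i\<in>{..<n}. lie L (\<theta> (e i)) (lie L (\<theta> (e' i)) v)) = v" if v: "v \<in> ext J" for v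
  proof -
    have w: "\<delta> v \<in> ext J" using endo_ext[OF \<delta> v] .
    have "(\<Oplus>\<^bsub>L\<^esub>i\<in>{..<n}. lie L (\<theta> (e i)) (lie L (\<theta> (e' i)) v)) = (\<Oplus>\<^bsub>L\<^esub>i\<in>{..<n}. \<theta> (lie L (e i) (lie L (e' i) (\<delta> v))))"
    proof (intro M.finsum_cong_closed)
      fix i assume i: "i \<in> {..<n}"
      have "\<theta> (lie L (e i) (lie L (e' i) (\<delta> v))) = lie L (\<theta> (e i)) (\<theta> (lie L (e' i) (\<delta> v)))"
        using i e' by (intro twist lie_ext w) auto
      also have "\<dots> = lie L (\<theta> (e i)) (lie L (\<theta> (e' i)) v)"
        using i e' w v by (simp add: twist sec)
      finally show "lie L (\<theta> (e i)) (lie L (\<theta> (e' i)) v) = \<theta> (lie L (e i) (lie L (e' i) (\<delta> v)))" by simp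
    qed (use e' ext_carrier[OF w] in \<open>auto simp: s lie_closed\<close>)
    also have "\<dots> = \<theta> (\<Oplus>\<^bsub>L\<^esub>i\<in>{..<n}. lie L (e i) (lie L (e' i) (\<delta> v)))"
      using e' ext_carrier[OF w] by (subst endo_finsum[OF \<theta>]) (auto simp: lie_closed)
    also have "\<dots> = v"
      using cas ext_carrier[OF w] by (simp add: casimir_def sec v)
    finally show ?thesis .
  qed
  \<comment> \<open>\<open>ext J\<close> is a module over \<open>L\<close> through x acting by ad
    (\<theta> x): the failure of \<theta> to be a homomorphism contributes [c(p, x), v], a bracket
    of two elements of \<open>ext J\<close>.\<close>
  have comm: "lie L (\<theta> p) (lie L (\<theta> x) v) = lie L (\<theta> x) (lie L (\<theta> p) v) \<oplus>\<^bsub>L\<^esub> lie L (\<theta> (lie L p x)) v"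
    if p: "p \<in> carrier L" and x: "x \<in> carrier L" and v: "v \<in> ext J" for p x v
  proof -
    have "lie L (c p x) v = \<zero>\<^bsub>L\<^esub>" by (rule lie_ext_ext[OF cJ[OF p x] v])
    moreover have "lie L (\<theta> p) (\<theta> x) = c p x \<oplus>\<^bsub>L\<^esub> \<theta> (lie L p x)"
      using p x by (simp add: c_def a_minus_def M.a_assoc M.l_neg s lie_closed)
    ultimately have "lie L (lie L (\<theta> p) (\<theta> x)) v = lie L (\<theta> (lie L p x)) v"
      using p x ext_carrier[OF v] by (simp add: lie_add_left s cc lie_closed)
    then show ?thesis
      using leibniz[of "\<theta> p" "\<theta> x" v] p x ext_carrier[OF v] by (simp add: s lie_closed M.a_comm)
  qed
  \<comment> \<open>Each bracketed pair telescopes to [\<theta> z, [\<theta> x, \<theta> y]] -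
    \<theta> [z, [x, y]]. Summed cyclically, both parts vanish by the Jacobi identity.\<close>
  have cocycle: "lie L (\<theta> z) (c x y) \<oplus>\<^bsub>L\<^esub> c z (lie L x y) \<oplus>\<^bsub>L\<^esub> (lie L (\<theta> x) (c y z) \<oplus>\<^bsub>L\<^esub> c x (lie L y z))
      \<oplus>\<^bsub>L\<^esub> (lie L (\<theta> y) (c z x) \<oplus>\<^bsub>L\<^esub> c y (lie L z x)) = \<zero>\<^bsub>L\<^esub>"
    if x: "x \<in> carrier L" and y: "y \<in> carrier L" and z: "z \<in> carrier L" for x y z
  proof -
    have *: "lie L (\<theta> z) (c x y) \<oplus>\<^bsub>L\<^esub> c z (lie L x y)
        = lie L (\<theta> z) (lie L (\<theta> x) (\<theta> y)) \<ominus>\<^bsub>L\<^esub> \<theta> (lie L z (lie L x y))"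
      if "x \<in> carrier L" "y \<in> carrier L" "z \<in> carrier L" for x y z
      using that by (simp add: c_def lie_add_right lie_neg_right s lie_closed a_minus_def M.a_assoc M.r_neg1)
    have "\<theta> (lie L z (lie L x y) \<oplus>\<^bsub>L\<^esub> lie L x (lie L y z) \<oplus>\<^bsub>L\<^esub> lie L y (lie L z x)) = \<zero>\<^bsub>L\<^esub>"
      using x y z by (simp add: jacobi endo_zero[OF \<theta>])
    then have 1: "\<theta> (lie L z (lie L x y)) \<oplus>\<^bsub>L\<^esub> \<theta> (lie L x (lie L y z)) \<oplus>\<^bsub>L\<^esub> \<theta> (lie L y (lie L z x)) = \<zero>\<^bsub>L\<^esub>"
      using x y z by (simp add: endo_add[OF \<theta>] lie_closed)
    have 2: "lie L (\<theta> z) (lie L (\<theta> x) (\<theta> y)) \<oplus>\<^bsub>L\<^esub> lie L (\<theta> x) (lie L (\<theta> y) (\<theta> z)) \<oplus>\<^bsub>L\<^esub> lie L (\<theta> y) (lie L (\<theta> z) (\<theta> x)) = \<zero>\<^bsub>L\<^esub>"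
      using x y z by (simp add: jacobi s)
    have 3: "a \<ominus>\<^bsub>L\<^esub> a' \<oplus>\<^bsub>L\<^esub> (b \<ominus>\<^bsub>L\<^esub> b') \<oplus>\<^bsub>L\<^esub> (d \<ominus>\<^bsub>L\<^esub> d') = (a \<oplus>\<^bsub>L\<^esub> b \<oplus>\<^bsub>L\<^esub> d) \<ominus>\<^bsub>L\<^esub> (a' \<oplus>\<^bsub>L\<^esub> b' \<oplus>\<^bsub>L\<^esub> d')"
      if "a \<in> carrier L" "b \<in> carrier L" "d \<in> carrier L" "a' \<in> carrier L" "b' \<in> carrier L" "d' \<in> carrier L" for a b d a' b' d'
      using that by (simp add: a_minus_def M.minus_add M.a_ac)
    show ?thesis
      using x y z by (simp only: *) (simp add: 3 1 2 s lie_closed a_minus_def[of L "\<zero>\<^bsub>L\<^esub>"])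
  qed
  \<comment> \<open>The equation d\<psi> = c, with the negative terms moved to the left.\<close>
  have coboundary: "c x y \<oplus>\<^bsub>L\<^esub> \<psi> (lie L x y) \<oplus>\<^bsub>L\<^esub> lie L (\<theta> y) (\<psi> x) = lie L (\<theta> x) (\<psi> y)"
    if x: "x \<in> carrier L" and y: "y \<in> carrier L" for x y
  proof -
    define S where "S f = (\<Oplus>\<^bsub>L\<^esub>i\<in>{..<n}. f i)" for f
    define \<beta> where "\<beta> x p q = lie L (\<theta> p) (c q x)" for x p q
    have \<beta>c: "\<beta> x p q \<in> carrier L" if "x \<in> carrier L" "p \<in> carrier L" "q \<in> carrier L" for x p q
      using that by (simp add: \<beta>_def s cc lie_closed)
    have swap: "S (\<lambda>i. \<beta> x (lie L (e i) y) (e' i)) = S (\<lambda>i. \<beta> x (e i) (lie L y (e' i)))"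
      if "x \<in> carrier L" "y \<in> carrier L" for x y
      unfolding S_def \<beta>_def using that
      by (intro casimir_swap[OF cas]) (auto simp: cc s intro!: endo_comp[OF endo_ad' \<theta>] endo_comp[OF endo_ad c_endo'])
    \<comment> \<open>The cocycle identity for x, y and e'_i, under ad (\<theta> e_i). Moving
      \<theta> e_i past \<theta> x and \<theta> y by \<open>comm\<close> produces the terms with
      [e_i, x] and [e_i, y].\<close>
    have pt: "lie L (\<theta> (e i)) (lie L (\<theta> (e' i)) (c x y)) \<oplus>\<^bsub>L\<^esub> \<beta> (lie L x y) (e i) (e' i)
        \<oplus>\<^bsub>L\<^esub> \<beta> y (e i) (lie L x (e' i)) \<oplus>\<^bsub>L\<^esub> (lie L (\<theta> y) (\<beta> x (e i) (e' i)) \<oplus>\<^bsub>L\<^esub> \<beta> x (lie L (e i) y) (e' i))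
      = (lie L (\<theta> x) (\<beta> y (e i) (e' i)) \<oplus>\<^bsub>L\<^esub> \<beta> y (lie L (e i) x) (e' i)) \<oplus>\<^bsub>L\<^esub> \<beta> x (e i) (lie L y (e' i))"
      if i: "i < n" for i
    proof -
      let ?ad = "lie L (\<theta> (e i))"
      have ei: "e i \<in> carrier L" "e' i \<in> carrier L" using i e' by auto
      note ad = endo_add[OF endo_ad[OF s[OF ei(1)]]] endo_neg[OF endo_ad[OF s[OF ei(1)]]]
      have 1: "?ad (lie L (\<theta> (e' i)) (c x y)) \<oplus>\<^bsub>L\<^esub> ?ad (c (e' i) (lie L x y)) \<oplus>\<^bsub>L\<^esub> (?ad (lie L (\<theta> x) (c y (e' i))) \<oplus>\<^bsub>L\<^esub> ?ad (c x (lie L y (e' i))))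
        \<oplus>\<^bsub>L\<^esub> (?ad (lie L (\<theta> y) (c (e' i) x)) \<oplus>\<^bsub>L\<^esub> ?ad (c y (lie L (e' i) x))) = \<zero>\<^bsub>L\<^esub>"
        using arg_cong[OF cocycle[OF x y ei(2)], of ?ad] x y ei by (simp add: ad s cc lie_closed)
      have 2: "?ad (lie L (\<theta> x) (c y (e' i))) = \<ominus>\<^bsub>L\<^esub> (lie L (\<theta> x) (\<beta> y (e i) (e' i)) \<oplus>\<^bsub>L\<^esub> \<beta> y (lie L (e i) x) (e' i))"
        using x y ei c_anti[of y "e' i"] comm[OF ei(1) x cJ[OF ei(2) y]]
        by (simp add: \<beta>_def ad lie_neg_right s cc lie_closed)
      have 3: "?ad (c x (lie L y (e' i))) = \<ominus>\<^bsub>L\<^esub> \<beta> x (e i) (lie L y (e' i))"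
        using x y ei c_anti[of x "lie L y (e' i)"] by (simp add: \<beta>_def ad lie_neg_right s cc lie_closed)
      have 4: "?ad (lie L (\<theta> y) (c (e' i) x)) = lie L (\<theta> y) (\<beta> x (e i) (e' i)) \<oplus>\<^bsub>L\<^esub> \<beta> x (lie L (e i) y) (e' i)"
        using comm[OF ei(1) y cJ[OF ei(2) x]] by (simp add: \<beta>_def)
      have 5: "?ad (c y (lie L (e' i) x)) = \<beta> y (e i) (lie L x (e' i))"
      proof -
        have "c y (lie L (e' i) x) = \<ominus>\<^bsub>L\<^esub> c y (lie L x (e' i))"
          using x y ei lie_anti[of "e' i" x] by (simp add: endo_neg[OF c_endo] lie_closed)
        also have "\<dots> = c (lie L x (e' i)) y"
          using x y ei c_anti[of "lie L x (e' i)" y] by (simp add: lie_closed)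
        finally show ?thesis by (simp add: \<beta>_def)
      qed
      have 6: "T1 \<oplus>\<^bsub>L\<^esub> T4 \<oplus>\<^bsub>L\<^esub> T6 \<oplus>\<^bsub>L\<^esub> T5 = T2 \<oplus>\<^bsub>L\<^esub> T3"
        if "T1 \<oplus>\<^bsub>L\<^esub> T4 \<oplus>\<^bsub>L\<^esub> (\<ominus>\<^bsub>L\<^esub> T2 \<oplus>\<^bsub>L\<^esub> \<ominus>\<^bsub>L\<^esub> T3) \<oplus>\<^bsub>L\<^esub> (T5 \<oplus>\<^bsub>L\<^esub> T6) = \<zero>\<^bsub>L\<^esub>"
          "T1 \<in> carrier L" "T2 \<in> carrier L" "T3 \<in> carrier L" "T4 \<in> carrier L" "T5 \<in> carrier L" "T6 \<in> carrier L"
        for T1 T2 T3 T4 T5 T6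
      proof -
        have "T1 \<oplus>\<^bsub>L\<^esub> T4 \<oplus>\<^bsub>L\<^esub> T6 \<oplus>\<^bsub>L\<^esub> T5
          = (T1 \<oplus>\<^bsub>L\<^esub> T4 \<oplus>\<^bsub>L\<^esub> (\<ominus>\<^bsub>L\<^esub> T2 \<oplus>\<^bsub>L\<^esub> \<ominus>\<^bsub>L\<^esub> T3) \<oplus>\<^bsub>L\<^esub> (T5 \<oplus>\<^bsub>L\<^esub> T6)) \<oplus>\<^bsub>L\<^esub> (T2 \<oplus>\<^bsub>L\<^esub> T3)"
          using that(2-) by (simp add: M.a_ac M.r_neg M.r_neg1 M.r_neg2 M.l_neg)
        then show ?thesis using that by simp
      qed
      show ?thesis
        using 1 unfolding 2 3 4 5 unfolding \<beta>_def[of "lie L x y", symmetric]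
        by (rule 6) (use x y ei in \<open>auto simp: s cc lie_closed \<beta>c\<close>)
    qed
    have Sadd: "S (\<lambda>i. f i \<oplus>\<^bsub>L\<^esub> g i) = S f \<oplus>\<^bsub>L\<^esub> S g"
      if "\<And>i. i < n \<Longrightarrow> f i \<in> carrier L" "\<And>i. i < n \<Longrightarrow> g i \<in> carrier L" for f g
      unfolding S_def using that by (intro M.finsum_addf) auto
    have Scl: "S f \<in> carrier L" if "\<And>i. i < n \<Longrightarrow> f i \<in> carrier L" for f
      unfolding S_def using that by (intro M.finsum_closed) auto
    have S\<psi>: "S (\<lambda>i. \<beta> x (e i) (e' i)) = \<psi> x" for x
      by (simp add: S_def \<psi>_def \<beta>_def)
    have Slie: "S (\<lambda>i. lie L (\<theta> y) (f i)) = lie L (\<theta> y) (S f)"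
      if "\<And>i. i < n \<Longrightarrow> f i \<in> carrier L" "y \<in> carrier L" for f y
      unfolding S_def using that by (intro lie_finsum_right[symmetric]) (auto simp: s)
    have Scas: "S (\<lambda>i. lie L (\<theta> (e i)) (lie L (\<theta> (e' i)) (c x y))) = c x y"
      unfolding S_def using cas1[OF cJ[OF x y]] .
    have "S (\<lambda>i. lie L (\<theta> (e i)) (lie L (\<theta> (e' i)) (c x y)) \<oplus>\<^bsub>L\<^esub> \<beta> (lie L x y) (e i) (e' i)
        \<oplus>\<^bsub>L\<^esub> \<beta> y (e i) (lie L x (e' i)) \<oplus>\<^bsub>L\<^esub> (lie L (\<theta> y) (\<beta> x (e i) (e' i)) \<oplus>\<^bsub>L\<^esub> \<beta> x (lie L (e i) y) (e' i)))
      = S (\<lambda>i. (lie L (\<theta> x) (\<beta> y (e i) (e' i)) \<oplus>\<^bsub>L\<^esub> \<beta> y (lie L (e i) x) (e' i)) \<oplus>\<^bsub>L\<^esub> \<beta> x (e i) (lie L y (e' i)))"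
      unfolding S_def using x y e'
      by (intro M.finsum_cong_closed) (auto simp: pt s cc lie_closed \<beta>c)
    \<comment> \<open>After summation \<open>swap\<close> rewrites the terms with [e_i, x] and
      [e_i, y], and the same two sums of \<beta> stand on both sides, ready to be cancelled.\<close>
    then have eq: "c x y \<oplus>\<^bsub>L\<^esub> \<psi> (lie L x y) \<oplus>\<^bsub>L\<^esub> S (\<lambda>i. \<beta> y (e i) (lie L x (e' i)))
        \<oplus>\<^bsub>L\<^esub> (lie L (\<theta> y) (\<psi> x) \<oplus>\<^bsub>L\<^esub> S (\<lambda>i. \<beta> x (e i) (lie L y (e' i))))
      = (lie L (\<theta> x) (\<psi> y) \<oplus>\<^bsub>L\<^esub> S (\<lambda>i. \<beta> y (e i) (lie L x (e' i)))) \<oplus>\<^bsub>L\<^esub> S (\<lambda>i. \<beta> x (e i) (lie L y (e' i)))"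
      using x y e' by (simp add: Sadd s cc lie_closed \<beta>c Slie S\<psi> Scas swap)
    have cancel: "a = b" if "a \<oplus>\<^bsub>L\<^esub> (p \<oplus>\<^bsub>L\<^esub> q) = b \<oplus>\<^bsub>L\<^esub> (p \<oplus>\<^bsub>L\<^esub> q)"
      "a \<in> carrier L" "b \<in> carrier L" "p \<in> carrier L" "q \<in> carrier L" for a b p q
      using that by simp
    have "(c x y \<oplus>\<^bsub>L\<^esub> \<psi> (lie L x y) \<oplus>\<^bsub>L\<^esub> lie L (\<theta> y) (\<psi> x)) \<oplus>\<^bsub>L\<^esub> (S (\<lambda>i. \<beta> y (e i) (lie L x (e' i))) \<oplus>\<^bsub>L\<^esub> S (\<lambda>i. \<beta> x (e i) (lie L y (e' i))))
      = lie L (\<theta> x) (\<psi> y) \<oplus>\<^bsub>L\<^esub> (S (\<lambda>i. \<beta> y (e i) (lie L x (e' i))) \<oplus>\<^bsub>L\<^esub> S (\<lambda>i. \<beta> x (e i) (lie L y (e' i))))"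
      using eq x y e' by (simp add: M.a_ac s cc lie_closed \<beta>c Scl endo_closed[OF \<psi>_endo])
    then show ?thesis
      by (rule cancel) (use x y e' in \<open>auto simp: s cc lie_closed \<beta>c Scl endo_closed[OF \<psi>_endo]\<close>)
  qed
  define \<tau> where "\<tau> x = \<theta> x \<ominus>\<^bsub>L\<^esub> \<psi> x" for x
  have \<tau>: "endo \<tau>" unfolding \<tau>_def by (rule endo_diff[OF \<theta> \<psi>_endo])
  have \<tau>\<theta>: "\<tau> x \<ominus>\<^bsub>L\<^esub> \<theta> x \<in> ext J" if "x \<in> carrier L" for x
  proof -
    have "p \<ominus>\<^bsub>L\<^esub> q \<ominus>\<^bsub>L\<^esub> p = \<ominus>\<^bsub>L\<^esub> q" if "p \<in> carrier L" "q \<in> carrier L" for p q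
      using that by (simp add: a_minus_def M.a_ac M.r_neg2)
    then have "\<tau> x \<ominus>\<^bsub>L\<^esub> \<theta> x = \<ominus>\<^bsub>L\<^esub> \<psi> x"
      using that endo_closed[OF \<psi>_endo] by (simp add: \<tau>_def s)
    then show ?thesis using ext_neg[OF \<psi>J[OF that]] by simp
  qed
  have \<tau>_lie: "\<tau> (lie L x y) = lie L (\<tau> x) (\<tau> y)" if x: "x \<in> carrier L" and y: "y \<in> carrier L" for x y
  proof -
    have pp: "lie L (\<psi> x) (\<psi> y) = \<zero>\<^bsub>L\<^esub>" by (rule lie_ext_ext[OF \<psi>J[OF x] \<psi>J[OF y]])
    have \<psi>x: "\<psi> x \<in> carrier L" "\<psi> y \<in> carrier L" "\<psi> (lie L x y) \<in> carrier L"
      using x y by (auto intro!: endo_closed[OF \<psi>_endo] lie_closed)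
    have z: "\<ominus>\<^bsub>L\<^esub> \<zero>\<^bsub>L\<^esub> = \<zero>\<^bsub>L\<^esub>" by (rule M.minus_equality) auto
    \<comment> \<open>The term quadratic in \<psi> is zero by \<open>pp\<close>, so only the linear
      corrections remain, and \<open>coboundary\<close> balances them against the defect
      \<open>c\<close>.\<close>
    have "lie L (\<tau> x) (\<tau> y) = lie L (\<theta> x) (\<theta> y) \<ominus>\<^bsub>L\<^esub> lie L (\<theta> x) (\<psi> y) \<ominus>\<^bsub>L\<^esub> lie L (\<psi> x) (\<theta> y)"
      using x y \<psi>x by (simp add: \<tau>_def lie_minus_left lie_minus_right s lie_closed pp) (simp add: a_minus_def M.minus_add M.a_ac s lie_closed z)
    also have "lie L (\<psi> x) (\<theta> y) = \<ominus>\<^bsub>L\<^esub> lie L (\<theta> y) (\<psi> x)"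
      using y \<psi>x by (intro lie_anti s)
    also have "lie L (\<theta> x) (\<psi> y) = c x y \<oplus>\<^bsub>L\<^esub> \<psi> (lie L x y) \<oplus>\<^bsub>L\<^esub> lie L (\<theta> y) (\<psi> x)"
      using coboundary[OF x y] by simp
    also have "lie L (\<theta> x) (\<theta> y) = c x y \<oplus>\<^bsub>L\<^esub> \<theta> (lie L x y)"
      using x y by (simp add: c_def a_minus_def M.a_assoc M.l_neg s lie_closed)
    also have "c x y \<oplus>\<^bsub>L\<^esub> \<theta> (lie L x y) \<ominus>\<^bsub>L\<^esub> (c x y \<oplus>\<^bsub>L\<^esub> \<psi> (lie L x y) \<oplus>\<^bsub>L\<^esub> lie L (\<theta> y) (\<psi> x)) \<ominus>\<^bsub>L\<^esub> \<ominus>\<^bsub>L\<^esub> lie L (\<theta> y) (\<psi> x)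
      = \<tau> (lie L x y)"
    proof -
      have "p \<oplus>\<^bsub>L\<^esub> t \<ominus>\<^bsub>L\<^esub> (p \<oplus>\<^bsub>L\<^esub> r \<oplus>\<^bsub>L\<^esub> q) \<ominus>\<^bsub>L\<^esub> \<ominus>\<^bsub>L\<^esub> q = t \<ominus>\<^bsub>L\<^esub> r"
        if "p \<in> carrier L" "q \<in> carrier L" "r \<in> carrier L" "t \<in> carrier L" for p q r t
      proof -
        have "p \<oplus>\<^bsub>L\<^esub> t \<ominus>\<^bsub>L\<^esub> (p \<oplus>\<^bsub>L\<^esub> r \<oplus>\<^bsub>L\<^esub> q) \<ominus>\<^bsub>L\<^esub> \<ominus>\<^bsub>L\<^esub> q
          = (p \<oplus>\<^bsub>L\<^esub> \<ominus>\<^bsub>L\<^esub> p) \<oplus>\<^bsub>L\<^esub> ((q \<oplus>\<^bsub>L\<^esub> \<ominus>\<^bsub>L\<^esub> q) \<oplus>\<^bsub>L\<^esub> (t \<ominus>\<^bsub>L\<^esub> r))"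
          using that by (simp add: a_minus_def M.minus_add M.a_ac)
        then show ?thesis using that by (simp add: M.r_neg)
      qed
      then show ?thesis using x y \<psi>x by (simp add: \<tau>_def s cc lie_closed)
    qed
    finally show ?thesis by simp
  qed
  have "bij_betw \<tau> (carrier L) (carrier L)"
  \<comment> \<open>\<tau> and \<theta> agree modulo \<open>ext J\<close>, so \<delta> is an
    approximate inverse of \<tau> as well.\<close>
  proof (rule near_inverse_bij[OF \<tau> \<delta>])
    fix x assume x: "x \<in> carrier L"
    have d: "\<delta> x \<in> carrier L" using endo_closed[OF \<delta> x] .
    have "\<tau> (\<delta> x) \<ominus>\<^bsub>L\<^esub> x = (\<tau> (\<delta> x) \<ominus>\<^bsub>L\<^esub> \<theta> (\<delta> x)) \<oplus>\<^bsub>L\<^esub> (\<theta> (\<delta> x) \<ominus>\<^bsub>L\<^esub> x)"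
      using x d endo_closed[OF \<tau>] by (simp add: a_minus_def s M.a_assoc M.r_neg1)
    then show "\<tau> (\<delta> x) \<ominus>\<^bsub>L\<^esub> x \<in> ext J" using ext_add[OF \<tau>\<theta>[OF d] r[OF x]] by simp
    have "\<delta> (\<tau> x) \<ominus>\<^bsub>L\<^esub> x = \<delta> (\<tau> x \<ominus>\<^bsub>L\<^esub> \<theta> x) \<oplus>\<^bsub>L\<^esub> (\<delta> (\<theta> x) \<ominus>\<^bsub>L\<^esub> x)"
      using x endo_closed[OF \<tau>] endo_closed[OF \<delta>] by (simp add: endo_minus[OF \<delta>] s) (simp add: a_minus_def s M.a_assoc M.r_neg1)
    then show "\<delta> (\<tau> x) \<ominus>\<^bsub>L\<^esub> x \<in> ext J" using ext_add[OF endo_ext[OF \<delta> \<tau>\<theta>[OF x]] l[OF x]] by simp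
  qed
  then show thesis using that \<tau> \<tau>_lie \<tau>\<theta> by blast
qed

end
end
end

section \<open>Automorphisms as solutions of polynomial equations\<close>

context lie_fg
begin

text \<open>An endomorphism for every matrix of ring elements. For redundant generators, different
  matrices may give the same map.\<close>

definition mat_map :: "(nat \<Rightarrow> nat \<Rightarrow> 'a) \<Rightarrow> 'g \<Rightarrow> 'g"
  where "mat_map c x = (\<Oplus>\<^bsub>L\<^esub>j\<in>{..<n}. \<phi> j x \<odot>\<^bsub>L\<^esub> (\<Oplus>\<^bsub>L\<^esub>i\<in>{..<n}. c i j \<odot>\<^bsub>L\<^esub> e i))"

definition mat_of :: "('g \<Rightarrow> 'g) \<Rightarrow> nat \<Rightarrow> nat \<Rightarrow> 'a"
  where "mat_of f i j = \<phi> i (f (e j))"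

definition is_mat :: "(nat \<Rightarrow> nat \<Rightarrow> 'a) \<Rightarrow> bool"
  where "is_mat c \<longleftrightarrow> (\<forall>i<n. \<forall>j<n. c i j \<in> carrier A)"

text \<open>Let p be the matrix of the \<open>\<phi> i (e j)\<close>, idempotent by
  \<open>expand\<close>. The matrix of \<open>mat_map c\<close> is p c p, so vanishing means c = p c
  p, which characterizes the matrices of the form \<open>mat_of f\<close> for an endomorphism
  \<open>f\<close>.\<close>

definition rel_proj :: "(nat \<Rightarrow> nat \<Rightarrow> 'a) \<Rightarrow> nat \<times> nat \<Rightarrow> 'a"
  where "rel_proj c = (\<lambda>(i, j). c i j \<ominus> \<phi> i (mat_map c (e j)))"

text \<open>The subtracted matrix is that of the identity map, the idempotent
  \<open>\<phi> i (e j)\<close> and not the unit matrix.\<close>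

definition rel_inv :: "(nat \<Rightarrow> nat \<Rightarrow> 'a) \<Rightarrow> (nat \<Rightarrow> nat \<Rightarrow> 'a) \<Rightarrow> nat \<times> nat \<Rightarrow> 'a"
  where "rel_inv c d = (\<lambda>(i, j). \<phi> i (mat_map c (mat_map d (e j))) \<ominus> \<phi> i (e j))"

definition rel_lie :: "(nat \<Rightarrow> nat \<Rightarrow> 'a) \<Rightarrow> nat \<times> nat \<times> nat \<Rightarrow> 'a"
  where "rel_lie c = (\<lambda>(l, i, j). \<phi> l (mat_map c (lie L (e i) (e j))) \<ominus> \<phi> l (lie L (mat_map c (e i)) (mat_map c (e j))))"

text \<open>\<open>rels c d\<close> vanishes exactly when \<open>c\<close> and \<open>d\<close> are the matrices, with respect to the
  generators \<open>e\<close> and the functionals \<open>\<phi>\<close>, of an automorphism and of its inverse. As the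
  \<open>e i\<close> need not be linearly independent, \<open>rel_proj\<close> is needed to make the matrices unique.\<close>

definition rels :: "(nat \<Rightarrow> nat \<Rightarrow> 'a) \<Rightarrow> (nat \<Rightarrow> nat \<Rightarrow> 'a) \<Rightarrow> 'a set"
  where "rels c d = rel_proj c ` ({..<n} \<times> {..<n}) \<union> rel_proj d ` ({..<n} \<times> {..<n}) \<union>
    rel_inv c d ` ({..<n} \<times> {..<n}) \<union> rel_inv d c ` ({..<n} \<times> {..<n}) \<union>
    rel_lie c ` ({..<n} \<times> {..<n} \<times> {..<n})"

lemma endo_mat_map:
  assumes "is_mat c"
  shows "endo (mat_map c)"
  unfolding mat_map_def using assms
  by (intro endo_sum endo_smult_const M.finsum_closed) (auto simp: is_mat_def phi_add phi_smult)

lemma mat_map_closed: "\<lbrakk>is_mat c; x \<in> carrier L\<rbrakk> \<Longrightarrow> mat_map c x \<in> carrier L"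
  by (rule endo_closed[OF endo_mat_map])

lemma is_mat_of: "endo f \<Longrightarrow> is_mat (mat_of f)"
  by (auto simp: is_mat_def mat_of_def endo_closed)

lemma mat_map_mat_of:
  assumes "endo f" "x \<in> carrier L"
  shows "mat_map (mat_of f) x = f x"
proof -
  have "mat_map (mat_of f) x = (\<Oplus>\<^bsub>L\<^esub>j\<in>{..<n}. \<phi> j x \<odot>\<^bsub>L\<^esub> f (e j))"
    unfolding mat_map_def mat_of_def using assms
    by (intro M.finsum_cong_closed) (auto simp: expand endo_closed)
  then show ?thesis using assms by (simp add: endo_expand)
qed

lemma rels_closed:
  assumes "is_mat c" "is_mat d"
  shows "rels c d \<subseteq> carrier A"
  using assms
  by (auto simp: rels_def rel_proj_def rel_inv_def rel_lie_def mat_map_closed lie_closed is_mat_def[of c] is_mat_def[of d])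

lemma finite_rels: "finite (rels c d)"
  by (simp add: rels_def)

lemma ext_if_phi_diff:
  assumes "x \<in> carrier L" "y \<in> carrier L" "\<And>i. i < n \<Longrightarrow> \<phi> i x \<ominus> \<phi> i y \<in> J"
  shows "x \<ominus>\<^bsub>L\<^esub> y \<in> ext J"
  using assms by (simp add: ext_def phi_minus)

text \<open>An arbitrary ideal is allowed so that the exact case (zero ideal) and the lifting
  problem (square-zero ideal) share one proof. The relations are conditions on generators, which
  linearity extends to all elements.\<close>

lemma rels_approx:
  assumes J: "ideal J A" and c: "is_mat c" and d: "is_mat d" and rels: "rels c d \<subseteq> J"
  shows "\<lbrakk>i < n; j < n\<rbrakk> \<Longrightarrow> c i j \<ominus> mat_of (mat_map c) i j \<in> J"
    and "\<lbrakk>i < n; j < n\<rbrakk> \<Longrightarrow> d i j \<ominus> mat_of (mat_map d) i j \<in> J"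
    and "x \<in> carrier L \<Longrightarrow> mat_map c (mat_map d x) \<ominus>\<^bsub>L\<^esub> x \<in> ext J"
    and "x \<in> carrier L \<Longrightarrow> mat_map d (mat_map c x) \<ominus>\<^bsub>L\<^esub> x \<in> ext J"
    and "\<lbrakk>x \<in> carrier L; y \<in> carrier L\<rbrakk> \<Longrightarrow>
      mat_map c (lie L x y) \<ominus>\<^bsub>L\<^esub> lie L (mat_map c x) (mat_map c y) \<in> ext J"
proof -
  note C = endo_mat_map[OF c] and D = endo_mat_map[OF d]
  show "\<lbrakk>i < n; j < n\<rbrakk> \<Longrightarrow> c i j \<ominus> mat_of (mat_map c) i j \<in> J"
    "\<lbrakk>i < n; j < n\<rbrakk> \<Longrightarrow> d i j \<ominus> mat_of (mat_map d) i j \<in> J"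
    using rels by (auto simp: rels_def rel_proj_def mat_of_def)
  have inv: "mat_map c (mat_map d x) \<ominus>\<^bsub>L\<^esub> x \<in> ext J"
    if c: "is_mat c" and d: "is_mat d" and rel: "rel_inv c d ` ({..<n} \<times> {..<n}) \<subseteq> J" and x: "x \<in> carrier L" for c d x
  proof (rule endo_ext_range[OF J endo_diff[OF endo_comp[OF endo_mat_map[OF c] endo_mat_map[OF d]] endo_id] _ x])
    fix j assume j: "j < n"
    show "mat_map c (mat_map d (e j)) \<ominus>\<^bsub>L\<^esub> e j \<in> ext J"
      using rel j c d by (intro ext_if_phi_diff mat_map_closed) (auto simp: rel_inv_def)
  qed
  show "x \<in> carrier L \<Longrightarrow> mat_map c (mat_map d x) \<ominus>\<^bsub>L\<^esub> x \<in> ext J"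
    using rels by (intro inv c d) (auto simp: rels_def)
  show "x \<in> carrier L \<Longrightarrow> mat_map d (mat_map c x) \<ominus>\<^bsub>L\<^esub> x \<in> ext J"
    using rels by (intro inv c d) (auto simp: rels_def)
  assume x: "x \<in> carrier L" and y: "y \<in> carrier L"
  show "mat_map c (lie L x y) \<ominus>\<^bsub>L\<^esub> lie L (mat_map c x) (mat_map c y) \<in> ext J"
  \<comment> \<open>The condition is bilinear and is reduced to generators one argument at a
    time.\<close>
  proof (rule endo_ext_range[OF J _ _ x])
    show "endo (\<lambda>x. mat_map c (lie L x y) \<ominus>\<^bsub>L\<^esub> lie L (mat_map c x) (mat_map c y))"
      using endo_diff[OF endo_comp[OF C endo_ad'[OF y]] endo_comp[OF endo_ad'[OF mat_map_closed[OF c y]] C]] .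
    fix i assume i: "i < n"
    show "mat_map c (lie L (e i) y) \<ominus>\<^bsub>L\<^esub> lie L (mat_map c (e i)) (mat_map c y) \<in> ext J"
    proof (rule endo_ext_range[OF J _ _ y])
      show "endo (\<lambda>y. mat_map c (lie L (e i) y) \<ominus>\<^bsub>L\<^esub> lie L (mat_map c (e i)) (mat_map c y))"
        using endo_diff[OF endo_comp[OF C endo_ad[OF e_closed[OF i]]] endo_comp[OF endo_ad[OF mat_map_closed[OF c e_closed[OF i]]] C]] .
      fix j assume j: "j < n"
      show "mat_map c (lie L (e i) (e j)) \<ominus>\<^bsub>L\<^esub> lie L (mat_map c (e i)) (mat_map c (e j)) \<in> ext J"
      proof (rule ext_if_phi_diff)
        fix l assume l: "l < n"
        have "rel_lie c (l, i, j) \<in> rels c d" using i j l by (force simp: rels_def)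
        then show "\<phi> l (mat_map c (lie L (e i) (e j))) \<ominus> \<phi> l (lie L (mat_map c (e i)) (mat_map c (e j))) \<in> J"
          using rels by (auto simp: rel_lie_def)
      qed (use i j c in \<open>auto simp: mat_map_closed lie_closed\<close>)
    qed
  qed
qed

lemma rels_exact:
  assumes c: "is_mat c" and d: "is_mat d" and rels: "rels c d \<subseteq> {\<zero>}"
  shows "\<lbrakk>i < n; j < n\<rbrakk> \<Longrightarrow> c i j = mat_of (mat_map c) i j"
    and "\<lbrakk>i < n; j < n\<rbrakk> \<Longrightarrow> d i j = mat_of (mat_map d) i j"
    and "x \<in> carrier L \<Longrightarrow> mat_map c (mat_map d x) = x"
    and "x \<in> carrier L \<Longrightarrow> mat_map d (mat_map c x) = x"
    and "\<lbrakk>x \<in> carrier L; y \<in> carrier L\<rbrakk> \<Longrightarrow> mat_map c (lie L x y) = lie L (mat_map c x) (mat_map c y)"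
proof -
  note cl = mat_map_closed[OF c] mat_map_closed[OF d]
  note ap = rels_approx[OF R.zeroideal c d rels, unfolded ext_zero_ideal singleton_iff]
  show "c i j = mat_of (mat_map c) i j" if "i < n" "j < n"
    by (rule R.eq_if_minus_zero[OF ap(1)]) (use that c in \<open>auto simp: mat_of_def cl is_mat_def\<close>)
  show "d i j = mat_of (mat_map d) i j" if "i < n" "j < n"
    by (rule R.eq_if_minus_zero[OF ap(2)]) (use that d in \<open>auto simp: mat_of_def cl is_mat_def\<close>)
  show "mat_map c (mat_map d x) = x" if "x \<in> carrier L"
    by (rule M.eq_if_minus_zero[OF ap(3)]) (use that in \<open>auto simp: cl\<close>)
  show "mat_map d (mat_map c x) = x" if "x \<in> carrier L"
    by (rule M.eq_if_minus_zero[OF ap(4)]) (use that in \<open>auto simp: cl\<close>)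
  show "mat_map c (lie L x y) = lie L (mat_map c x) (mat_map c y)" if "x \<in> carrier L" "y \<in> carrier L"
    by (rule M.eq_if_minus_zero[OF ap(5)]) (use that in \<open>auto simp: cl lie_closed\<close>)
qed

lemma rels_lie_aut:
  assumes c: "is_mat c" and d: "is_mat d" and rels: "rels c d \<subseteq> {\<zero>}"
  shows "(\<lambda>x\<in>carrier L. mat_map c x) \<in> lie_aut A L"
proof -
  note cl = mat_map_closed[OF c] mat_map_closed[OF d]
  note ex = rels_exact[OF assms]
  have "bij_betw (mat_map c) (carrier L) (carrier L)"
    by (rule bij_betw_byWitness[where f' = "mat_map d"]) (auto simp: ex(3,4) cl)
  then have "bij_betw (\<lambda>x\<in>carrier L. mat_map c x) (carrier L) (carrier L)"
    by (subst bij_betw_cong[where g = "mat_map c"]) auto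
  then show ?thesis
    using endo_mat_map[OF c]
    by (auto simp: lie_aut_def mod_hom_def ex(5) lie_closed endo_def)
qed

text \<open>The set-theoretic inverse is linear by injectivity. As \<open>mat_map\<close> recovers
  an endomorphism from its matrix, each relation becomes an identity between \<theta> and its
  inverse.\<close>

lemma lie_aut_rels:
  assumes \<theta>: "endo \<theta>" and bij: "bij_betw \<theta> (carrier L) (carrier L)"
    and br: "\<And>x y. \<lbrakk>x \<in> carrier L; y \<in> carrier L\<rbrakk> \<Longrightarrow> \<theta> (lie L x y) = lie L (\<theta> x) (\<theta> y)"
  obtains \<delta> where "endo \<delta>" "\<And>x. x \<in> carrier L \<Longrightarrow> \<theta> (\<delta> x) = x" "\<And>x. x \<in> carrier L \<Longrightarrow> \<delta> (\<theta> x) = x"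
    "rels (mat_of \<theta>) (mat_of \<delta>) \<subseteq> {\<zero>}"
proof -
  define \<delta> where "\<delta> = inv_into (carrier L) \<theta>"
  have r: "\<theta> (\<delta> x) = x" and dc: "\<delta> x \<in> carrier L" if "x \<in> carrier L" for x
    using bij that by (auto simp: \<delta>_def bij_betw_def f_inv_into_f inv_into_into)
  have l: "\<delta> (\<theta> x) = x" if "x \<in> carrier L" for x
    using bij that by (simp add: \<delta>_def bij_betw_inv_into_left)
  have inj: "x = y" if "\<theta> x = \<theta> y" "x \<in> carrier L" "y \<in> carrier L" for x y
    using bij that by (auto simp: bij_betw_def inj_on_def)
  have \<delta>: "endo \<delta>"
  proof (rule endoI)
    show "\<delta> (x \<oplus>\<^bsub>L\<^esub> y) = \<delta> x \<oplus>\<^bsub>L\<^esub> \<delta> y" if "x \<in> carrier L" "y \<in> carrier L" for x y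
      by (rule inj) (use that in \<open>auto simp: dc r endo_add[OF \<theta>]\<close>)
    show "\<delta> (a \<odot>\<^bsub>L\<^esub> x) = a \<odot>\<^bsub>L\<^esub> \<delta> x" if "a \<in> carrier A" "x \<in> carrier L" for a x
      by (rule inj) (use that in \<open>auto simp: dc r endo_smult[OF \<theta>]\<close>)
  qed (rule dc)
  have "rels (mat_of \<theta>) (mat_of \<delta>) \<subseteq> {\<zero>}"
    by (auto simp: rels_def rel_proj_def rel_inv_def rel_lie_def mat_map_mat_of[OF \<theta>] mat_map_mat_of[OF \<delta>]
        r l br dc endo_closed[OF \<theta>] lie_closed mat_of_def a_minus_def R.r_neg)
  then show thesis using that \<delta> r l by blast
qed

text \<open>\<open>lift_automorphism\<close> in terms of matrices: the new solution consists of the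
  matrices of the lifted automorphism and of its true inverse.\<close>

theorem lift_solution:
  assumes J: "ideal J A" and J2: "\<And>a b. \<lbrakk>a \<in> J; b \<in> J\<rbrakk> \<Longrightarrow> a \<otimes> b = \<zero>" and cas: "casimir e'"
    and c: "is_mat c" and d: "is_mat d" and rels: "rels c d \<subseteq> J"
  obtains c' d' where "is_mat c'" "is_mat d'" "rels c' d' \<subseteq> {\<zero>}"
    "\<And>i j. \<lbrakk>i < n; j < n\<rbrakk> \<Longrightarrow> c' i j \<ominus> c i j \<in> J" "\<And>i j. \<lbrakk>i < n; j < n\<rbrakk> \<Longrightarrow> d' i j \<ominus> d i j \<in> J"
proof -
  note C = endo_mat_map[OF c] and D = endo_mat_map[OF d]
  note cl = mat_map_closed[OF c] mat_map_closed[OF d]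
  note ap = rels_approx[OF J c d rels]
  obtain \<tau> where \<tau>: "endo \<tau>" "bij_betw \<tau> (carrier L) (carrier L)"
    "\<And>x y. \<lbrakk>x \<in> carrier L; y \<in> carrier L\<rbrakk> \<Longrightarrow> \<tau> (lie L x y) = lie L (\<tau> x) (\<tau> y)"
    and \<tau>c: "\<And>x. x \<in> carrier L \<Longrightarrow> \<tau> x \<ominus>\<^bsub>L\<^esub> mat_map c x \<in> ext J"
    using lift_automorphism[OF J J2 cas C D ap(3-5)] by blast
  obtain \<delta> where \<delta>: "endo \<delta>" "\<And>x. x \<in> carrier L \<Longrightarrow> \<tau> (\<delta> x) = x" "\<And>x. x \<in> carrier L \<Longrightarrow> \<delta> (\<tau> x) = x"
    and R: "rels (mat_of \<tau>) (mat_of \<delta>) \<subseteq> {\<zero>}"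
    using lie_aut_rels[OF \<tau>] by blast
  note tc = endo_closed[OF \<tau>(1)] endo_closed[OF \<delta>(1)]
  \<comment> \<open>The element \<tau>(d x) - x lies in \<open>ext J\<close> because d is an
    approximate inverse of c and \<tau> is close to c. Applying \<delta> to its negative gives the
    claim.\<close>
  have \<delta>d: "\<delta> x \<ominus>\<^bsub>L\<^esub> mat_map d x \<in> ext J" if x: "x \<in> carrier L" for x
  proof -
    let ?y = "\<tau> (mat_map d x) \<ominus>\<^bsub>L\<^esub> x"
    have y: "?y \<in> carrier L" using x by (simp add: tc cl)
    have "?y = (\<tau> (mat_map d x) \<ominus>\<^bsub>L\<^esub> mat_map c (mat_map d x)) \<oplus>\<^bsub>L\<^esub> (mat_map c (mat_map d x) \<ominus>\<^bsub>L\<^esub> x)"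
      using x by (simp add: a_minus_def tc cl M.a_assoc M.r_neg1)
    then have "?y \<in> ext J"
      using ext_add[OF J \<tau>c[OF cl(2)[OF x]] ap(3)[OF x]] by simp
    then have "\<delta> (\<ominus>\<^bsub>L\<^esub> ?y) \<in> ext J" by (intro endo_ext[OF J \<delta>(1)] ext_neg[OF J])
    moreover have "\<delta> (\<ominus>\<^bsub>L\<^esub> ?y) = \<delta> x \<ominus>\<^bsub>L\<^esub> mat_map d x"
      using x by (simp add: endo_neg[OF \<delta>(1)] endo_minus[OF \<delta>(1)] tc cl \<delta>(3))
        (simp add: a_minus_def M.minus_add tc cl M.a_comm)
    ultimately show ?thesis by simp
  qed
  \<comment> \<open>Closeness of the maps controls only the matrix of \<open>mat_map c\<close>. The
    relation \<open>rel_proj\<close>, valid modulo \<open>J\<close>, passes from it to the entries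
    of \<open>c\<close>.\<close>
  have cong: "mat_of f i j \<ominus> c i j \<in> J"
    if f: "endo f" and c: "is_mat c" and near: "\<And>x. x \<in> carrier L \<Longrightarrow> f x \<ominus>\<^bsub>L\<^esub> mat_map c x \<in> ext J"
      and p: "c i j \<ominus> mat_of (mat_map c) i j \<in> J" and ij: "i < n" "j < n" for f c i j
  proof -
    have m: "mat_of (mat_map c) i j \<in> carrier A" "c i j \<in> carrier A" "mat_of f i j \<in> carrier A"
      using ij c f by (auto simp: mat_of_def mat_map_closed endo_closed is_mat_def)
    have "\<phi> i (f (e j) \<ominus>\<^bsub>L\<^esub> mat_map c (e j)) \<in> J"
      using near[OF e_closed[OF ij(2)]] ij(1) by (simp add: ext_def)
    then have q: "mat_of f i j \<ominus> mat_of (mat_map c) i j \<in> J"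
      using ij f c by (simp add: mat_of_def phi_minus endo_closed mat_map_closed)
    have "mat_of f i j \<ominus> c i j = (mat_of f i j \<ominus> mat_of (mat_map c) i j) \<oplus> \<ominus> (c i j \<ominus> mat_of (mat_map c) i j)"
      using m by (simp add: a_minus_def R.minus_add R.a_ac R.r_neg R.r_neg1 R.r_neg2)
    then show ?thesis using J_add[OF J q J_neg[OF J p]] by simp
  qed
  show thesis
  proof (rule that)
    show "is_mat (mat_of \<tau>)" "is_mat (mat_of \<delta>)" by (rule is_mat_of[OF \<tau>(1)], rule is_mat_of[OF \<delta>(1)])
    show "rels (mat_of \<tau>) (mat_of \<delta>) \<subseteq> {\<zero>}" by (rule R)
    show "mat_of \<tau> i j \<ominus> c i j \<in> J" if "i < n" "j < n" for i j
      by (rule cong[OF \<tau>(1) c \<tau>c ap(1)[OF that] that])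
    show "mat_of \<delta> i j \<ominus> d i j \<in> J" if "i < n" "j < n" for i j
      by (rule cong[OF \<delta>(1) d \<delta>d ap(2)[OF that] that])
  qed
qed

end

section \<open>Base change\<close>

locale lie_fg_base_change = lie_fg A L n e \<phi>
  for A :: "('a, 'm) ring_scheme" (structure) and L :: "('a, 'g, 'k) lie_alg_scheme" (structure)
    and n e \<phi> +
  fixes B :: "('a, 'b, 'l) module_scheme" (structure)
  assumes algebra_B: "algebra A B"
begin

sublocale B: cring B
  using algebra_B by (rule algebra.M_cring)

lemma B_abelian: "abelian_group B"
  by (rule B.abelian_group_axioms)

lemma
  assumes "a \<in> carrier A" "x \<in> carrier B"
  shows sB_closed [simp]: "a \<odot>\<^bsub>B\<^esub> x \<in> carrier B"
    and sB_add_left: "a' \<in> carrier A \<Longrightarrow> (a \<oplus> a') \<odot>\<^bsub>B\<^esub> x = a \<odot>\<^bsub>B\<^esub> x \<oplus>\<^bsub>B\<^esub> a' \<odot>\<^bsub>B\<^esub> x"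
    and sB_add_right: "y \<in> carrier B \<Longrightarrow> a \<odot>\<^bsub>B\<^esub> (x \<oplus>\<^bsub>B\<^esub> y) = a \<odot>\<^bsub>B\<^esub> x \<oplus>\<^bsub>B\<^esub> a \<odot>\<^bsub>B\<^esub> y"
    and sB_assoc: "a' \<in> carrier A \<Longrightarrow> (a' \<otimes> a) \<odot>\<^bsub>B\<^esub> x = a' \<odot>\<^bsub>B\<^esub> (a \<odot>\<^bsub>B\<^esub> x)"
    and sB_mult_left: "y \<in> carrier B \<Longrightarrow> (a \<odot>\<^bsub>B\<^esub> x) \<otimes>\<^bsub>B\<^esub> y = a \<odot>\<^bsub>B\<^esub> (x \<otimes>\<^bsub>B\<^esub> y)"
    and sB_mult_right: "y \<in> carrier B \<Longrightarrow> y \<otimes>\<^bsub>B\<^esub> (a \<odot>\<^bsub>B\<^esub> x) = a \<odot>\<^bsub>B\<^esub> (y \<otimes>\<^bsub>B\<^esub> x)"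
    and sB_neg_left: "(\<ominus> a) \<odot>\<^bsub>B\<^esub> x = \<ominus>\<^bsub>B\<^esub> (a \<odot>\<^bsub>B\<^esub> x)"
proof -
  interpret AB: algebra A B by (rule algebra_B)
  show cl: "a \<odot>\<^bsub>B\<^esub> x \<in> carrier B" using assms by simp
  show "a' \<in> carrier A \<Longrightarrow> (a \<oplus> a') \<odot>\<^bsub>B\<^esub> x = a \<odot>\<^bsub>B\<^esub> x \<oplus>\<^bsub>B\<^esub> a' \<odot>\<^bsub>B\<^esub> x"
    using assms by (simp add: AB.smult_l_distr)
  show "y \<in> carrier B \<Longrightarrow> a \<odot>\<^bsub>B\<^esub> (x \<oplus>\<^bsub>B\<^esub> y) = a \<odot>\<^bsub>B\<^esub> x \<oplus>\<^bsub>B\<^esub> a \<odot>\<^bsub>B\<^esub> y"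
    using assms by (simp add: AB.smult_r_distr)
  show "a' \<in> carrier A \<Longrightarrow> (a' \<otimes> a) \<odot>\<^bsub>B\<^esub> x = a' \<odot>\<^bsub>B\<^esub> (a \<odot>\<^bsub>B\<^esub> x)"
    using assms by (simp add: AB.smult_assoc1)
  show l: "(a \<odot>\<^bsub>B\<^esub> x) \<otimes>\<^bsub>B\<^esub> y = a \<odot>\<^bsub>B\<^esub> (x \<otimes>\<^bsub>B\<^esub> y)" if "y \<in> carrier B"
    using assms that by (simp add: AB.smult_assoc2)
  show "y \<otimes>\<^bsub>B\<^esub> (a \<odot>\<^bsub>B\<^esub> x) = a \<odot>\<^bsub>B\<^esub> (y \<otimes>\<^bsub>B\<^esub> x)" if "y \<in> carrier B"
    using l[OF that] assms that cl by (simp add: B.m_comm)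
  show "(\<ominus> a) \<odot>\<^bsub>B\<^esub> x = \<ominus>\<^bsub>B\<^esub> (a \<odot>\<^bsub>B\<^esub> x)" using assms by (rule AB.smult_l_minus)
qed

lemma sB_null_left: "x \<in> carrier B \<Longrightarrow> \<zero> \<odot>\<^bsub>B\<^esub> x = \<zero>\<^bsub>B\<^esub>"
proof -
  interpret AB: algebra A B by (rule algebra_B)
  show "x \<in> carrier B \<Longrightarrow> \<zero> \<odot>\<^bsub>B\<^esub> x = \<zero>\<^bsub>B\<^esub>" by simp_all
qed

definition tvalid :: "('g \<times> 'b) list \<Rightarrow> bool"
  where "tvalid xs \<longleftrightarrow> set xs \<subseteq> carrier L \<times> carrier B"

lemma tvalid_simps [simp]:
  "tvalid []" "tvalid ((x, b) # xs) \<longleftrightarrow> x \<in> carrier L \<and> b \<in> carrier B \<and> tvalid xs"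
  "tvalid (xs @ ys) \<longleftrightarrow> tvalid xs \<and> tvalid ys"
  by (auto simp: tvalid_def)

text \<open>The map g (x) id with A (x) B identified with B, evaluated on a list of pure
  tensors.\<close>

fun tsum :: "('g \<Rightarrow> 'a) \<Rightarrow> ('g \<times> 'b) list \<Rightarrow> 'b"
  where "tsum g [] = \<zero>\<^bsub>B\<^esub>"
  | "tsum g ((x, b) # xs) = g x \<odot>\<^bsub>B\<^esub> b \<oplus>\<^bsub>B\<^esub> tsum g xs"

definition functional :: "('g \<Rightarrow> 'a) \<Rightarrow> bool"
  where "functional g \<longleftrightarrow> g \<in> carrier L \<rightarrow> carrier A \<and>
    (\<forall>x\<in>carrier L. \<forall>y\<in>carrier L. g (x \<oplus>\<^bsub>L\<^esub> y) = g x \<oplus> g y) \<and>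
    (\<forall>a\<in>carrier A. \<forall>x\<in>carrier L. g (a \<odot>\<^bsub>L\<^esub> x) = a \<otimes> g x)"

lemma functional_closed: "\<lbrakk>functional g; x \<in> carrier L\<rbrakk> \<Longrightarrow> g x \<in> carrier A"
  by (auto simp: functional_def)

lemma functional_phi: "i < n \<Longrightarrow> functional (\<phi> i)"
  by (auto simp: functional_def phi_add phi_smult)

lemma functional_phi_endo: "\<lbrakk>i < n; endo f\<rbrakk> \<Longrightarrow> functional (\<lambda>x. \<phi> i (f x))"
  by (auto simp: functional_def phi_add phi_smult endo_def Pi_iff)

lemma tsum_closed [simp]: "\<lbrakk>functional g; tvalid xs\<rbrakk> \<Longrightarrow> tsum g xs \<in> carrier B"
  by (induct xs) (auto simp: functional_closed)

lemma tsum_append: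
  "\<lbrakk>functional g; tvalid xs; tvalid ys\<rbrakk> \<Longrightarrow> tsum g (xs @ ys) = tsum g xs \<oplus>\<^bsub>B\<^esub> tsum g ys"
  by (induct xs) (auto simp: functional_closed B.a_assoc)

lemma tensor_eq_valid: "tensor_eq A L B xs ys \<Longrightarrow> tvalid xs \<and> tvalid ys"
  by (induct rule: tensor_eq.induct) (auto simp: tvalid_def)

text \<open>Linearity of \<open>g\<close> respects each generating relation of the congruence, so
  \<open>tsum g\<close> is a function on the tensor product.\<close>

lemma tensor_eq_tsum:
  assumes "tensor_eq A L B xs ys" "functional g"
  shows "tsum g xs = tsum g ys"
  using assms(1)
proof (induct rule: tensor_eq.induct)
  case (append xs xs' ys ys')
  then show ?case using assms(2) tensor_eq_valid[of xs xs'] tensor_eq_valid[of ys ys'] by (simp add: tsum_append)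
next
  case (comm xs ys)
  then show ?case using assms(2) by (simp add: tsum_append B.a_comm flip: tvalid_def)
next
  case (zero_left b)
  have "g \<zero>\<^bsub>L\<^esub> = \<zero>"
    using assms(2) by (intro additive_zero[OF L_abelian A_abelian]) (auto simp: functional_def)
  then show ?case using zero_left by (simp add: sB_null_left)
qed (use assms(2) in \<open>auto simp: functional_def Pi_iff sB_add_left sB_add_right R.m_comm sB_assoc[symmetric] B.a_assoc\<close>)

text \<open>Normal forms: sums of e_i (x) u_i. The bound \<open>m\<close> allows induction over
  partial sums; at \<open>m = n\<close> every tensor is reached.\<close>

definition tnorm :: "(nat \<Rightarrow> 'b) \<Rightarrow> nat \<Rightarrow> ('g \<times> 'b) list"
  where "tnorm u m = map (\<lambda>i. (e i, u i)) [0..<m]"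

lemma tnorm_simps: "tnorm u 0 = []" "tnorm u (Suc m) = tnorm u m @ [(e m, u m)]"
  by (simp_all add: tnorm_def)

lemma tvalid_tnorm: "\<lbrakk>m \<le> n; \<And>i. i < m \<Longrightarrow> u i \<in> carrier B\<rbrakk> \<Longrightarrow> tvalid (tnorm u m)"
  by (auto simp: tvalid_def tnorm_def)

lemma trefl: "tvalid xs \<Longrightarrow> tensor_eq A L B xs xs"
  by (rule tensor_eq.refl) (simp add: tvalid_def)

lemma tcomm: "\<lbrakk>tvalid xs; tvalid ys\<rbrakk> \<Longrightarrow> tensor_eq A L B (xs @ ys) (ys @ xs)"
  by (rule tensor_eq.comm) (simp_all add: tvalid_def)

lemmas ttrans [trans] = tensor_eq.trans

text \<open>Only a zero in the left factor is among the generating relations;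
  \<open>balanced\<close> carries the scalar zero across.\<close>

lemma tzero_right:
  assumes "x \<in> carrier L"
  shows "tensor_eq A L B [(x, \<zero>\<^bsub>B\<^esub>)] []"
proof -
  have "tensor_eq A L B [(\<zero> \<odot>\<^bsub>L\<^esub> x, \<zero>\<^bsub>B\<^esub>)] [(x, \<zero> \<odot>\<^bsub>B\<^esub> \<zero>\<^bsub>B\<^esub>)]"
    using assms by (intro tensor_eq.balanced) auto
  then have "tensor_eq A L B [(x, \<zero>\<^bsub>B\<^esub>)] [(\<zero>\<^bsub>L\<^esub>, \<zero>\<^bsub>B\<^esub>)]"
    using assms by (simp add: sB_null_left tensor_eq.sym)
  also have "tensor_eq A L B [(\<zero>\<^bsub>L\<^esub>, \<zero>\<^bsub>B\<^esub>)] []"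
    by (rule tensor_eq.zero_left) simp
  finally show ?thesis .
qed

lemma tnorm_zero: "m \<le> n \<Longrightarrow> tensor_eq A L B (tnorm (\<lambda>i. \<zero>\<^bsub>B\<^esub>) m) []"
proof (induct m)
  case (Suc m)
  have "tensor_eq A L B (tnorm (\<lambda>i. \<zero>\<^bsub>B\<^esub>) m @ [(e m, \<zero>\<^bsub>B\<^esub>)]) ([] @ [])"
    using Suc by (intro tensor_eq.append tzero_right) auto
  then show ?case by (simp add: tnorm_simps)
qed (simp add: tnorm_simps trefl)

lemma tnorm_add:
  assumes "m \<le> n" "\<And>i. i < n \<Longrightarrow> u i \<in> carrier B" "\<And>i. i < n \<Longrightarrow> v i \<in> carrier B"
  shows "tensor_eq A L B (tnorm (\<lambda>i. u i \<oplus>\<^bsub>B\<^esub> v i) m) (tnorm u m @ tnorm v m)"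
  using assms(1)
proof (induct m)
  case (Suc m)
  have val: "tvalid (tnorm u m)" "tvalid (tnorm v m)"
    using Suc assms by (auto intro!: tvalid_tnorm)
  have "tensor_eq A L B (tnorm (\<lambda>i. u i \<oplus>\<^bsub>B\<^esub> v i) m @ [(e m, u m \<oplus>\<^bsub>B\<^esub> v m)]) ((tnorm u m @ tnorm v m) @ [(e m, u m), (e m, v m)])"
    using Suc assms by (intro tensor_eq.append tensor_eq.add_right) auto
  also have "(tnorm u m @ tnorm v m) @ [(e m, u m), (e m, v m)] = (tnorm u m @ (tnorm v m @ [(e m, u m)])) @ [(e m, v m)]"
    by simp
  also have "tensor_eq A L B \<dots> ((tnorm u m @ ([(e m, u m)] @ tnorm v m)) @ [(e m, v m)])"
    using Suc assms val by (intro tensor_eq.append tcomm trefl) auto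
  finally show ?case by (simp add: tnorm_simps)
qed (simp add: tnorm_simps trefl)

lemma tnorm_single:
  assumes "m \<le> n" "x \<in> carrier L" "b \<in> carrier B"
  shows "tensor_eq A L B [(\<Oplus>\<^bsub>L\<^esub>i\<in>{..<m}. \<phi> i x \<odot>\<^bsub>L\<^esub> e i, b)] (tnorm (\<lambda>i. \<phi> i x \<odot>\<^bsub>B\<^esub> b) m)"
  using assms(1)
proof (induct m)
  case (Suc m)
  let ?s = "\<Oplus>\<^bsub>L\<^esub>i\<in>{..<m}. \<phi> i x \<odot>\<^bsub>L\<^esub> e i"
  have s: "?s \<in> carrier L" using Suc assms by (intro M.finsum_closed) auto
  have "(\<Oplus>\<^bsub>L\<^esub>i\<in>{..<Suc m}. \<phi> i x \<odot>\<^bsub>L\<^esub> e i) = \<phi> m x \<odot>\<^bsub>L\<^esub> e m \<oplus>\<^bsub>L\<^esub> ?s"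
    using Suc assms by (simp add: lessThan_Suc Pi_iff)
  also have "\<dots> = ?s \<oplus>\<^bsub>L\<^esub> \<phi> m x \<odot>\<^bsub>L\<^esub> e m"
    using Suc assms s by (simp add: M.a_comm)
  finally have "tensor_eq A L B [(\<Oplus>\<^bsub>L\<^esub>i\<in>{..<Suc m}. \<phi> i x \<odot>\<^bsub>L\<^esub> e i, b)] ([(?s, b)] @ [(\<phi> m x \<odot>\<^bsub>L\<^esub> e m, b)])"
    using Suc assms s tensor_eq.add_left[of ?s L "\<phi> m x \<odot>\<^bsub>L\<^esub> e m" b B A] by simp
  also have "tensor_eq A L B \<dots> (tnorm (\<lambda>i. \<phi> i x \<odot>\<^bsub>B\<^esub> b) m @ [(e m, \<phi> m x \<odot>\<^bsub>B\<^esub> b)])"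
    using Suc assms by (intro tensor_eq.append tensor_eq.balanced) auto
  finally show ?case by (simp add: tnorm_simps)
qed (use assms in \<open>simp add: tnorm_simps tensor_eq.zero_left\<close>)

lemma tensor_eq_tnorm:
  assumes "tvalid xs"
  shows "tensor_eq A L B xs (tnorm (\<lambda>i. tsum (\<phi> i) xs) n)"
  using assms
proof (induct xs)
  case Nil
  then show ?case using tnorm_zero[of n] by (simp add: tensor_eq.sym)
next
  case (Cons p xs)
  obtain x b where p: "p = (x, b)" by (cases p)
  with Cons have x: "x \<in> carrier L" "b \<in> carrier B" "tvalid xs" by auto
  have "tensor_eq A L B ([(x, b)] @ xs) (tnorm (\<lambda>i. \<phi> i x \<odot>\<^bsub>B\<^esub> b) n @ tnorm (\<lambda>i. tsum (\<phi> i) xs) n)"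
    using tnorm_single[OF order.refl x(1,2)] Cons x by (intro tensor_eq.append) (auto simp: expand)
  also have "tensor_eq A L B \<dots> (tnorm (\<lambda>i. \<phi> i x \<odot>\<^bsub>B\<^esub> b \<oplus>\<^bsub>B\<^esub> tsum (\<phi> i) xs) n)"
    using x by (intro tensor_eq.sym[OF tnorm_add]) (auto simp: functional_phi)
  finally show ?case by (simp add: p)
qed

text \<open>Coordinates are invariants of the congruence, and conversely they determine the normal
  form \<open>tnorm\<close>. From here on the inductively defined congruence is decided by equations
  in \<open>B\<close>.\<close>

lemma tensor_eq_iff:
  assumes "tvalid xs" "tvalid ys"
  shows "tensor_eq A L B xs ys \<longleftrightarrow> (\<forall>i<n. tsum (\<phi> i) xs = tsum (\<phi> i) ys)"
proof
  assume "tensor_eq A L B xs ys"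
  then show "\<forall>i<n. tsum (\<phi> i) xs = tsum (\<phi> i) ys"
    by (auto intro: tensor_eq_tsum functional_phi)
next
  assume "\<forall>i<n. tsum (\<phi> i) xs = tsum (\<phi> i) ys"
  then have "tnorm (\<lambda>i. tsum (\<phi> i) xs) n = tnorm (\<lambda>i. tsum (\<phi> i) ys) n"
    by (simp add: tnorm_def)
  then show "tensor_eq A L B xs ys"
    using tensor_eq_tnorm[OF assms(1)] tensor_eq_tnorm[OF assms(2)]
    by (metis tensor_eq.sym tensor_eq.trans)
qed

definition tsm :: "'b \<Rightarrow> ('g \<times> 'b) list \<Rightarrow> ('g \<times> 'b) list"
  where "tsm b xs = map (\<lambda>(x, c). (x, b \<otimes>\<^bsub>B\<^esub> c)) xs"

definition tlie :: "('g \<times> 'b) list \<Rightarrow> ('g \<times> 'b) list \<Rightarrow> ('g \<times> 'b) list"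
  where "tlie xs ys = [(lie L x y, b \<otimes>\<^bsub>B\<^esub> c). (x, b) \<leftarrow> xs, (y, c) \<leftarrow> ys]"

lemma tlie_simps [simp]:
  "tlie [] ys = []"
  "tlie ((x, b) # xs) ys = map (\<lambda>(y, c). (lie L x y, b \<otimes>\<^bsub>B\<^esub> c)) ys @ tlie xs ys"
  "tlie (xs @ zs) ys = tlie xs ys @ tlie zs ys"
  by (simp_all add: tlie_def)

lemma tvalid_tsm [simp]: "\<lbrakk>b \<in> carrier B; tvalid xs\<rbrakk> \<Longrightarrow> tvalid (tsm b xs)"
  by (auto simp: tvalid_def tsm_def)

lemma tvalid_tlie1: "\<lbrakk>x \<in> carrier L; b \<in> carrier B; tvalid ys\<rbrakk> \<Longrightarrow>
    tvalid (map (\<lambda>(y, c). (lie L x y, b \<otimes>\<^bsub>B\<^esub> c)) ys)"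
  by (auto simp: tvalid_def lie_closed)

lemma tvalid_tlie [simp]: "\<lbrakk>tvalid xs; tvalid ys\<rbrakk> \<Longrightarrow> tvalid (tlie xs ys)"
  by (induct xs) (auto simp: tvalid_tlie1)

lemma tsum_tsm: "\<lbrakk>functional g; b \<in> carrier B; tvalid xs\<rbrakk> \<Longrightarrow> tsum g (tsm b xs) = b \<otimes>\<^bsub>B\<^esub> tsum g xs"
  by (induct xs) (auto simp: tsm_def functional_closed B.r_distr sB_mult_right)

lemma tsum_tlie1: "\<lbrakk>i < n; x \<in> carrier L; b \<in> carrier B; tvalid ys\<rbrakk> \<Longrightarrow>
    tsum (\<phi> i) (map (\<lambda>(y, c). (lie L x y, b \<otimes>\<^bsub>B\<^esub> c)) ys) = b \<otimes>\<^bsub>B\<^esub> tsum (\<lambda>y. \<phi> i (lie L x y)) ys"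
  by (induct ys) (auto simp: functional_phi_endo endo_ad lie_closed B.r_distr sB_mult_right)

text \<open>For fixed \<open>x\<close> the map sending \<open>y\<close> to
  \<open>\<phi> i (lie L x y)\<close> is again a linear functional, so \<open>tensor_eq_tsum\<close>
  applies to it.\<close>

lemma tlie_cong_right:
  assumes "tvalid xs" "tensor_eq A L B ys ys'"
  shows "tensor_eq A L B (tlie xs ys) (tlie xs ys')"
  using assms(1)
proof (induct xs)
  case (Cons p xs)
  obtain x b where p: "p = (x, b)" by (cases p)
  have "tensor_eq A L B (map (\<lambda>(y, c). (lie L x y, b \<otimes>\<^bsub>B\<^esub> c)) ys) (map (\<lambda>(y, c). (lie L x y, b \<otimes>\<^bsub>B\<^esub> c)) ys')"
    using Cons p tensor_eq_valid[OF assms(2)] tensor_eq_tsum[OF assms(2) functional_phi_endo[OF _ endo_ad]]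
    by (subst tensor_eq_iff) (auto simp: tvalid_tlie1 tsum_tlie1)
  then show ?case using Cons p by (auto intro: tensor_eq.append)
qed (simp add: trefl)

text \<open>Antisymmetry on coordinates; it yields congruence in the left argument from congruence
  in the right one.\<close>

lemma tsum_tlie_anti:
  assumes "tvalid xs" "tvalid ys" "i < n"
  shows "tsum (\<phi> i) (tlie xs ys) = \<ominus>\<^bsub>B\<^esub> tsum (\<phi> i) (tlie ys xs)"
  using assms(1)
proof (induct xs)
  case Nil
  have "tlie ys [] = []" by (induct ys) auto
  then show ?case by simp
next
  case (Cons p xs)
  obtain x b where p: "p = (x, b)" by (cases p)
  have x: "x \<in> carrier L" "b \<in> carrier B" "tvalid xs" using Cons p by auto
  note f = functional_phi[OF assms(3)]
  \<comment> \<open>\<open>tlie\<close> runs through its first argument, so splitting an element off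
    the second one takes an induction of its own.\<close>
  have "tsum (\<phi> i) (tlie ys (p # xs)) = \<ominus>\<^bsub>B\<^esub> tsum (\<phi> i) (map (\<lambda>(y, c). (lie L x y, b \<otimes>\<^bsub>B\<^esub> c)) ys) \<oplus>\<^bsub>B\<^esub> tsum (\<phi> i) (tlie ys xs)"
    using assms(2)
  proof (induct ys)
    case (Cons q ys)
    obtain y c where q: "q = (y, c)" by (cases q)
    have y: "y \<in> carrier L" "c \<in> carrier B" "tvalid ys" using Cons q by auto
    let ?u = "tsum (\<phi> i) (map (\<lambda>(y, c). (lie L x y, b \<otimes>\<^bsub>B\<^esub> c)) ys)" and ?v = "tsum (\<phi> i) (tlie ys xs)"
      and ?w = "tsum (\<phi> i) (map (\<lambda>(x, b). (lie L y x, c \<otimes>\<^bsub>B\<^esub> b)) xs)" and ?p = "\<phi> i (lie L x y) \<odot>\<^bsub>B\<^esub> (b \<otimes>\<^bsub>B\<^esub> c)"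
    have cl: "?u \<in> carrier B" "?v \<in> carrier B" "?w \<in> carrier B" "?p \<in> carrier B"
      using x y f assms(3) by (auto simp: tvalid_tlie1 lie_closed)
    have "tsum (\<phi> i) (tlie (q # ys) (p # xs)) = \<phi> i (lie L y x) \<odot>\<^bsub>B\<^esub> (c \<otimes>\<^bsub>B\<^esub> b) \<oplus>\<^bsub>B\<^esub> (?w \<oplus>\<^bsub>B\<^esub> (\<ominus>\<^bsub>B\<^esub> ?u \<oplus>\<^bsub>B\<^esub> ?v))"
      using Cons x y by (simp add: p q tsum_append[OF f] tvalid_tlie1 lie_closed B.a_assoc)
    also have "\<phi> i (lie L y x) \<odot>\<^bsub>B\<^esub> (c \<otimes>\<^bsub>B\<^esub> b) = \<ominus>\<^bsub>B\<^esub> ?p"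
      using x y assms(3) lie_anti[of y x] by (simp add: B.m_comm phi_neg sB_neg_left lie_closed)
    also have "\<ominus>\<^bsub>B\<^esub> ?p \<oplus>\<^bsub>B\<^esub> (?w \<oplus>\<^bsub>B\<^esub> (\<ominus>\<^bsub>B\<^esub> ?u \<oplus>\<^bsub>B\<^esub> ?v)) = \<ominus>\<^bsub>B\<^esub> (?p \<oplus>\<^bsub>B\<^esub> ?u) \<oplus>\<^bsub>B\<^esub> (?w \<oplus>\<^bsub>B\<^esub> ?v)"
      using cl by (simp add: B.minus_add B.a_ac)
    finally show ?case using x y by (simp add: p q tsum_append[OF f] tvalid_tlie1)
  qed simp
  then have "tsum (\<phi> i) (tlie ys (p # xs)) = \<ominus>\<^bsub>B\<^esub> (tsum (\<phi> i) (map (\<lambda>(y, c). (lie L x y, b \<otimes>\<^bsub>B\<^esub> c)) ys) \<oplus>\<^bsub>B\<^esub> tsum (\<phi> i) (tlie xs ys))"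
    using Cons x assms f by (simp add: B.minus_add tvalid_tlie1)
  then show ?case
    using x assms f by (simp add: p tsum_append tvalid_tlie1)
qed

lemma tlie_cong_left:
  assumes "tvalid xs" "tensor_eq A L B ys ys'"
  shows "tensor_eq A L B (tlie ys xs) (tlie ys' xs)"
proof -
  have v: "tvalid ys" "tvalid ys'" using tensor_eq_valid[OF assms(2)] by auto
  show ?thesis
    using tlie_cong_right[OF assms] v assms(1)
    by (auto simp: tensor_eq_iff tsum_tlie_anti[of ys xs] tsum_tlie_anti[of ys' xs])
qed

end

section \<open>The base change as a Lie algebra with dual basis and Casimir element\<close>

context lie_fg_base_change
begin

abbreviation LB :: "('b, ('g \<times> 'b) list set) lie_alg"
  where "LB \<equiv> base_change A L B"

definition tclass :: "('g \<times> 'b) list \<Rightarrow> ('g \<times> 'b) list set"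
  where "tclass xs = {zs. tensor_eq A L B xs zs}"

lemma tclass_eq_iff:
  assumes "tvalid xs" "tvalid ys"
  shows "tclass xs = tclass ys \<longleftrightarrow> (\<forall>i<n. tsum (\<phi> i) xs = tsum (\<phi> i) ys)"
proof -
  have "tclass xs = tclass ys \<longleftrightarrow> tensor_eq A L B xs ys"
    using assms by (auto simp: tclass_def intro: trefl tensor_eq.sym tensor_eq.trans)
  then show ?thesis using assms by (simp add: tensor_eq_iff)
qed

lemma tclass_closed: "tvalid xs \<Longrightarrow> tclass xs \<in> carrier LB"
  by (auto simp: base_change_def tclass_def tvalid_def)

lemma LB_cases:
  assumes "U \<in> carrier LB"
  obtains xs where "tvalid xs" "U = tclass xs"
  using assms by (auto simp: base_change_def tclass_def tvalid_def)

lemma LB_zero: "\<zero>\<^bsub>LB\<^esub> = tclass []"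
  by (simp add: base_change_def tclass_def)

lemma LB_add:
  assumes "tvalid xs" "tvalid ys"
  shows "tclass xs \<oplus>\<^bsub>LB\<^esub> tclass ys = tclass (xs @ ys)"
proof -
  have "tensor_eq A L B (xs @ ys) zs"
    if "tensor_eq A L B xs xs'" "tensor_eq A L B ys ys'" "tensor_eq A L B (xs' @ ys') zs" for xs' ys' zs
    using tensor_eq.trans[OF tensor_eq.append[OF that(1,2)] that(3)] .
  then show ?thesis
    using trefl[OF assms(1)] trefl[OF assms(2)] by (simp add: base_change_def tclass_def set_eq_iff) blast
qed

lemma LB_smult:
  assumes "b \<in> carrier B" "tvalid xs"
  shows "b \<odot>\<^bsub>LB\<^esub> tclass xs = tclass (tsm b xs)"
proof -
  have "tensor_eq A L B (tsm b xs) zs"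
    if "tensor_eq A L B xs xs'" "tensor_eq A L B (tsm b xs') zs" for xs' zs
  proof -
    have "tensor_eq A L B (tsm b xs) (tsm b xs')"
      using that(1) tensor_eq_valid[OF that(1)] assms tensor_eq_tsum[OF that(1) functional_phi]
      by (simp add: tensor_eq_iff tsum_tsm functional_phi)
    then show ?thesis using that(2) by (rule tensor_eq.trans)
  qed
  then show ?thesis
    using trefl[OF assms(2)] by (simp add: base_change_def tclass_def tsm_def set_eq_iff) blast
qed

lemma LB_lie:
  assumes "tvalid xs" "tvalid ys"
  shows "lie LB (tclass xs) (tclass ys) = tclass (tlie xs ys)"
proof -
  have "tensor_eq A L B (tlie xs ys) zs"
    if "tensor_eq A L B xs xs'" "tensor_eq A L B ys ys'" "tensor_eq A L B (tlie xs' ys') zs" for xs' ys' zs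
    using tensor_eq.trans[OF tensor_eq.trans[OF tlie_cong_left[OF assms(2) that(1)] tlie_cong_right[OF _ that(2)]] that(3)]
      tensor_eq_valid[OF that(1)] by simp
  then show ?thesis
    using trefl[OF assms(1)] trefl[OF assms(2)] by (simp add: base_change_def tclass_def tlie_def set_eq_iff) blast
qed

text \<open>The coordinate \<phi>_i (x) id on classes. By \<open>tensor_eq_tsum\<close> the chosen
  representative does not matter.\<close>

definition \<Phi> :: "nat \<Rightarrow> ('g \<times> 'b) list set \<Rightarrow> 'b"
  where "\<Phi> i U = tsum (\<phi> i) (SOME xs. xs \<in> U)"

lemma Phi_tclass:
  assumes "i < n" "tvalid xs"
  shows "\<Phi> i (tclass xs) = tsum (\<phi> i) xs"
proof -
  have "tensor_eq A L B xs (SOME zs. zs \<in> tclass xs)"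
    using someI[of "\<lambda>zs. zs \<in> tclass xs" xs] trefl[OF assms(2)] by (simp add: tclass_def)
  then show ?thesis
    unfolding \<Phi>_def using assms(1) by (intro tensor_eq_tsum[symmetric] functional_phi)
qed

lemma Phi_closed [simp]: "\<lbrakk>i < n; U \<in> carrier LB\<rbrakk> \<Longrightarrow> \<Phi> i U \<in> carrier B"
  by (auto elim!: LB_cases simp: Phi_tclass functional_phi)

lemma LB_eqI:
  assumes "U \<in> carrier LB" "V \<in> carrier LB" "\<And>i. i < n \<Longrightarrow> \<Phi> i U = \<Phi> i V"
  shows "U = V"
proof -
  obtain xs ys where "tvalid xs" "U = tclass xs" "tvalid ys" "V = tclass ys"
    using assms(1,2) by (meson LB_cases)
  then show ?thesis using assms(3) by (simp add: tclass_eq_iff Phi_tclass)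
qed

lemma Phi_zero: "i < n \<Longrightarrow> \<Phi> i \<zero>\<^bsub>LB\<^esub> = \<zero>\<^bsub>B\<^esub>"
  by (simp add: LB_zero Phi_tclass)

lemma LB_zero_closed: "\<zero>\<^bsub>LB\<^esub> \<in> carrier LB"
  by (simp add: LB_zero tclass_closed)

lemma LB_add_closed: "\<lbrakk>U \<in> carrier LB; V \<in> carrier LB\<rbrakk> \<Longrightarrow> U \<oplus>\<^bsub>LB\<^esub> V \<in> carrier LB"
  by (auto elim!: LB_cases simp: LB_add intro!: tclass_closed)

lemma Phi_add: "\<lbrakk>i < n; U \<in> carrier LB; V \<in> carrier LB\<rbrakk> \<Longrightarrow> \<Phi> i (U \<oplus>\<^bsub>LB\<^esub> V) = \<Phi> i U \<oplus>\<^bsub>B\<^esub> \<Phi> i V"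
  by (auto elim!: LB_cases simp: LB_add Phi_tclass tsum_append functional_phi)

lemma LB_smult_closed: "\<lbrakk>b \<in> carrier B; U \<in> carrier LB\<rbrakk> \<Longrightarrow> b \<odot>\<^bsub>LB\<^esub> U \<in> carrier LB"
  by (auto elim!: LB_cases simp: LB_smult intro!: tclass_closed)

lemma Phi_smult: "\<lbrakk>i < n; b \<in> carrier B; U \<in> carrier LB\<rbrakk> \<Longrightarrow> \<Phi> i (b \<odot>\<^bsub>LB\<^esub> U) = b \<otimes>\<^bsub>B\<^esub> \<Phi> i U"
  by (auto elim!: LB_cases simp: LB_smult Phi_tclass tsum_tsm functional_phi)

text \<open>The coordinates are additive, linear over \<open>B\<close> and jointly injective, so
  each module axiom becomes a ring identity in \<open>B\<close>. Negatives are multiples by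
  -1.\<close>

lemma LB_module: "module B LB"
proof (rule moduleI)
  show "abelian_group LB"
  proof (rule abelian_groupI)
    fix U assume U: "U \<in> carrier LB"
    show "\<exists>V\<in>carrier LB. V \<oplus>\<^bsub>LB\<^esub> U = \<zero>\<^bsub>LB\<^esub>"
      using U by (intro bexI[of _ "(\<ominus>\<^bsub>B\<^esub> \<one>\<^bsub>B\<^esub>) \<odot>\<^bsub>LB\<^esub> U"] LB_eqI)
        (auto simp: LB_add_closed LB_smult_closed LB_zero_closed Phi_add Phi_smult Phi_zero B.l_minus B.l_neg)
  qed ((rule LB_zero_closed LB_add_closed LB_eqI; simp add: LB_add_closed LB_zero_closed Phi_add Phi_zero B.a_ac)+)
qed ((rule B.is_cring LB_smult_closed LB_eqI; simp add: LB_add_closed LB_smult_closed Phi_add Phi_smult B.l_distr B.r_distr B.m_assoc)+)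

definition pure :: "'g \<Rightarrow> 'b \<Rightarrow> ('g \<times> 'b) list set"
  where "pure x b = tclass [(x, b)]"

lemma pure_closed: "\<lbrakk>x \<in> carrier L; b \<in> carrier B\<rbrakk> \<Longrightarrow> pure x b \<in> carrier LB"
  by (simp add: pure_def tclass_closed)

lemma Phi_pure: "\<lbrakk>i < n; x \<in> carrier L; b \<in> carrier B\<rbrakk> \<Longrightarrow> \<Phi> i (pure x b) = \<phi> i x \<odot>\<^bsub>B\<^esub> b"
  by (simp add: pure_def Phi_tclass)

lemma pure_add: "\<lbrakk>x \<in> carrier L; y \<in> carrier L; b \<in> carrier B\<rbrakk> \<Longrightarrow> pure (x \<oplus>\<^bsub>L\<^esub> y) b = pure x b \<oplus>\<^bsub>LB\<^esub> pure y b"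
  by (rule LB_eqI) (auto simp: pure_closed LB_add_closed Phi_add Phi_pure phi_add sB_add_left)

lemma pure_zero: "b \<in> carrier B \<Longrightarrow> pure \<zero>\<^bsub>L\<^esub> b = \<zero>\<^bsub>LB\<^esub>"
  by (rule LB_eqI) (auto simp: pure_closed LB_zero_closed Phi_zero Phi_pure phi_zero sB_null_left)

lemma pure_smult: "\<lbrakk>a \<in> carrier A; x \<in> carrier L; b \<in> carrier B\<rbrakk> \<Longrightarrow> pure (a \<odot>\<^bsub>L\<^esub> x) b = (a \<odot>\<^bsub>B\<^esub> b) \<odot>\<^bsub>LB\<^esub> pure x \<one>\<^bsub>B\<^esub>"
  by (rule LB_eqI)
    (auto simp: pure_closed LB_smult_closed Phi_smult Phi_pure phi_smult sB_mult_left sB_mult_right R.m_comm sB_assoc[symmetric])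

lemma pure_finsum:
  "\<lbrakk>\<And>i. i \<in> I \<Longrightarrow> f i \<in> carrier L; b \<in> carrier B\<rbrakk> \<Longrightarrow> pure (finsum L f I) b = (\<Oplus>\<^bsub>LB\<^esub>i\<in>I. pure (f i) b)"
  by (rule additive_finsum[OF L_abelian module.axioms(2)[OF LB_module], where h = "\<lambda>x. pure x b"])
    (auto simp: pure_closed pure_add)

lemma lie_pure:
  "\<lbrakk>x \<in> carrier L; y \<in> carrier L; b \<in> carrier B; c \<in> carrier B\<rbrakk> \<Longrightarrow>
    lie LB (pure x b) (pure y c) = pure (lie L x y) (b \<otimes>\<^bsub>B\<^esub> c)"
  by (simp add: pure_def LB_lie)

text \<open>Zero needs no case of its own because it is the pure tensor of two zeros.\<close>

lemma LB_induct [consumes 1, case_names pure add]: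
  assumes "U \<in> carrier LB"
    and pure: "\<And>x b. \<lbrakk>x \<in> carrier L; b \<in> carrier B\<rbrakk> \<Longrightarrow> P (pure x b)"
    and add: "\<And>U V. \<lbrakk>U \<in> carrier LB; V \<in> carrier LB; P U; P V\<rbrakk> \<Longrightarrow> P (U \<oplus>\<^bsub>LB\<^esub> V)"
  shows "P U"
proof -
  have "P (tclass xs)" if "tvalid xs" for xs
    using that
  proof (induct xs)
    case Nil
    have "P (pure \<zero>\<^bsub>L\<^esub> \<zero>\<^bsub>B\<^esub>)" by (rule pure) auto
    then show ?case by (simp add: pure_zero LB_zero)
  next
    case (Cons p xs)
    obtain x b where p: "p = (x, b)" by (cases p)
    have "P (pure x b \<oplus>\<^bsub>LB\<^esub> tclass xs)"
      using Cons p by (intro add pure pure_closed tclass_closed) auto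
    then show ?case using Cons p by (simp add: pure_def LB_add)
  qed
  then show ?thesis using assms(1) by (auto elim: LB_cases)
qed

lemma LB_lie_closed: "\<lbrakk>U \<in> carrier LB; V \<in> carrier LB\<rbrakk> \<Longrightarrow> lie LB U V \<in> carrier LB"
  by (auto elim!: LB_cases simp: LB_lie intro!: tclass_closed)

lemma LB_lie_add_left:
  "\<lbrakk>U \<in> carrier LB; V \<in> carrier LB; W \<in> carrier LB\<rbrakk> \<Longrightarrow> lie LB (U \<oplus>\<^bsub>LB\<^esub> V) W = lie LB U W \<oplus>\<^bsub>LB\<^esub> lie LB V W"
  by (auto elim!: LB_cases simp: LB_lie LB_add)

lemma LB_lie_anti:
  assumes "U \<in> carrier LB" "V \<in> carrier LB"
  shows "lie LB U V = \<ominus>\<^bsub>LB\<^esub> lie LB V U"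
proof -
  interpret LB: module B LB by (rule LB_module)
  have "lie LB U V \<oplus>\<^bsub>LB\<^esub> lie LB V U = \<zero>\<^bsub>LB\<^esub>"
  proof (rule LB_eqI)
    fix i assume i: "i < n"
    obtain xs ys where "tvalid xs" "tvalid ys" "U = tclass xs" "V = tclass ys"
      using assms by (meson LB_cases)
    then show "\<Phi> i (lie LB U V \<oplus>\<^bsub>LB\<^esub> lie LB V U) = \<Phi> i \<zero>\<^bsub>LB\<^esub>"
      using i by (simp add: LB_lie Phi_add tclass_closed Phi_tclass Phi_zero tsum_tlie_anti[of xs ys] functional_phi B.l_neg)
  qed (use assms in \<open>auto simp: LB_lie_closed\<close>)
  then show ?thesis using assms by (intro LB.minus_equality[symmetric]) (auto simp: LB_lie_closed)
qed

lemma LB_lie_add_right: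
  assumes "U \<in> carrier LB" "V \<in> carrier LB" "W \<in> carrier LB"
  shows "lie LB W (U \<oplus>\<^bsub>LB\<^esub> V) = lie LB W U \<oplus>\<^bsub>LB\<^esub> lie LB W V"
proof -
  interpret LB: module B LB by (rule LB_module)
  show ?thesis
    using assms by (simp add: LB_lie_anti[of W] LB_lie_add_left LB.minus_add LB_lie_closed)
qed

lemma LB_lie_smult_left:
  assumes "b \<in> carrier B" "U \<in> carrier LB" "V \<in> carrier LB"
  shows "lie LB (b \<odot>\<^bsub>LB\<^esub> U) V = b \<odot>\<^bsub>LB\<^esub> lie LB U V"
proof -
  have "tlie (tsm b xs) ys = tsm b (tlie xs ys)" if "tvalid xs" "tvalid ys" for xs ys
  proof -
    have "tlie (tsm b [p]) ys = tsm b (tlie [p] ys)" if "tvalid [p]" for p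
      using \<open>tvalid ys\<close> that assms(1) by (induct ys; cases p) (auto simp: tsm_def B.m_assoc tvalid_def)
    then show ?thesis using \<open>tvalid xs\<close>
      by (induct xs) (fastforce simp: tsm_def)+
  qed
  then show ?thesis using assms by (auto elim!: LB_cases simp: LB_smult LB_lie)
qed

lemma LB_lie_smult_right:
  assumes "b \<in> carrier B" "U \<in> carrier LB" "V \<in> carrier LB"
  shows "lie LB V (b \<odot>\<^bsub>LB\<^esub> U) = b \<odot>\<^bsub>LB\<^esub> lie LB V U"
proof -
  interpret LB: module B LB by (rule LB_module)
  show ?thesis
    using assms by (simp add: LB_lie_anti[of V] LB_lie_smult_left LB.smult_r_minus LB_lie_closed)
qed

text \<open>This does not follow from antisymmetry when 2 is not cancellable. It holds on pure
  tensors, and in a sum the two mixed brackets cancel.\<close>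

lemma LB_lie_self:
  assumes "U \<in> carrier LB"
  shows "lie LB U U = \<zero>\<^bsub>LB\<^esub>"
proof -
  interpret LB: module B LB by (rule LB_module)
  show ?thesis using assms
  proof (induct rule: LB_induct)
    case (pure x b)
    then show ?case by (simp add: lie_pure lie_self pure_zero)
  next
    case (add U V)
    then show ?case
      by (simp add: LB_lie_add_left LB_lie_add_right LB_lie_closed LB_lie_anti[of V U] LB.l_neg LB.r_neg)
  qed
qed

text \<open>The expression is additive in each argument, so three nested inductions reduce it to
  pure tensors.\<close>

lemma LB_jacobi:
  assumes "U \<in> carrier LB" "V \<in> carrier LB" "W \<in> carrier LB"
  shows "lie LB U (lie LB V W) \<oplus>\<^bsub>LB\<^esub> lie LB V (lie LB W U) \<oplus>\<^bsub>LB\<^esub> lie LB W (lie LB U V) = \<zero>\<^bsub>LB\<^esub>"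
    (is "?J U V W = _")
proof -
  interpret LB: module B LB by (rule LB_module)
  have split: "(a \<oplus>\<^bsub>LB\<^esub> a') \<oplus>\<^bsub>LB\<^esub> (b \<oplus>\<^bsub>LB\<^esub> b') \<oplus>\<^bsub>LB\<^esub> (c \<oplus>\<^bsub>LB\<^esub> c') = (a \<oplus>\<^bsub>LB\<^esub> b \<oplus>\<^bsub>LB\<^esub> c) \<oplus>\<^bsub>LB\<^esub> (a' \<oplus>\<^bsub>LB\<^esub> b' \<oplus>\<^bsub>LB\<^esub> c')"
    if "a \<in> carrier LB" "b \<in> carrier LB" "c \<in> carrier LB" "a' \<in> carrier LB" "b' \<in> carrier LB" "c' \<in> carrier LB" for a b c a' b' c'
    using that by (simp add: LB.a_ac)
  note dist = LB_lie_add_left LB_lie_add_right LB_lie_closed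
  show ?thesis using assms
  proof (induct arbitrary: V W rule: LB_induct)
    case U: (pure x b)
    from U(3,4) U(1,2) show ?case
    proof (induct arbitrary: W rule: LB_induct)
      case V: (pure y c)
      from V(3) V(1,2,4,5) show ?case
      proof (induct rule: LB_induct)
        case W: (pure z d)
        \<comment> \<open>The three cyclic products of the scalars agree, and the Jacobi identity of
          \<open>L\<close> remains, tensored with \<open>t\<close>.\<close>
        define t where "t = b \<otimes>\<^bsub>B\<^esub> (c \<otimes>\<^bsub>B\<^esub> d)"
        have "c \<otimes>\<^bsub>B\<^esub> (d \<otimes>\<^bsub>B\<^esub> b) = t" "d \<otimes>\<^bsub>B\<^esub> (b \<otimes>\<^bsub>B\<^esub> c) = t" "t \<in> carrier B"
          using W by (auto simp: t_def B.m_ac)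
        then show ?case
          using W by (simp add: lie_pure lie_closed jacobi pure_zero flip: pure_add t_def)
      next
        case (add U' V')
        then show ?case by (simp add: dist pure_closed split)
      qed
    next
      case (add U' V')
      then show ?case by (simp add: dist pure_closed split)
    qed
  next
    case (add U' V')
    then show ?case by (simp add: dist split)
  qed
qed

lemma LB_lie_algebra: "lie_algebra B LB"
  by (intro lie_algebra.intro lie_algebra_axioms.intro LB_module)
    (auto simp: LB_lie_closed LB_lie_add_left LB_lie_add_right LB_lie_smult_left LB_lie_smult_right LB_lie_self LB_jacobi)

definition eB :: "nat \<Rightarrow> ('g \<times> 'b) list set"
  where "eB i = pure (e i) \<one>\<^bsub>B\<^esub>"

lemma eB_closed: "i < n \<Longrightarrow> eB i \<in> carrier LB"
  by (simp add: eB_def pure_closed)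

lemma LB_expand:
  assumes "U \<in> carrier LB"
  shows "(\<Oplus>\<^bsub>LB\<^esub>i\<in>{..<n}. \<Phi> i U \<odot>\<^bsub>LB\<^esub> eB i) = U"
proof -
  interpret LB: module B LB by (rule LB_module)
  show ?thesis using assms
  proof (induct rule: LB_induct)
    case (pure x b)
    have "(\<Oplus>\<^bsub>LB\<^esub>i\<in>{..<n}. \<Phi> i (pure x b) \<odot>\<^bsub>LB\<^esub> eB i) = (\<Oplus>\<^bsub>LB\<^esub>i\<in>{..<n}. pure (\<phi> i x \<odot>\<^bsub>L\<^esub> e i) b)"
      using pure by (intro LB.finsum_cong_closed) (auto simp: pure_closed Phi_pure pure_smult eB_def)
    also have "\<dots> = pure x b"
      using pure by (subst pure_finsum[symmetric]) (simp_all add: expand)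
    finally show ?case .
  next
    case (add U V)
    have "(\<Oplus>\<^bsub>LB\<^esub>i\<in>{..<n}. \<Phi> i (U \<oplus>\<^bsub>LB\<^esub> V) \<odot>\<^bsub>LB\<^esub> eB i)
      = (\<Oplus>\<^bsub>LB\<^esub>i\<in>{..<n}. \<Phi> i U \<odot>\<^bsub>LB\<^esub> eB i \<oplus>\<^bsub>LB\<^esub> \<Phi> i V \<odot>\<^bsub>LB\<^esub> eB i)"
      using add by (intro LB.finsum_cong_closed) (auto simp: eB_closed Phi_add LB.smult_l_distr)
    then show ?case using add by (simp add: LB.finsum_addf eB_closed)
  qed
qed

text \<open>The dual basis survives base change. Everything proved for \<open>L\<close> over
  \<open>A\<close> is thus available for \<open>LB\<close> over \<open>B\<close>, in particular the
  lifting theorem.\<close>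

lemma LB_lie_fg: "lie_fg B LB n eB \<Phi>"
  by (intro lie_fg.intro lie_fg_axioms.intro LB_lie_algebra)
    (auto simp: eB_closed Phi_add Phi_smult LB_expand)

sublocale LB: lie_fg B LB n eB \<Phi>
  by (rule LB_lie_fg)

text \<open>The identity clause is linear and checked on the generators. The invariance clause for
  \<open>U\<close> is additive in \<open>U\<close> and reduces to pure tensors, so no Killing form
  over \<open>B\<close> is needed.\<close>

lemma casimir_base_change:
  assumes "casimir e'"
  shows "LB.casimir (\<lambda>i. pure (e' i) \<one>\<^bsub>B\<^esub>)"
proof -
  note e' = assms[unfolded casimir_def, THEN conjunct1, rule_format]
  have cas: "(\<Oplus>\<^bsub>L\<^esub>i\<in>{..<n}. lie L (e i) (lie L (e' i) x)) = x" if "x \<in> carrier L" for x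
    using assms that by (simp add: casimir_def)
  have "(\<Oplus>\<^bsub>LB\<^esub>i\<in>{..<n}. lie LB (eB i) (lie LB (pure (e' i) \<one>\<^bsub>B\<^esub>) U)) = U" if "U \<in> carrier LB" for U
  proof (rule LB.endo_eqI[OF _ LB.endo_id _ that])
    show "LB.endo (\<lambda>U. \<Oplus>\<^bsub>LB\<^esub>i\<in>{..<n}. lie LB (eB i) (lie LB (pure (e' i) \<one>\<^bsub>B\<^esub>) U))"
      using e' by (intro LB.endo_sum LB.endo_comp[OF LB.endo_ad LB.endo_ad]) (auto simp: pure_closed eB_closed)
    fix j assume j: "j < n"
    have "(\<Oplus>\<^bsub>LB\<^esub>i\<in>{..<n}. lie LB (eB i) (lie LB (pure (e' i) \<one>\<^bsub>B\<^esub>) (eB j)))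
      = (\<Oplus>\<^bsub>LB\<^esub>i\<in>{..<n}. pure (lie L (e i) (lie L (e' i) (e j))) \<one>\<^bsub>B\<^esub>)"
      using j e' by (intro LB.M.finsum_cong_closed) (auto simp: eB_def lie_pure lie_closed pure_closed)
    also have "\<dots> = eB j"
      using j e' by (subst pure_finsum[symmetric]) (auto simp: lie_closed cas eB_def)
    finally show "(\<Oplus>\<^bsub>LB\<^esub>i\<in>{..<n}. lie LB (eB i) (lie LB (pure (e' i) \<one>\<^bsub>B\<^esub>) (eB j))) = eB j" .
  qed
  moreover have "\<exists>k. (\<forall>i<n. \<forall>j<n. k i j \<in> carrier B) \<and>
      (\<forall>i<n. lie LB (eB i) U = (\<Oplus>\<^bsub>LB\<^esub>j\<in>{..<n}. k i j \<odot>\<^bsub>LB\<^esub> eB j)) \<and>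
      (\<forall>j<n. lie LB U (pure (e' j) \<one>\<^bsub>B\<^esub>) = (\<Oplus>\<^bsub>LB\<^esub>i\<in>{..<n}. k i j \<odot>\<^bsub>LB\<^esub> pure (e' i) \<one>\<^bsub>B\<^esub>))"
    if "U \<in> carrier LB" for U
    using that
  proof (induct rule: LB_induct)
    case (pure x b)
    have "\<exists>k. (\<forall>i<n. \<forall>j<n. k i j \<in> carrier A) \<and>
      (\<forall>i<n. lie L (e i) x = (\<Oplus>\<^bsub>L\<^esub>j\<in>{..<n}. k i j \<odot>\<^bsub>L\<^esub> e j)) \<and>
      (\<forall>j<n. lie L x (e' j) = (\<Oplus>\<^bsub>L\<^esub>i\<in>{..<n}. k i j \<odot>\<^bsub>L\<^esub> e' i))"
      using assms pure(1) unfolding casimir_def by (elim conjE) (drule (1) bspec)+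
    then obtain k where "\<forall>i<n. \<forall>j<n. k i j \<in> carrier A"
      "\<forall>i<n. lie L (e i) x = (\<Oplus>\<^bsub>L\<^esub>j\<in>{..<n}. k i j \<odot>\<^bsub>L\<^esub> e j)"
      "\<forall>j<n. lie L x (e' j) = (\<Oplus>\<^bsub>L\<^esub>i\<in>{..<n}. k i j \<odot>\<^bsub>L\<^esub> e' i)"
      by (elim exE conjE)
    note k = this(1)[rule_format] and k1 = this(2)[rule_format] and k2 = this(3)[rule_format]
    show ?case
    \<comment> \<open>The matrix for x (x) b is the matrix for x scaled by b.\<close>
    proof (intro exI[of _ "\<lambda>i j. k i j \<odot>\<^bsub>B\<^esub> b"] conjI allI impI)
      fix i assume i: "i < n"
      have "lie LB (eB i) (pure x b) = pure (\<Oplus>\<^bsub>L\<^esub>j\<in>{..<n}. k i j \<odot>\<^bsub>L\<^esub> e j) b"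
        using i pure by (simp add: eB_def lie_pure k1)
      also have "\<dots> = (\<Oplus>\<^bsub>LB\<^esub>j\<in>{..<n}. pure (k i j \<odot>\<^bsub>L\<^esub> e j) b)"
        using i pure k by (intro pure_finsum) auto
      also have "\<dots> = (\<Oplus>\<^bsub>LB\<^esub>j\<in>{..<n}. (k i j \<odot>\<^bsub>B\<^esub> b) \<odot>\<^bsub>LB\<^esub> eB j)"
        using i pure k by (intro LB.M.finsum_cong_closed) (auto simp: pure_smult eB_def pure_closed)
      finally show "lie LB (eB i) (pure x b) = (\<Oplus>\<^bsub>LB\<^esub>j\<in>{..<n}. (k i j \<odot>\<^bsub>B\<^esub> b) \<odot>\<^bsub>LB\<^esub> eB j)" .
    next
      fix j assume j: "j < n"
      have "lie LB (pure x b) (pure (e' j) \<one>\<^bsub>B\<^esub>) = pure (\<Oplus>\<^bsub>L\<^esub>i\<in>{..<n}. k i j \<odot>\<^bsub>L\<^esub> e' i) b"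
        using j pure e' by (simp add: lie_pure k2)
      also have "\<dots> = (\<Oplus>\<^bsub>LB\<^esub>i\<in>{..<n}. pure (k i j \<odot>\<^bsub>L\<^esub> e' i) b)"
        using j pure k e' by (intro pure_finsum) auto
      also have "\<dots> = (\<Oplus>\<^bsub>LB\<^esub>i\<in>{..<n}. (k i j \<odot>\<^bsub>B\<^esub> b) \<odot>\<^bsub>LB\<^esub> pure (e' i) \<one>\<^bsub>B\<^esub>)"
        using j pure k e' by (intro LB.M.finsum_cong_closed) (auto simp: pure_smult pure_closed)
      finally show "lie LB (pure x b) (pure (e' j) \<one>\<^bsub>B\<^esub>) = (\<Oplus>\<^bsub>LB\<^esub>i\<in>{..<n}. (k i j \<odot>\<^bsub>B\<^esub> b) \<odot>\<^bsub>LB\<^esub> pure (e' i) \<one>\<^bsub>B\<^esub>)" .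
    qed (use k pure in auto)
  next
    case (add U V)
    obtain k where "\<forall>i<n. \<forall>j<n. k i j \<in> carrier B"
      "\<forall>i<n. lie LB (eB i) U = (\<Oplus>\<^bsub>LB\<^esub>j\<in>{..<n}. k i j \<odot>\<^bsub>LB\<^esub> eB j)"
      "\<forall>j<n. lie LB U (pure (e' j) \<one>\<^bsub>B\<^esub>) = (\<Oplus>\<^bsub>LB\<^esub>i\<in>{..<n}. k i j \<odot>\<^bsub>LB\<^esub> pure (e' i) \<one>\<^bsub>B\<^esub>)"
      using add(3) by (elim exE conjE)
    note k = this[rule_format]
    obtain l where "\<forall>i<n. \<forall>j<n. l i j \<in> carrier B"
      "\<forall>i<n. lie LB (eB i) V = (\<Oplus>\<^bsub>LB\<^esub>j\<in>{..<n}. l i j \<odot>\<^bsub>LB\<^esub> eB j)"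
      "\<forall>j<n. lie LB V (pure (e' j) \<one>\<^bsub>B\<^esub>) = (\<Oplus>\<^bsub>LB\<^esub>i\<in>{..<n}. l i j \<odot>\<^bsub>LB\<^esub> pure (e' i) \<one>\<^bsub>B\<^esub>)"
      using add(4) by (elim exE conjE)
    note l = this[rule_format]
    have sum: "(\<Oplus>\<^bsub>LB\<^esub>j\<in>{..<n}. p j \<odot>\<^bsub>LB\<^esub> v j) \<oplus>\<^bsub>LB\<^esub> (\<Oplus>\<^bsub>LB\<^esub>j\<in>{..<n}. q j \<odot>\<^bsub>LB\<^esub> v j) = (\<Oplus>\<^bsub>LB\<^esub>j\<in>{..<n}. (p j \<oplus>\<^bsub>B\<^esub> q j) \<odot>\<^bsub>LB\<^esub> v j)"
      if "\<And>j. j < n \<Longrightarrow> p j \<in> carrier B" "\<And>j. j < n \<Longrightarrow> q j \<in> carrier B" "\<And>j. j < n \<Longrightarrow> v j \<in> carrier LB" for p q v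
    proof -
      have "(\<Oplus>\<^bsub>LB\<^esub>j\<in>{..<n}. (p j \<oplus>\<^bsub>B\<^esub> q j) \<odot>\<^bsub>LB\<^esub> v j) = (\<Oplus>\<^bsub>LB\<^esub>j\<in>{..<n}. p j \<odot>\<^bsub>LB\<^esub> v j \<oplus>\<^bsub>LB\<^esub> q j \<odot>\<^bsub>LB\<^esub> v j)"
        using that by (intro LB.M.finsum_cong_closed) (auto simp: LB.smult_l_distr)
      then show ?thesis using that by (simp add: LB.M.finsum_addf)
    qed
    show ?case
      by (intro exI[of _ "\<lambda>i j. k i j \<oplus>\<^bsub>B\<^esub> l i j"] conjI allI impI)
        (use add k l e' in \<open>simp_all add: LB_lie_add_left LB_lie_add_right eB_closed pure_closed sum\<close>)
  qed
  ultimately show ?thesis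
    using e' by (simp add: LB.casimir_def pure_closed)
qed

end

section \<open>Algebra homomorphisms and the maps they induce between base changes\<close>

lemma alg_homD:
  assumes "h \<in> alg_hom A B C"
  shows "h \<in> ring_hom B C"
    and "x \<in> carrier B \<Longrightarrow> h x \<in> carrier C"
    and "\<lbrakk>x \<in> carrier B; y \<in> carrier B\<rbrakk> \<Longrightarrow> h (x \<oplus>\<^bsub>B\<^esub> y) = h x \<oplus>\<^bsub>C\<^esub> h y"
    and "\<lbrakk>x \<in> carrier B; y \<in> carrier B\<rbrakk> \<Longrightarrow> h (x \<otimes>\<^bsub>B\<^esub> y) = h x \<otimes>\<^bsub>C\<^esub> h y"
    and "\<lbrakk>a \<in> carrier A; x \<in> carrier B\<rbrakk> \<Longrightarrow> h (a \<odot>\<^bsub>B\<^esub> x) = a \<odot>\<^bsub>C\<^esub> h x"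
    and "h \<one>\<^bsub>B\<^esub> = \<one>\<^bsub>C\<^esub>"
    and "h \<in> extensional (carrier B)"
  using assms by (auto simp: alg_hom_def ring_hom_def mod_hom_def PiE_def)

lemma alg_homI:
  assumes "\<And>x. x \<in> carrier B \<Longrightarrow> h x \<in> carrier C"
    and "\<And>x y. \<lbrakk>x \<in> carrier B; y \<in> carrier B\<rbrakk> \<Longrightarrow> h (x \<oplus>\<^bsub>B\<^esub> y) = h x \<oplus>\<^bsub>C\<^esub> h y"
    and "\<And>x y. \<lbrakk>x \<in> carrier B; y \<in> carrier B\<rbrakk> \<Longrightarrow> h (x \<otimes>\<^bsub>B\<^esub> y) = h x \<otimes>\<^bsub>C\<^esub> h y"
    and "\<And>a x. \<lbrakk>a \<in> carrier A; x \<in> carrier B\<rbrakk> \<Longrightarrow> h (a \<odot>\<^bsub>B\<^esub> x) = a \<odot>\<^bsub>C\<^esub> h x"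
    and "h \<one>\<^bsub>B\<^esub> = \<one>\<^bsub>C\<^esub>"
    and "h \<in> extensional (carrier B)"
  shows "h \<in> alg_hom A B C"
  using assms by (auto simp: alg_hom_def ring_hom_def mod_hom_def PiE_def)

lemma alg_hom_restrictI:
  assumes "algebra A B"
    and "\<And>x. x \<in> carrier B \<Longrightarrow> h x \<in> carrier C"
    and "\<And>x y. \<lbrakk>x \<in> carrier B; y \<in> carrier B\<rbrakk> \<Longrightarrow> h (x \<oplus>\<^bsub>B\<^esub> y) = h x \<oplus>\<^bsub>C\<^esub> h y"
    and "\<And>x y. \<lbrakk>x \<in> carrier B; y \<in> carrier B\<rbrakk> \<Longrightarrow> h (x \<otimes>\<^bsub>B\<^esub> y) = h x \<otimes>\<^bsub>C\<^esub> h y"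
    and "\<And>a x. \<lbrakk>a \<in> carrier A; x \<in> carrier B\<rbrakk> \<Longrightarrow> h (a \<odot>\<^bsub>B\<^esub> x) = a \<odot>\<^bsub>C\<^esub> h x"
    and "h \<one>\<^bsub>B\<^esub> = \<one>\<^bsub>C\<^esub>"
  shows "(\<lambda>x\<in>carrier B. h x) \<in> alg_hom A B C"
proof -
  interpret algebra A B by fact
  show ?thesis by (rule alg_homI) (auto simp: assms)
qed

lemma alg_hom_comp:
  assumes "algebra A B" "h \<in> alg_hom A B C" "k \<in> alg_hom A C D"
  shows "(\<lambda>x\<in>carrier B. k (h x)) \<in> alg_hom A B D"
  using assms(1) by (rule alg_hom_restrictI) (simp_all add: alg_homD[OF assms(2)] alg_homD[OF assms(3)])

lemma alg_hom_id:
  assumes "algebra A B"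
  shows "(\<lambda>x\<in>carrier B. x) \<in> alg_hom A B B"
  using assms by (rule alg_hom_restrictI) auto

lemma alg_hom_eqI:
  assumes "h \<in> alg_hom A B C" "k \<in> alg_hom A B C" "\<And>x. x \<in> carrier B \<Longrightarrow> h x = k x"
  shows "h = k"
  using alg_homD(7)[OF assms(1)] alg_homD(7)[OF assms(2)] assms(3) by (rule extensionalityI)

locale lie_fg_base_change_hom =
  B: lie_fg_base_change A L n e \<phi> B + C: lie_fg_base_change A L n e \<phi> C
  for A :: "('a, 'm) ring_scheme" and L :: "('a, 'g, 'k) lie_alg_scheme"
    and n e \<phi> and B :: "('a, 'b, 'l) module_scheme" and C :: "('a, 'c, 'j) module_scheme" +
  fixes h
  assumes hom: "h \<in> alg_hom A B C"
begin

lemmas h_closed = alg_homD(2)[OF hom]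
  and h_add = alg_homD(3)[OF hom]
  and h_mult = alg_homD(4)[OF hom]
  and h_smult = alg_homD(5)[OF hom]
  and h_one = alg_homD(6)[OF hom]

lemma h_zero: "h \<zero>\<^bsub>B\<^esub> = \<zero>\<^bsub>C\<^esub>"
  by (rule additive_zero[OF B.B_abelian C.B_abelian]) (auto simp: h_closed h_add)

lemma h_minus: "\<lbrakk>x \<in> carrier B; y \<in> carrier B\<rbrakk> \<Longrightarrow> h (x \<ominus>\<^bsub>B\<^esub> y) = h x \<ominus>\<^bsub>C\<^esub> h y"
  using additive_neg[OF B.B_abelian C.B_abelian, of h y]
  by (simp add: a_minus_def h_closed h_add Pi_iff)

definition tmap :: "('g \<times> 'b) list \<Rightarrow> ('g \<times> 'c) list"
  where "tmap xs = map (\<lambda>(x, r). (x, h r)) xs"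

lemma tmap_valid: "B.tvalid xs \<Longrightarrow> C.tvalid (tmap xs)"
  by (auto simp: tmap_def B.tvalid_def C.tvalid_def h_closed)

lemma tsum_tmap: "\<lbrakk>B.functional g; B.tvalid xs\<rbrakk> \<Longrightarrow> C.tsum g (tmap xs) = h (B.tsum g xs)"
  by (induct xs) (auto simp: tmap_def h_zero h_add h_smult B.functional_closed)

abbreviation bc :: "('g \<times> 'b) list set \<Rightarrow> ('g \<times> 'c) list set"
  where "bc \<equiv> base_change_map A L C h"

lemma bc_tclass:
  assumes "B.tvalid xs"
  shows "bc (B.tclass xs) = C.tclass (tmap xs)"
proof -
  have "tensor_eq A L C (tmap xs) zs"
    if "tensor_eq A L B xs xs'" "tensor_eq A L C (tmap xs') zs" for xs' zs
  proof -
    have v: "B.tvalid xs'" using B.tensor_eq_valid[OF that(1)] by simp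
    have "tensor_eq A L C (tmap xs) (tmap xs')"
      using B.tensor_eq_tsum[OF that(1) B.functional_phi] assms v
      by (simp add: C.tensor_eq_iff tmap_valid tsum_tmap B.functional_phi)
    then show ?thesis using that(2) by (rule tensor_eq.trans)
  qed
  then show ?thesis
    using B.trefl[OF assms] by (simp add: base_change_map_def B.tclass_def C.tclass_def set_eq_iff flip: tmap_def) blast
qed

lemma bc_closed: "U \<in> carrier B.LB \<Longrightarrow> bc U \<in> carrier C.LB"
  by (erule B.LB_cases) (simp add: bc_tclass C.tclass_closed tmap_valid)

text \<open>Coordinates are natural in the algebra. With \<open>LB_eqI\<close> this reduces the
  linearity of \<open>bc\<close> to the homomorphism laws of \<open>h\<close>.\<close>

lemma Phi_bc: "\<lbrakk>i < n; U \<in> carrier B.LB\<rbrakk> \<Longrightarrow> C.\<Phi> i (bc U) = h (B.\<Phi> i U)"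
  by (erule B.LB_cases) (simp add: bc_tclass C.Phi_tclass B.Phi_tclass tmap_valid tsum_tmap B.functional_phi)

lemma bc_add: "\<lbrakk>U \<in> carrier B.LB; V \<in> carrier B.LB\<rbrakk> \<Longrightarrow> bc (U \<oplus>\<^bsub>B.LB\<^esub> V) = bc U \<oplus>\<^bsub>C.LB\<^esub> bc V"
  by (rule C.LB_eqI) (simp_all add: bc_closed Phi_bc B.Phi_add C.Phi_add h_add)

lemma bc_smult: "\<lbrakk>b \<in> carrier B; U \<in> carrier B.LB\<rbrakk> \<Longrightarrow> bc (b \<odot>\<^bsub>B.LB\<^esub> U) = h b \<odot>\<^bsub>C.LB\<^esub> bc U"
  by (rule C.LB_eqI) (simp_all add: bc_closed Phi_bc B.Phi_smult C.Phi_smult h_mult h_closed)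

lemma bc_finsum:
  "(\<And>i. i \<in> I \<Longrightarrow> f i \<in> carrier B.LB) \<Longrightarrow> bc (finsum B.LB f I) = (\<Oplus>\<^bsub>C.LB\<^esub>i\<in>I. bc (f i))"
  by (rule additive_finsum[OF B.LB.L_abelian C.LB.L_abelian]) (auto simp: bc_closed bc_add)

lemma bc_eB: "i < n \<Longrightarrow> bc (B.eB i) = C.eB i"
  by (simp add: B.eB_def C.eB_def B.pure_def C.pure_def bc_tclass tmap_def h_one)

lemma tmap_tlie:
  assumes "B.tvalid xs" "B.tvalid ys"
  shows "tmap (B.tlie xs ys) = C.tlie (tmap xs) (tmap ys)"
  using assms(1)
proof (induct xs)
  case (Cons p xs)
  obtain x b where p: "p = (x, b)" by (cases p)
  have "map (\<lambda>(x, r). (x, h r)) (map (\<lambda>(y, c). (lie L x y, b \<otimes>\<^bsub>B\<^esub> c)) ys)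
    = map (\<lambda>(y, c). (lie L x y, h b \<otimes>\<^bsub>C\<^esub> c)) (map (\<lambda>(x, r). (x, h r)) ys)"
    using Cons p assms(2) by (auto simp: h_mult B.tvalid_def)
  then show ?case using Cons p by (simp add: tmap_def)
qed (simp add: tmap_def)

lemma bc_lie: "\<lbrakk>U \<in> carrier B.LB; V \<in> carrier B.LB\<rbrakk> \<Longrightarrow> bc (lie B.LB U V) = lie C.LB (bc U) (bc V)"
  by (elim B.LB_cases) (simp add: bc_tclass B.LB_lie C.LB_lie tmap_valid tmap_tlie)

lemma is_mat_hom: "B.LB.is_mat c \<Longrightarrow> C.LB.is_mat (\<lambda>i j. h (c i j))"
  by (simp add: B.LB.is_mat_def C.LB.is_mat_def h_closed)

lemma bc_mat_map:
  assumes "B.LB.is_mat c" "U \<in> carrier B.LB"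
  shows "bc (B.LB.mat_map c U) = C.LB.mat_map (\<lambda>i j. h (c i j)) (bc U)"
proof -
  have c: "c i j \<in> carrier B" if "i < n" "j < n" for i j
    using assms(1) that by (simp add: B.LB.is_mat_def)
  have col: "bc (\<Oplus>\<^bsub>B.LB\<^esub>i\<in>{..<n}. c i j \<odot>\<^bsub>B.LB\<^esub> B.eB i) = (\<Oplus>\<^bsub>C.LB\<^esub>i\<in>{..<n}. h (c i j) \<odot>\<^bsub>C.LB\<^esub> C.eB i)"
    if "j < n" for j
    using that c
    by (subst bc_finsum) (auto simp: bc_smult bc_eB h_closed intro!: C.LB.M.finsum_cong_closed)
  have "bc (B.LB.mat_map c U)
    = (\<Oplus>\<^bsub>C.LB\<^esub>j\<in>{..<n}. bc (B.\<Phi> j U \<odot>\<^bsub>B.LB\<^esub> (\<Oplus>\<^bsub>B.LB\<^esub>i\<in>{..<n}. c i j \<odot>\<^bsub>B.LB\<^esub> B.eB i)))"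
    unfolding B.LB.mat_map_def using assms(2) c
    by (intro bc_finsum B.LB.smult_closed B.LB.M.finsum_closed) auto
  also have "\<dots> = C.LB.mat_map (\<lambda>i j. h (c i j)) (bc U)"
    unfolding C.LB.mat_map_def using assms(2) c
    by (intro C.LB.M.finsum_cong_closed)
      (auto simp: bc_smult col Phi_bc h_closed bc_closed B.LB.M.finsum_closed intro!: C.LB.smult_closed C.LB.M.finsum_closed)
  finally show ?thesis .
qed

text \<open>The relations are built from coordinates, brackets and \<open>mat_map\<close>, all of
  which commute with base change; so a homomorphism carries them to the relations between the images
  of the entries.\<close>

lemma rels_hom:
  assumes c: "B.LB.is_mat c" and d: "B.LB.is_mat d"
  shows "h ` B.LB.rels c d = C.LB.rels (\<lambda>i j. h (c i j)) (\<lambda>i j. h (d i j))"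
proof -
  have cl: "B.LB.mat_map c U \<in> carrier B.LB" if "B.LB.is_mat c" "U \<in> carrier B.LB" for c U
    using that by (rule B.LB.mat_map_closed)
  note facts = B.eB_closed cl B.LB_lie_closed h_minus bc_mat_map bc_lie bc_eB
  have "h (B.LB.rel_proj c p) = C.LB.rel_proj (\<lambda>i j. h (c i j)) p"
    if "p \<in> {..<n} \<times> {..<n}" "B.LB.is_mat c" for p c
  proof -
    have "c i j \<in> carrier B" if "i < n" "j < n" for i j
      using \<open>B.LB.is_mat c\<close> that by (simp add: B.LB.is_mat_def)
    then show ?thesis
      using that by (auto simp: B.LB.rel_proj_def C.LB.rel_proj_def facts simp flip: Phi_bc)
  qed
  moreover have "h (B.LB.rel_inv c d p) = C.LB.rel_inv (\<lambda>i j. h (c i j)) (\<lambda>i j. h (d i j)) p"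
    if "p \<in> {..<n} \<times> {..<n}" "B.LB.is_mat c" "B.LB.is_mat d" for p c d
    using that by (auto simp: B.LB.rel_inv_def C.LB.rel_inv_def facts simp flip: Phi_bc)
  moreover have "h (B.LB.rel_lie c p) = C.LB.rel_lie (\<lambda>i j. h (c i j)) p"
    if "p \<in> {..<n} \<times> {..<n} \<times> {..<n}" for p
    using that c by (auto simp: B.LB.rel_lie_def C.LB.rel_lie_def facts simp flip: Phi_bc)
  ultimately show ?thesis
    using c d by (simp add: B.LB.rels_def C.LB.rels_def image_Un image_image cong: image_cong_simp)
qed

end

section \<open>Polynomial rings\<close>

text \<open>Keeps the convolution sums of the polynomial product finite; \<open>finsum\<close> over
  an infinite set would be zero by convention.\<close>

lemma finite_submsets: "finite {k. k \<subseteq># (m :: 'i multiset)}"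
proof (induct m)
  case (add x m)
  have "{k. k \<subseteq># add_mset x m} \<subseteq> {k. k \<subseteq># m} \<union> add_mset x ` {k. k \<subseteq># m}"
  proof
    fix k assume k: "k \<in> {k. k \<subseteq># add_mset x m}"
    show "k \<in> {k. k \<subseteq># m} \<union> add_mset x ` {k. k \<subseteq># m}"
    proof (cases "x \<in># k")
      case True
      then obtain k' where k': "k = add_mset x k'" by (metis mset_add)
      then show ?thesis using k by auto
    next
      case False
      have "count k y \<le> count m y" for y
        using k False mset_subset_eq_count[of k "add_mset x m" y] by (cases "y = x") (auto simp: not_in_iff)
      then show ?thesis by (simp add: subseteq_mset_def)
    qed
  qed
  then show ?case using add by (meson finite_UnI finite_imageI finite_subset)
qed simp

context cring
begin

abbreviation mpoly :: "nat \<Rightarrow> ('a, nat multiset \<Rightarrow> 'a) module"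
  where "mpoly N \<equiv> mpoly_ring R N"

definition mono :: "'a \<Rightarrow> nat multiset \<Rightarrow> nat multiset \<Rightarrow> 'a"
  where "mono a m = (\<lambda>k. if k = m then a else \<zero>)"

lemma mpoly_simps:
  "\<zero>\<^bsub>mpoly N\<^esub> = (\<lambda>m. \<zero>)" "p \<oplus>\<^bsub>mpoly N\<^esub> q = (\<lambda>m. p m \<oplus> q m)" "a \<odot>\<^bsub>mpoly N\<^esub> p = (\<lambda>m. a \<otimes> p m)"
  "\<one>\<^bsub>mpoly N\<^esub> = mono \<one> {#}" "p \<otimes>\<^bsub>mpoly N\<^esub> q = (\<lambda>m. \<Oplus>k\<in>{k. k \<subseteq># m}. p k \<otimes> q (m - k))"
  by (simp_all add: mpoly_ring_def mono_def)

lemma mpoly_carrier_iff: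
  "p \<in> carrier (mpoly N) \<longleftrightarrow> (\<forall>m. p m \<in> carrier R) \<and> finite {m. p m \<noteq> \<zero>} \<and> (\<forall>m. p m \<noteq> \<zero> \<longrightarrow> set_mset m \<subseteq> {..<N})"
  by (simp add: mpoly_ring_def)

lemma mpoly_coeff_closed: "p \<in> carrier (mpoly N) \<Longrightarrow> p m \<in> carrier R"
  by (simp add: mpoly_carrier_iff)

lemma mono_closed: "\<lbrakk>a \<in> carrier R; set_mset m \<subseteq> {..<N}\<rbrakk> \<Longrightarrow> mono a m \<in> carrier (mpoly N)"
  by (auto simp: mpoly_carrier_iff mono_def)

lemma mpoly_zero_closed: "\<zero>\<^bsub>mpoly N\<^esub> \<in> carrier (mpoly N)"
  by (simp add: mpoly_carrier_iff mpoly_simps)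

lemma mpoly_add_closed:
  assumes "p \<in> carrier (mpoly N)" "q \<in> carrier (mpoly N)"
  shows "p \<oplus>\<^bsub>mpoly N\<^esub> q \<in> carrier (mpoly N)"
proof -
  have "{m. p m \<oplus> q m \<noteq> \<zero>} \<subseteq> {m. p m \<noteq> \<zero>} \<union> {m. q m \<noteq> \<zero>}" by auto
  then have "finite {m. p m \<oplus> q m \<noteq> \<zero>}"
    by (rule finite_subset) (use assms in \<open>simp add: mpoly_carrier_iff\<close>)
  moreover have "set_mset m \<subseteq> {..<N}" if "p m \<oplus> q m \<noteq> \<zero>" for m
    using that assms by (cases "p m = \<zero>"; cases "q m = \<zero>") (auto simp: mpoly_carrier_iff)
  ultimately show ?thesis using assms by (simp add: mpoly_carrier_iff mpoly_simps)
qed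

lemma mpoly_smult_closed:
  assumes "a \<in> carrier R" "p \<in> carrier (mpoly N)"
  shows "a \<odot>\<^bsub>mpoly N\<^esub> p \<in> carrier (mpoly N)"
proof -
  have "{m. a \<otimes> p m \<noteq> \<zero>} \<subseteq> {m. p m \<noteq> \<zero>}" using assms by auto
  then show ?thesis
    using assms finite_subset by (fastforce simp: mpoly_carrier_iff mpoly_simps)
qed

text \<open>The support of the product lies in the set of sums of exponents from the two supports;
  this bounds its size and its variables.\<close>

lemma mpoly_mult_closed:
  assumes "p \<in> carrier (mpoly N)" "q \<in> carrier (mpoly N)"
  shows "p \<otimes>\<^bsub>mpoly N\<^esub> q \<in> carrier (mpoly N)"
proof -
  let ?r = "p \<otimes>\<^bsub>mpoly N\<^esub> q"
  have ex: "\<exists>k. k \<subseteq># m \<and> p k \<noteq> \<zero> \<and> q (m - k) \<noteq> \<zero>" if "?r m \<noteq> \<zero>" for m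
  proof (rule ccontr)
    assume "\<not> ?thesis"
    then have "p k \<otimes> q (m - k) = \<zero>" if "k \<subseteq># m" for k
      using that assms by (cases "p k = \<zero>") (auto simp: mpoly_coeff_closed)
    then have "?r m = \<zero>" unfolding mpoly_simps by (intro add.finprod_one_eqI) auto
    then show False using that by simp
  qed
  have "{m. ?r m \<noteq> \<zero>} \<subseteq> (\<lambda>(k, l). k + l) ` ({k. p k \<noteq> \<zero>} \<times> {l. q l \<noteq> \<zero>})"
  proof
    fix m assume "m \<in> {m. ?r m \<noteq> \<zero>}"
    then obtain k where "k \<subseteq># m" "p k \<noteq> \<zero>" "q (m - k) \<noteq> \<zero>" using ex by blast
    then show "m \<in> (\<lambda>(k, l). k + l) ` ({k. p k \<noteq> \<zero>} \<times> {l. q l \<noteq> \<zero>})"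
      by (intro image_eqI[of _ _ "(k, m - k)"]) auto
  qed
  moreover have "finite ({k. p k \<noteq> \<zero>} \<times> {l. q l \<noteq> \<zero>})"
    using assms by (simp add: mpoly_carrier_iff)
  ultimately have "finite {m. ?r m \<noteq> \<zero>}"
    by (meson finite_imageI finite_subset)
  moreover have "set_mset m \<subseteq> {..<N}" if m: "?r m \<noteq> \<zero>" for m
  proof -
    obtain k where k: "k \<subseteq># m" "p k \<noteq> \<zero>" "q (m - k) \<noteq> \<zero>" using ex[OF m] by blast
    have "set_mset m = set_mset k \<union> set_mset (m - k)"
      using k(1) by (metis set_mset_union subset_mset.add_diff_inverse)
    then show ?thesis using k assms by (auto simp: mpoly_carrier_iff)
  qed
  moreover have "?r m \<in> carrier R" for m
    unfolding mpoly_simps using assms by (intro finsum_closed) (auto simp: mpoly_coeff_closed)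
  ultimately show ?thesis by (simp add: mpoly_carrier_iff)
qed

text \<open>Induction on a finite set containing the support, removing one coefficient at a time.
  Laws that are additive in each argument are thereby reduced to monomials.\<close>

lemma mpoly_induct [consumes 1, case_names mono add]:
  assumes "p \<in> carrier (mpoly N)"
    and mono: "\<And>a m. \<lbrakk>a \<in> carrier R; set_mset m \<subseteq> {..<N}\<rbrakk> \<Longrightarrow> P (mono a m)"
    and add: "\<And>p q. \<lbrakk>p \<in> carrier (mpoly N); q \<in> carrier (mpoly N); P p; P q\<rbrakk> \<Longrightarrow> P (p \<oplus>\<^bsub>mpoly N\<^esub> q)"
  shows "P p"
proof -
  have "P p" if "finite S" "p \<in> carrier (mpoly N)" "{m. p m \<noteq> \<zero>} \<subseteq> S" for S p
    using that
  proof (induct S arbitrary: p)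
    case empty
    then have "p = mono \<zero> {#}" by (auto simp: mono_def)
    then show ?case using mono[of \<zero> "{#}"] by simp
  next
    case (insert m S)
    show ?case
    proof (cases "p m = \<zero>")
      case True
      then show ?thesis using insert by auto
    next
      case False
      let ?q = "p(m := \<zero>)"
      have "{k. ?q k \<noteq> \<zero>} \<subseteq> {k. p k \<noteq> \<zero>}" by auto
      then have "finite {k. ?q k \<noteq> \<zero>}" by (rule finite_subset) (use insert(4) in \<open>simp add: mpoly_carrier_iff\<close>)
      then have q: "?q \<in> carrier (mpoly N)" using insert(4) by (auto simp: mpoly_carrier_iff)
      have m: "p m \<in> carrier R" "set_mset m \<subseteq> {..<N}" using insert(4) False by (auto simp: mpoly_carrier_iff)
      have "{k. ?q k \<noteq> \<zero>} \<subseteq> S" using insert(5) by auto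
      then have "P ?q" by (rule insert(3)[OF q])
      then have "P (?q \<oplus>\<^bsub>mpoly N\<^esub> mono (p m) m)" using q m by (intro add mono mono_closed)
      also have "?q \<oplus>\<^bsub>mpoly N\<^esub> mono (p m) m = p"
        using insert(4) by (auto simp: mpoly_simps mono_def mpoly_coeff_closed)
      finally show ?thesis .
    qed
  qed
  then show ?thesis using assms(1) by (auto simp: mpoly_carrier_iff)
qed

text \<open>Only the summand k = m of the convolution can be nonzero, and it occurs just when m is
  contained in the exponent and leaves l.\<close>

lemma mono_mult:
  assumes "a \<in> carrier R" "b \<in> carrier R"
  shows "mono a m \<otimes>\<^bsub>mpoly N\<^esub> mono b l = mono (a \<otimes> b) (m + l)"
proof
  fix x
  have "(mono a m \<otimes>\<^bsub>mpoly N\<^esub> mono b l) x = (\<Oplus>k\<in>{k. k \<subseteq># x}. if k = m then (if x - k = l then a \<otimes> b else \<zero>) else \<zero>)"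
    unfolding mpoly_simps using assms by (intro finsum_cong_closed) (auto simp: mono_def)
  also have "\<dots> = mono (a \<otimes> b) (m + l) x"
  proof (cases "m \<subseteq># x")
    case True
    have "(\<Oplus>k\<in>{k. k \<subseteq># x}. if k = m then (if x - k = l then a \<otimes> b else \<zero>) else \<zero>) = (if x - m = l then a \<otimes> b else \<zero>)"
      using True assms finite_submsets[of x] by (intro add.finprod_singleton_swap) auto
    moreover have "x - m = l \<longleftrightarrow> x = m + l" using True by (metis add_diff_cancel_left' subset_mset.add_diff_inverse)
    ultimately show ?thesis by (simp add: mono_def)
  next
    case False
    then have "(\<Oplus>k\<in>{k. k \<subseteq># x}. if k = m then (if x - k = l then a \<otimes> b else \<zero>) else \<zero>) = \<zero>"
      by (intro add.finprod_one_eqI) auto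
    moreover have "x \<noteq> m + l" using False by auto
    ultimately show ?thesis by (simp add: mono_def)
  qed
  finally show "(mono a m \<otimes>\<^bsub>mpoly N\<^esub> mono b l) x = mono (a \<otimes> b) (m + l) x" .
qed

lemma mpoly_l_distr:
  assumes "p \<in> carrier (mpoly N)" "q \<in> carrier (mpoly N)" "r \<in> carrier (mpoly N)"
  shows "(p \<oplus>\<^bsub>mpoly N\<^esub> q) \<otimes>\<^bsub>mpoly N\<^esub> r = p \<otimes>\<^bsub>mpoly N\<^esub> r \<oplus>\<^bsub>mpoly N\<^esub> q \<otimes>\<^bsub>mpoly N\<^esub> r"
proof
  fix m
  have "((p \<oplus>\<^bsub>mpoly N\<^esub> q) \<otimes>\<^bsub>mpoly N\<^esub> r) m = (\<Oplus>k\<in>{k. k \<subseteq># m}. p k \<otimes> r (m - k) \<oplus> q k \<otimes> r (m - k))"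
    unfolding mpoly_simps using assms by (intro finsum_cong_closed) (auto simp: mpoly_coeff_closed l_distr)
  then show "((p \<oplus>\<^bsub>mpoly N\<^esub> q) \<otimes>\<^bsub>mpoly N\<^esub> r) m = (p \<otimes>\<^bsub>mpoly N\<^esub> r \<oplus>\<^bsub>mpoly N\<^esub> q \<otimes>\<^bsub>mpoly N\<^esub> r) m"
    using assms by (simp add: mpoly_simps finsum_addf mpoly_coeff_closed)
qed

lemma mpoly_r_distr:
  assumes "p \<in> carrier (mpoly N)" "q \<in> carrier (mpoly N)" "r \<in> carrier (mpoly N)"
  shows "r \<otimes>\<^bsub>mpoly N\<^esub> (p \<oplus>\<^bsub>mpoly N\<^esub> q) = r \<otimes>\<^bsub>mpoly N\<^esub> p \<oplus>\<^bsub>mpoly N\<^esub> r \<otimes>\<^bsub>mpoly N\<^esub> q"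
proof
  fix m
  have "(r \<otimes>\<^bsub>mpoly N\<^esub> (p \<oplus>\<^bsub>mpoly N\<^esub> q)) m = (\<Oplus>k\<in>{k. k \<subseteq># m}. r k \<otimes> p (m - k) \<oplus> r k \<otimes> q (m - k))"
    unfolding mpoly_simps using assms by (intro finsum_cong_closed) (auto simp: mpoly_coeff_closed r_distr)
  then show "(r \<otimes>\<^bsub>mpoly N\<^esub> (p \<oplus>\<^bsub>mpoly N\<^esub> q)) m = (r \<otimes>\<^bsub>mpoly N\<^esub> p \<oplus>\<^bsub>mpoly N\<^esub> r \<otimes>\<^bsub>mpoly N\<^esub> q) m"
    using assms by (simp add: mpoly_simps finsum_addf mpoly_coeff_closed)
qed

lemma mpoly_comm:
  assumes "p \<in> carrier (mpoly N)" "q \<in> carrier (mpoly N)"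
  shows "p \<otimes>\<^bsub>mpoly N\<^esub> q = q \<otimes>\<^bsub>mpoly N\<^esub> p"
  using assms
proof (induct p rule: mpoly_induct)
  case p: (mono a m)
  from p(3) p(1,2) show ?case
  proof (induct q rule: mpoly_induct)
    case (mono b l)
    then show ?case by (simp add: mono_mult m_comm add.commute)
  next
    case (add q q')
    then show ?case by (simp add: mpoly_l_distr mpoly_r_distr mono_closed)
  qed
next
  case (add p p')
  then show ?case by (simp add: mpoly_l_distr mpoly_r_distr)
qed

lemma mpoly_assoc:
  assumes "p \<in> carrier (mpoly N)" "q \<in> carrier (mpoly N)" "r \<in> carrier (mpoly N)"
  shows "(p \<otimes>\<^bsub>mpoly N\<^esub> q) \<otimes>\<^bsub>mpoly N\<^esub> r = p \<otimes>\<^bsub>mpoly N\<^esub> (q \<otimes>\<^bsub>mpoly N\<^esub> r)"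
  using assms
proof (induct p rule: mpoly_induct)
  case p: (mono a m)
  from p(3) p(1,2,4) show ?case
  proof (induct q rule: mpoly_induct)
    case q: (mono b l)
    from q(5) q(1-4) show ?case
    proof (induct r rule: mpoly_induct)
      case (mono c k)
      then show ?case by (simp add: mono_mult m_assoc add.assoc)
    next
      case (add r r')
      then show ?case by (simp add: mpoly_r_distr mono_closed mpoly_mult_closed)
    qed
  next
    case (add q q')
    then show ?case by (simp add: mpoly_l_distr mpoly_r_distr mono_closed mpoly_mult_closed)
  qed
next
  case (add p p')
  then show ?case by (simp add: mpoly_l_distr mpoly_r_distr mpoly_mult_closed)
qed

lemma mpoly_one:
  assumes "p \<in> carrier (mpoly N)"
  shows "\<one>\<^bsub>mpoly N\<^esub> \<otimes>\<^bsub>mpoly N\<^esub> p = p"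
  using assms
proof (induct p rule: mpoly_induct)
  case (mono a m)
  then show ?case by (simp add: mpoly_simps(4) mono_mult)
next
  case (add p q)
  then show ?case by (simp add: mpoly_r_distr mono_closed mpoly_simps(4))
qed

lemma mpoly_smult_mult:
  assumes "a \<in> carrier R" "p \<in> carrier (mpoly N)" "q \<in> carrier (mpoly N)"
  shows "(a \<odot>\<^bsub>mpoly N\<^esub> p) \<otimes>\<^bsub>mpoly N\<^esub> q = a \<odot>\<^bsub>mpoly N\<^esub> (p \<otimes>\<^bsub>mpoly N\<^esub> q)"
proof
  fix m
  have "a \<otimes> (\<Oplus>k\<in>{k. k \<subseteq># m}. p k \<otimes> q (m - k)) = (\<Oplus>k\<in>{k. k \<subseteq># m}. a \<otimes> (p k \<otimes> q (m - k)))"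
    using assms finite_submsets[of m] by (intro finsum_rdistr) (auto simp: mpoly_coeff_closed)
  then show "((a \<odot>\<^bsub>mpoly N\<^esub> p) \<otimes>\<^bsub>mpoly N\<^esub> q) m = (a \<odot>\<^bsub>mpoly N\<^esub> (p \<otimes>\<^bsub>mpoly N\<^esub> q)) m"
    unfolding mpoly_simps using assms by (simp add: m_assoc mpoly_coeff_closed)
qed

lemma mpoly_algebra: "algebra R (mpoly N)"
proof (rule algebraI)
  show "cring (mpoly N)"
  proof (rule cringI)
    show "abelian_group (mpoly N)"
    proof (rule abelian_groupI)
      fix p assume p: "p \<in> carrier (mpoly N)"
      show "\<exists>q\<in>carrier (mpoly N). q \<oplus>\<^bsub>mpoly N\<^esub> p = \<zero>\<^bsub>mpoly N\<^esub>"
        using p by (intro bexI[of _ "(\<ominus> \<one>) \<odot>\<^bsub>mpoly N\<^esub> p"] mpoly_smult_closed)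
          (auto simp: mpoly_simps mpoly_coeff_closed l_minus l_neg)
    qed (auto simp: mpoly_zero_closed mpoly_add_closed, auto simp: mpoly_simps mpoly_coeff_closed a_ac)
    show "comm_monoid (mpoly N)"
      by (rule comm_monoidI) (simp_all add: mpoly_mult_closed mpoly_assoc mpoly_one, simp_all add: mpoly_simps(4) mono_closed mpoly_comm)
  qed (rule mpoly_l_distr)
qed (auto simp: is_cring mpoly_smult_closed mpoly_smult_mult, auto simp: mpoly_simps mpoly_coeff_closed l_distr r_distr m_assoc)

definition var :: "nat \<Rightarrow> nat multiset \<Rightarrow> 'a"
  where "var i = mono \<one> {#i#}"

lemma var_closed: "i < N \<Longrightarrow> var i \<in> carrier (mpoly N)"
  by (simp add: var_def mono_closed)

lemma mono_eq: "a \<in> carrier R \<Longrightarrow> mono a m = a \<odot>\<^bsub>mpoly N\<^esub> mono \<one> m"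
  by (auto simp: mono_def mpoly_simps)

lemma mpoly_hom_unique:
  assumes h: "h \<in> alg_hom R (mpoly N) B" and k: "k \<in> alg_hom R (mpoly N) B"
    and eq: "\<And>i. i < N \<Longrightarrow> h (var i) = k (var i)"
  shows "h = k"
proof (rule alg_hom_eqI[OF h k])
  have one: "h (mono \<one> m) = k (mono \<one> m)" if "set_mset m \<subseteq> {..<N}" for m
    using that
  proof (induct m)
    case empty
    then show ?case using alg_homD(6)[OF h] alg_homD(6)[OF k] by (simp add: mpoly_simps)
  next
    case (add i m)
    have "mono \<one> (add_mset i m) = var i \<otimes>\<^bsub>mpoly N\<^esub> mono \<one> m"
      by (simp add: var_def mono_mult)
    then show ?case
      using add eq by (simp add: alg_homD(4)[OF h] alg_homD(4)[OF k] var_closed mono_closed)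
  qed
  fix p assume "p \<in> carrier (mpoly N)"
  then show "h p = k p"
  proof (induct p rule: mpoly_induct)
    case (mono a m)
    then show ?case
      by (simp add: mono_eq[of a m N] alg_homD(5)[OF h] alg_homD(5)[OF k] mono_closed one)
  next
    case (add p q)
    then show ?case by (simp add: alg_homD(3)[OF h] alg_homD(3)[OF k])
  qed
qed

text \<open>Evaluation at \<open>s\<close>. Multiplicativity is additive in both factors and so
  reduces to monomials, where it is the rule for sums of exponents.\<close>

lemma mpoly_hom_exists:
  assumes B: "algebra R B" and s: "\<And>i. i < N \<Longrightarrow> s i \<in> carrier B"
  obtains h where "h \<in> alg_hom R (mpoly N) B" "\<And>i. i < N \<Longrightarrow> h (var i) = s i"
proof -
  interpret B: algebra R B by (rule B)
  interpret P: algebra R "mpoly N" by (rule mpoly_algebra)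
  define pw where "pw m = (\<Otimes>\<^bsub>B\<^esub>i\<in>{..<N}. s i [^]\<^bsub>B\<^esub> count m i)" for m
  define h where "h p = (\<Oplus>\<^bsub>B\<^esub>m\<in>{m. p m \<noteq> \<zero>}. p m \<odot>\<^bsub>B\<^esub> pw m)" for p
  have pwc: "pw m \<in> carrier B" for m
    unfolding pw_def using s by (intro B.finprod_closed) auto
  have pw_add: "pw (m + l) = pw m \<otimes>\<^bsub>B\<^esub> pw l" for m l
  proof -
    have "pw (m + l) = (\<Otimes>\<^bsub>B\<^esub>i\<in>{..<N}. s i [^]\<^bsub>B\<^esub> count m i \<otimes>\<^bsub>B\<^esub> s i [^]\<^bsub>B\<^esub> count l i)"
      unfolding pw_def using s by (intro B.finprod_cong') (auto simp: B.nat_pow_mult)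
    then show ?thesis using s by (simp add: pw_def B.finprod_multf Pi_iff)
  qed
  have pw_var: "pw {#i#} = s i" if "i < N" for i
  proof -
    have "pw {#i#} = (\<Otimes>\<^bsub>B\<^esub>j\<in>{..<N}. if i = j then s j else \<one>\<^bsub>B\<^esub>)"
      unfolding pw_def using s by (intro B.finprod_cong') auto
    also have "\<dots> = s i" using that s by (intro B.finprod_singleton) auto
    finally show ?thesis .
  qed
  \<comment> \<open>Summing over any finite set that contains the support lets two polynomials be
    evaluated over a common index set.\<close>
  have h_eq: "h p = (\<Oplus>\<^bsub>B\<^esub>m\<in>S. p m \<odot>\<^bsub>B\<^esub> pw m)" if "finite S" "{m. p m \<noteq> \<zero>} \<subseteq> S" "\<And>m. p m \<in> carrier R" for p S
    unfolding h_def using that pwc by (intro B.add.finprod_mono_neutral_cong_left) auto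
  have h_closed: "h p \<in> carrier B" if "p \<in> carrier (mpoly N)" for p
    unfolding h_def using that pwc by (intro B.finsum_closed) (auto simp: mpoly_coeff_closed)
  have h_mono: "h (mono a m) = a \<odot>\<^bsub>B\<^esub> pw m" if "a \<in> carrier R" for a m
  proof -
    have "h (mono a m) = (\<Oplus>\<^bsub>B\<^esub>k\<in>{m}. mono a m k \<odot>\<^bsub>B\<^esub> pw k)"
      using that by (intro h_eq) (auto simp: mono_def)
    then show ?thesis using that pwc by (simp add: mono_def)
  qed
  have h_add: "h (p \<oplus>\<^bsub>mpoly N\<^esub> q) = h p \<oplus>\<^bsub>B\<^esub> h q" if "p \<in> carrier (mpoly N)" "q \<in> carrier (mpoly N)" for p q
  proof -
    let ?S = "{m. p m \<noteq> \<zero>} \<union> {m. q m \<noteq> \<zero>}"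
    have fin: "finite ?S" using that by (simp add: mpoly_carrier_iff)
    have "h (p \<oplus>\<^bsub>mpoly N\<^esub> q) = (\<Oplus>\<^bsub>B\<^esub>m\<in>?S. (p m \<oplus> q m) \<odot>\<^bsub>B\<^esub> pw m)"
      unfolding mpoly_simps(2)
    proof (rule h_eq[OF fin])
      show "{m. p m \<oplus> q m \<noteq> \<zero>} \<subseteq> ?S" by auto
    qed (use that in \<open>simp add: mpoly_coeff_closed\<close>)
    also have "\<dots> = (\<Oplus>\<^bsub>B\<^esub>m\<in>?S. p m \<odot>\<^bsub>B\<^esub> pw m \<oplus>\<^bsub>B\<^esub> q m \<odot>\<^bsub>B\<^esub> pw m)"
      using that pwc by (intro B.finsum_cong_closed) (auto simp: mpoly_coeff_closed B.smult_l_distr)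
    also have "\<dots> = (\<Oplus>\<^bsub>B\<^esub>m\<in>?S. p m \<odot>\<^bsub>B\<^esub> pw m) \<oplus>\<^bsub>B\<^esub> (\<Oplus>\<^bsub>B\<^esub>m\<in>?S. q m \<odot>\<^bsub>B\<^esub> pw m)"
      using that pwc by (intro B.finsum_addf) (auto simp: mpoly_coeff_closed)
    also have "\<dots> = h p \<oplus>\<^bsub>B\<^esub> h q"
      using h_eq[of ?S p] h_eq[of ?S q] fin that by (simp add: mpoly_coeff_closed)
    finally show ?thesis .
  qed
  have h_smult: "h (a \<odot>\<^bsub>mpoly N\<^esub> p) = a \<odot>\<^bsub>B\<^esub> h p" if "p \<in> carrier (mpoly N)" "a \<in> carrier R" for a p
    using that
  proof (induct p rule: mpoly_induct)
    case (mono b m)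
    have "a \<odot>\<^bsub>mpoly N\<^esub> mono b m = mono (a \<otimes> b) m" using mono by (auto simp: mpoly_simps mono_def)
    then show ?case using mono pwc by (simp add: h_mono B.smult_assoc1)
  next
    case (add p q)
    then show ?case by (simp add: h_add h_closed P.smult_r_distr B.smult_r_distr)
  qed
  have h_mult: "h (p \<otimes>\<^bsub>mpoly N\<^esub> q) = h p \<otimes>\<^bsub>B\<^esub> h q" if "p \<in> carrier (mpoly N)" "q \<in> carrier (mpoly N)" for p q
    using that
  proof (induct p rule: mpoly_induct)
    case p: (mono a m)
    from p(3) p(1,2) show ?case
    proof (induct q rule: mpoly_induct)
      case (mono b l)
      have "(a \<odot>\<^bsub>B\<^esub> pw m) \<otimes>\<^bsub>B\<^esub> (b \<odot>\<^bsub>B\<^esub> pw l) = (a \<otimes> b) \<odot>\<^bsub>B\<^esub> (pw m \<otimes>\<^bsub>B\<^esub> pw l)"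
        using mono pwc by (simp add: B.smult_assoc2 B.smult_assoc1 B.m_comm[of "pw m"])
      then show ?case using mono by (simp add: mono_mult h_mono pw_add)
    next
      case (add q q')
      then show ?case by (simp add: mpoly_r_distr mono_closed mpoly_mult_closed h_add h_closed B.r_distr)
    qed
  next
    case (add p p')
    then show ?case by (simp add: mpoly_l_distr mpoly_mult_closed h_add h_closed B.l_distr)
  qed
  have "pw {#} = \<one>\<^bsub>B\<^esub>" unfolding pw_def using s by (intro B.finprod_one_eqI) auto
  then have "h \<one>\<^bsub>mpoly N\<^esub> = \<one>\<^bsub>B\<^esub>" by (simp add: mpoly_simps h_mono)
  then have "(\<lambda>p\<in>carrier (mpoly N). h p) \<in> alg_hom R (mpoly N) B"
    by (intro alg_hom_restrictI mpoly_algebra h_closed h_add h_mult h_smult)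
  moreover have "(\<lambda>p\<in>carrier (mpoly N). h p) (var i) = s i" if "i < N" for i
    using that s var_closed[OF that] by (simp add: var_def h_mono pw_var)
  ultimately show thesis by (rule that)
qed

end

section \<open>Quotient algebras\<close>

context
  fixes A :: "('a, 'm) ring_scheme" and B :: "('a, 'b, 'k) module_scheme" and J :: "'b set"
  assumes algebra_B: "algebra A B" and ideal_J: "ideal J B"
begin

interpretation B: algebra A B by (rule algebra_B)
interpretation J: ideal J B by (rule ideal_J)

lemma quot_carrier: "carrier (quot_algebra B J) = {J +>\<^bsub>B\<^esub> x | x. x \<in> carrier B}"
  by (auto simp: quot_algebra_def FactRing_def A_RCOSETS_def')

lemma quot_cases:
  assumes "U \<in> carrier (quot_algebra B J)"
  obtains x where "x \<in> carrier B" "U = J +>\<^bsub>B\<^esub> x"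
  using assms by (auto simp: quot_carrier)

lemma quot_closed: "x \<in> carrier B \<Longrightarrow> J +>\<^bsub>B\<^esub> x \<in> carrier (quot_algebra B J)"
  by (auto simp: quot_carrier)

lemma quot_add:
  "\<lbrakk>x \<in> carrier B; y \<in> carrier B\<rbrakk> \<Longrightarrow> (J +>\<^bsub>B\<^esub> x) \<oplus>\<^bsub>quot_algebra B J\<^esub> (J +>\<^bsub>B\<^esub> y) = J +>\<^bsub>B\<^esub> (x \<oplus>\<^bsub>B\<^esub> y)"
  using ring_hom_add[OF J.rcos_ring_hom] by (simp add: quot_algebra_def)

lemma quot_mult:
  "\<lbrakk>x \<in> carrier B; y \<in> carrier B\<rbrakk> \<Longrightarrow> (J +>\<^bsub>B\<^esub> x) \<otimes>\<^bsub>quot_algebra B J\<^esub> (J +>\<^bsub>B\<^esub> y) = J +>\<^bsub>B\<^esub> (x \<otimes>\<^bsub>B\<^esub> y)"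
  using ring_hom_mult[OF J.rcos_ring_hom] by (simp add: quot_algebra_def)

lemma quot_one: "\<one>\<^bsub>quot_algebra B J\<^esub> = J +>\<^bsub>B\<^esub> \<one>\<^bsub>B\<^esub>"
  by (simp add: quot_algebra_def FactRing_def)

lemma quot_zero: "\<zero>\<^bsub>quot_algebra B J\<^esub> = J" "\<zero>\<^bsub>quot_algebra B J\<^esub> = J +>\<^bsub>B\<^esub> \<zero>\<^bsub>B\<^esub>"
  by (simp_all add: quot_algebra_def FactRing_def J.a_subset)

lemma quot_eq_iff:
  assumes "x \<in> carrier B" "y \<in> carrier B"
  shows "J +>\<^bsub>B\<^esub> x = J +>\<^bsub>B\<^esub> y \<longleftrightarrow> x \<ominus>\<^bsub>B\<^esub> y \<in> J"
  using B.quotient_eq_iff_same_a_r_cos[OF ideal_J assms] by simp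

lemma quot_eq_zero_iff: "x \<in> carrier B \<Longrightarrow> J +>\<^bsub>B\<^esub> x = J \<longleftrightarrow> x \<in> J"
  using quot_eq_iff[of x "\<zero>\<^bsub>B\<^esub>"] J.a_subset by (simp add: a_minus_def)

text \<open>Scalar multiplication on the quotient is a union over all representatives. The union is
  constant because a j = (a 1) j stays in the ideal.\<close>

lemma quot_smult:
  assumes "a \<in> carrier A" "x \<in> carrier B"
  shows "a \<odot>\<^bsub>quot_algebra B J\<^esub> (J +>\<^bsub>B\<^esub> x) = J +>\<^bsub>B\<^esub> (a \<odot>\<^bsub>B\<^esub> x)"
proof -
  have "J +>\<^bsub>B\<^esub> (a \<odot>\<^bsub>B\<^esub> y) = J +>\<^bsub>B\<^esub> (a \<odot>\<^bsub>B\<^esub> x)" if y: "y \<in> J +>\<^bsub>B\<^esub> x" for y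
  proof -
    obtain j where j: "j \<in> J" "y = j \<oplus>\<^bsub>B\<^esub> x" using y by (auto simp: a_r_coset_def')
    have jc: "j \<in> carrier B" using j(1) J.a_subset by auto
    have "a \<odot>\<^bsub>B\<^esub> j = (a \<odot>\<^bsub>B\<^esub> \<one>\<^bsub>B\<^esub>) \<otimes>\<^bsub>B\<^esub> j" using assms jc by (simp add: B.smult_assoc2)
    then have "a \<odot>\<^bsub>B\<^esub> j \<in> J" using assms j(1) J.I_l_closed by simp
    moreover have "a \<odot>\<^bsub>B\<^esub> y \<ominus>\<^bsub>B\<^esub> a \<odot>\<^bsub>B\<^esub> x = a \<odot>\<^bsub>B\<^esub> j"
      using assms jc j(2) by (simp add: B.smult_r_distr a_minus_def B.M.a_assoc B.M.r_neg)
    ultimately show ?thesis using assms jc j(2) by (subst quot_eq_iff) auto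
  qed
  moreover have "x \<in> J +>\<^bsub>B\<^esub> x"
    by (rule J.a_rcos_self[OF assms(2)])
  ultimately have "(\<Union>y\<in>J +>\<^bsub>B\<^esub> x. J +>\<^bsub>B\<^esub> (a \<odot>\<^bsub>B\<^esub> y)) = J +>\<^bsub>B\<^esub> (a \<odot>\<^bsub>B\<^esub> x)"
    by (intro UN_constant_eq) blast+
  then show ?thesis by (simp add: quot_algebra_def)
qed

lemma quot_algebra_algebra: "algebra A (quot_algebra B J)"
proof (rule algebraI)
  note simps = quot_add quot_mult quot_one quot_smult quot_closed
  interpret Q: cring "B Quot J" by (rule J.quotient_is_cring[OF B.M_cring])
  show "cring A" by (rule B.R_cring)
  show "cring (quot_algebra B J)"
  proof (rule cringI)
    show "abelian_group (quot_algebra B J)"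
    proof (rule abelian_groupI)
      fix U assume U: "U \<in> carrier (quot_algebra B J)"
      then show "\<exists>V\<in>carrier (quot_algebra B J). V \<oplus>\<^bsub>quot_algebra B J\<^esub> U = \<zero>\<^bsub>quot_algebra B J\<^esub>"
        using Q.a_inv_closed Q.l_neg by (auto simp: quot_algebra_def intro!: bexI[of _ "\<ominus>\<^bsub>B Quot J\<^esub> U"])
    qed (simp_all add: quot_algebra_def Q.a_ac)
    show "comm_monoid (quot_algebra B J)"
      by (rule comm_monoidI) (simp_all add: quot_algebra_def Q.m_ac)
  qed (simp add: quot_algebra_def Q.l_distr)
qed (auto elim!: quot_cases simp: quot_smult quot_closed quot_add quot_mult B.smult_l_distr B.smult_r_distr B.smult_assoc1 B.smult_assoc2)

lemma quot_proj_hom: "(\<lambda>x\<in>carrier B. J +>\<^bsub>B\<^esub> x) \<in> alg_hom A B (quot_algebra B J)"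
  by (rule alg_hom_restrictI[OF algebra_B]) (simp_all add: quot_closed quot_add quot_mult quot_one quot_smult)

lemma quot_hom_exists:
  assumes C: "algebra A C" and k: "k \<in> alg_hom A B C" and null: "\<And>x. x \<in> J \<Longrightarrow> k x = \<zero>\<^bsub>C\<^esub>"
  obtains k' where "k' \<in> alg_hom A (quot_algebra B J) C" "\<And>x. x \<in> carrier B \<Longrightarrow> k' (J +>\<^bsub>B\<^esub> x) = k x"
proof -
  interpret C: algebra A C by (rule C)
  \<comment> \<open>The value is taken at a chosen representative; another choice changes it by the
    image of an element of \<open>J\<close>, which is zero.\<close>
  define f where "f U = k (SOME x. x \<in> carrier B \<and> U = J +>\<^bsub>B\<^esub> x)" for U
  have f: "f (J +>\<^bsub>B\<^esub> x) = k x" if x: "x \<in> carrier B" for x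
  proof -
    let ?y = "SOME y. y \<in> carrier B \<and> J +>\<^bsub>B\<^esub> x = J +>\<^bsub>B\<^esub> y"
    have y': "?y \<in> carrier B \<and> J +>\<^bsub>B\<^esub> x = J +>\<^bsub>B\<^esub> ?y" by (rule someI[of _ x]) (simp add: x)
    note y = y'[THEN conjunct1]
    have "x \<ominus>\<^bsub>B\<^esub> ?y \<in> J" using quot_eq_iff[OF x y] y' by blast
    then have "k (x \<ominus>\<^bsub>B\<^esub> ?y) = \<zero>\<^bsub>C\<^esub>" by (rule null)
    moreover have "k (x \<ominus>\<^bsub>B\<^esub> ?y) \<oplus>\<^bsub>C\<^esub> k ?y = k (x \<ominus>\<^bsub>B\<^esub> ?y \<oplus>\<^bsub>B\<^esub> ?y)"
      using x y alg_homD(3)[OF k] by simp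
    moreover have "x \<ominus>\<^bsub>B\<^esub> ?y \<oplus>\<^bsub>B\<^esub> ?y = x" using x y by (simp add: a_minus_def B.M.a_assoc B.M.l_neg)
    ultimately have "k ?y = k x" using y alg_homD(2)[OF k] by simp
    then show ?thesis by (simp add: f_def)
  qed
  have "(\<lambda>U\<in>carrier (quot_algebra B J). f U) \<in> alg_hom A (quot_algebra B J) C"
    by (rule alg_hom_restrictI[OF quot_algebra_algebra])
      (auto elim!: quot_cases simp: quot_add quot_mult quot_one quot_smult f alg_homD[OF k])
  then show thesis by (rule that) (simp add: f quot_closed)
qed

end

section \<open>The algebra representing the automorphisms\<close>

context lie_fg
begin

text \<open>Matrices are functions on all pairs of numbers, but only entries with both indices below
  \<open>n\<close> are meaningful.\<close>

lemma mat_map_cong: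
  assumes "is_mat c" "\<And>i j. \<lbrakk>i < n; j < n\<rbrakk> \<Longrightarrow> c' i j = c i j" "x \<in> carrier L"
  shows "mat_map c' x = mat_map c x"
proof -
  have c: "c i j \<in> carrier A" if "i < n" "j < n" for i j
    using assms(1) that by (simp add: is_mat_def)
  have "(\<Oplus>\<^bsub>L\<^esub>i\<in>{..<n}. c' i j \<odot>\<^bsub>L\<^esub> e i) = (\<Oplus>\<^bsub>L\<^esub>i\<in>{..<n}. c i j \<odot>\<^bsub>L\<^esub> e i)" if "j < n" for j
    using that assms(2) c by (intro M.finsum_cong_closed) auto
  then show ?thesis
    unfolding mat_map_def using assms(3) c
    by (intro M.finsum_cong_closed) (auto intro!: smult_closed M.finsum_closed)
qed

lemma rels_cong:
  assumes "is_mat c" "is_mat d"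
    and "\<And>i j. \<lbrakk>i < n; j < n\<rbrakk> \<Longrightarrow> c' i j = c i j" "\<And>i j. \<lbrakk>i < n; j < n\<rbrakk> \<Longrightarrow> d' i j = d i j"
  shows "rels c' d' = rels c d"
proof -
  note [simp] = mat_map_cong[OF assms(1,3)] mat_map_cong[OF assms(2,4)] assms(3,4) mat_map_closed[OF assms(1)]
    mat_map_closed[OF assms(2)] lie_closed
  have "rel_proj c' ` ({..<n} \<times> {..<n}) = rel_proj c ` ({..<n} \<times> {..<n})"
    "rel_proj d' ` ({..<n} \<times> {..<n}) = rel_proj d ` ({..<n} \<times> {..<n})"
    by (intro image_cong; auto simp: rel_proj_def)+
  moreover have "rel_inv c' d' ` ({..<n} \<times> {..<n}) = rel_inv c d ` ({..<n} \<times> {..<n})"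
    "rel_inv d' c' ` ({..<n} \<times> {..<n}) = rel_inv d c ` ({..<n} \<times> {..<n})"
    by (intro image_cong; auto simp: rel_inv_def)+
  moreover have "rel_lie c' ` ({..<n} \<times> {..<n} \<times> {..<n}) = rel_lie c ` ({..<n} \<times> {..<n} \<times> {..<n})"
    by (intro image_cong; auto simp: rel_lie_def)
  ultimately show ?thesis by (simp add: rels_def)
qed

lemma base_changeI: "algebra A B \<Longrightarrow> lie_fg_base_change A L n e \<phi> B"
  by (intro lie_fg_base_change.intro lie_fg_base_change_axioms.intro lie_fg_axioms)

lemma base_change_homI:
  "\<lbrakk>algebra A B; algebra A C; h \<in> alg_hom A B C\<rbrakk> \<Longrightarrow> lie_fg_base_change_hom A L n e \<phi> B C h"
  by (intro lie_fg_base_change_hom.intro lie_fg_base_change_hom_axioms.intro base_changeI)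

text \<open>One block of n * n variables for the matrix of an automorphism, stored row by row by
  \<open>cvar\<close>, and a second block, by \<open>dvar\<close>, for its inverse.\<close>

definition poly_alg :: "('a, nat multiset \<Rightarrow> 'a) module"
  where "poly_alg = mpoly_ring A (n * n + n * n)"

definition cvar :: "nat \<Rightarrow> nat \<Rightarrow> nat multiset \<Rightarrow> 'a"
  where "cvar i j = var (i * n + j)"

definition dvar :: "nat \<Rightarrow> nat \<Rightarrow> nat multiset \<Rightarrow> 'a"
  where "dvar i j = var (n * n + (i * n + j))"

lemma index_less: "\<lbrakk>i < n; j < n\<rbrakk> \<Longrightarrow> i * n + j < n * n"
proof -
  assume "i < n" "j < n"
  then have "i * n + j < i * n + n" by simp
  also have "\<dots> = Suc i * n" by simp
  also have "\<dots> \<le> n * n" using \<open>i < n\<close> by (intro mult_right_mono) auto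
  finally show ?thesis .
qed

lemma index_split: "t < n * n \<Longrightarrow> t div n < n \<and> t mod n < n \<and> t = t div n * n + t mod n"
  by (cases "n = 0") (auto simp: div_less_iff_less_mult)

lemma poly_alg_algebra: "algebra A poly_alg"
  unfolding poly_alg_def by (rule mpoly_algebra)

lemma cvar_closed: "\<lbrakk>i < n; j < n\<rbrakk> \<Longrightarrow> cvar i j \<in> carrier poly_alg"
  using index_less[of i j] by (auto simp: cvar_def poly_alg_def intro!: var_closed)

lemma dvar_closed: "\<lbrakk>i < n; j < n\<rbrakk> \<Longrightarrow> dvar i j \<in> carrier poly_alg"
  using index_less[of i j] by (auto simp: dvar_def poly_alg_def intro!: var_closed)

lemma poly_hom_unique:
  assumes h: "h \<in> alg_hom A poly_alg B" and k: "k \<in> alg_hom A poly_alg B"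
    and c: "\<And>i j. \<lbrakk>i < n; j < n\<rbrakk> \<Longrightarrow> h (cvar i j) = k (cvar i j)"
    and d: "\<And>i j. \<lbrakk>i < n; j < n\<rbrakk> \<Longrightarrow> h (dvar i j) = k (dvar i j)"
  shows "h = k"
proof (rule mpoly_hom_unique[OF h[unfolded poly_alg_def] k[unfolded poly_alg_def]])
  fix t assume t: "t < n * n + n * n"
  show "h (var t) = k (var t)"
  proof (cases "t < n * n")
    case True
    then show ?thesis using c[of "t div n" "t mod n"] index_split[OF True] by (simp add: cvar_def)
  next
    case False
    then have "t - n * n < n * n" using t by simp
    then show ?thesis
      using d[of "(t - n * n) div n" "(t - n * n) mod n"] index_split[of "t - n * n"] False by (simp add: dvar_def)
  qed
qed

lemma poly_hom_exists:
  assumes B: "algebra A B"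
    and c: "\<And>i j. \<lbrakk>i < n; j < n\<rbrakk> \<Longrightarrow> c i j \<in> carrier B" and d: "\<And>i j. \<lbrakk>i < n; j < n\<rbrakk> \<Longrightarrow> d i j \<in> carrier B"
  obtains k where "k \<in> alg_hom A poly_alg B"
    "\<And>i j. \<lbrakk>i < n; j < n\<rbrakk> \<Longrightarrow> k (cvar i j) = c i j" "\<And>i j. \<lbrakk>i < n; j < n\<rbrakk> \<Longrightarrow> k (dvar i j) = d i j"
proof -
  define s where "s t = (if t < n * n then c (t div n) (t mod n) else d ((t - n * n) div n) ((t - n * n) mod n))" for t
  have s: "s t \<in> carrier B" if t: "t < n * n + n * n" for t
    using index_split[of t] index_split[of "t - n * n"] t c d by (auto simp: s_def)
  obtain k where k: "k \<in> alg_hom A (mpoly_ring A (n * n + n * n)) B" "\<And>t. t < n * n + n * n \<Longrightarrow> k (var t) = s t"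
    using mpoly_hom_exists[where B = B and N = "n * n + n * n" and s = s] B s by blast
  show thesis
  proof (rule that)
    show "k \<in> alg_hom A poly_alg B" using k(1) by (simp add: poly_alg_def)
    fix i j assume ij: "i < n" "j < n"
    then show "k (cvar i j) = c i j" "k (dvar i j) = d i j"
      using index_less[OF ij] by (auto simp: cvar_def dvar_def k(2) s_def)
  qed
qed

interpretation P: lie_fg_base_change A L n e \<phi> poly_alg
  by (rule base_changeI[OF poly_alg_algebra])

lemma vars_mat: "P.LB.is_mat cvar" "P.LB.is_mat dvar"
  by (simp_all add: P.LB.is_mat_def cvar_closed dvar_closed)

definition rel_ideal :: "(nat multiset \<Rightarrow> 'a) set"
  where "rel_ideal = genideal poly_alg (P.LB.rels cvar dvar)"

lemma rels_carrier: "P.LB.rels cvar dvar \<subseteq> carrier poly_alg"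
  by (rule P.LB.rels_closed[OF vars_mat])

lemma rel_ideal: "ideal rel_ideal poly_alg"
  unfolding rel_ideal_def by (rule P.B.genideal_ideal[OF rels_carrier])

text \<open>Spelled out with the locale constants because \<open>B\<close> is a variable here, over
  which no interpretation is in force.\<close>

abbreviation rels_over where
  "rels_over B \<equiv> lie_fg.rels B (base_change A L B) n (lie_fg_base_change.eB A L e B) (lie_fg_base_change.\<Phi> \<phi> B)"

lemma rels_poly_hom:
  assumes B: "algebra A B" and k: "k \<in> alg_hom A poly_alg B"
  shows "k ` P.LB.rels cvar dvar = rels_over B (\<lambda>i j. k (cvar i j)) (\<lambda>i j. k (dvar i j))"
proof -
  interpret H: lie_fg_base_change_hom A L n e \<phi> poly_alg B k
    by (rule base_change_homI[OF poly_alg_algebra B k])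
  show ?thesis by (rule H.rels_hom[OF vars_mat])
qed

definition aut_alg :: "('a, (nat multiset \<Rightarrow> 'a) set) module"
  where "aut_alg = quot_algebra poly_alg rel_ideal"

definition cgen :: "nat \<Rightarrow> nat \<Rightarrow> (nat multiset \<Rightarrow> 'a) set"
  where "cgen i j = rel_ideal +>\<^bsub>poly_alg\<^esub> cvar i j"

definition dgen :: "nat \<Rightarrow> nat \<Rightarrow> (nat multiset \<Rightarrow> 'a) set"
  where "dgen i j = rel_ideal +>\<^bsub>poly_alg\<^esub> dvar i j"

lemma aut_alg_algebra: "algebra A aut_alg"
  unfolding aut_alg_def by (rule quot_algebra_algebra[OF poly_alg_algebra rel_ideal])

lemma cgen_closed: "\<lbrakk>i < n; j < n\<rbrakk> \<Longrightarrow> cgen i j \<in> carrier aut_alg"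
  by (simp add: cgen_def aut_alg_def quot_closed[OF poly_alg_algebra rel_ideal] cvar_closed)

lemma dgen_closed: "\<lbrakk>i < n; j < n\<rbrakk> \<Longrightarrow> dgen i j \<in> carrier aut_alg"
  by (simp add: dgen_def aut_alg_def quot_closed[OF poly_alg_algebra rel_ideal] dvar_closed)

abbreviation aut_proj :: "(nat multiset \<Rightarrow> 'a) \<Rightarrow> (nat multiset \<Rightarrow> 'a) set"
  where "aut_proj \<equiv> \<lambda>p\<in>carrier poly_alg. rel_ideal +>\<^bsub>poly_alg\<^esub> p"

lemma aut_proj_hom: "aut_proj \<in> alg_hom A poly_alg aut_alg"
  unfolding aut_alg_def by (rule quot_proj_hom[OF poly_alg_algebra rel_ideal])

lemma aut_hom_eqI:
  assumes h: "h \<in> alg_hom A aut_alg B" and k: "k \<in> alg_hom A aut_alg B"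
    and c: "\<And>i j. \<lbrakk>i < n; j < n\<rbrakk> \<Longrightarrow> h (cgen i j) = k (cgen i j)"
    and d: "\<And>i j. \<lbrakk>i < n; j < n\<rbrakk> \<Longrightarrow> h (dgen i j) = k (dgen i j)"
  shows "h = k"
proof (rule alg_hom_eqI[OF h k])
  have eq: "(\<lambda>p\<in>carrier poly_alg. h (aut_proj p)) = (\<lambda>p\<in>carrier poly_alg. k (aut_proj p))"
    by (rule poly_hom_unique[OF alg_hom_comp[OF poly_alg_algebra aut_proj_hom h] alg_hom_comp[OF poly_alg_algebra aut_proj_hom k]])
      (simp_all add: cvar_closed dvar_closed c d flip: cgen_def dgen_def)
  fix U assume "U \<in> carrier aut_alg"
  then obtain p where p: "p \<in> carrier poly_alg" "U = rel_ideal +>\<^bsub>poly_alg\<^esub> p"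
    unfolding aut_alg_def by (rule quot_cases[OF poly_alg_algebra rel_ideal])
  then show "h U = k U" using fun_cong[OF eq, of p] by simp
qed

text \<open>The universal property of generators and relations: evaluation on
  \<open>poly_alg\<close> kills the relations by naturality, hence the ideal they generate, and
  descends to the quotient.\<close>

lemma aut_hom_exists:
  assumes B: "algebra A B"
    and c: "\<And>i j. \<lbrakk>i < n; j < n\<rbrakk> \<Longrightarrow> c i j \<in> carrier B" and d: "\<And>i j. \<lbrakk>i < n; j < n\<rbrakk> \<Longrightarrow> d i j \<in> carrier B"
    and rels: "rels_over B c d \<subseteq> {\<zero>\<^bsub>B\<^esub>}"
  obtains h where "h \<in> alg_hom A aut_alg B"
    "\<And>i j. \<lbrakk>i < n; j < n\<rbrakk> \<Longrightarrow> h (cgen i j) = c i j" "\<And>i j. \<lbrakk>i < n; j < n\<rbrakk> \<Longrightarrow> h (dgen i j) = d i j"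
proof -
  interpret BB: lie_fg_base_change A L n e \<phi> B by (rule base_changeI[OF B])
  obtain k where k: "k \<in> alg_hom A poly_alg B"
    and kc: "\<And>i j. \<lbrakk>i < n; j < n\<rbrakk> \<Longrightarrow> k (cvar i j) = c i j" and kd: "\<And>i j. \<lbrakk>i < n; j < n\<rbrakk> \<Longrightarrow> k (dvar i j) = d i j"
    using poly_hom_exists[where B = B and c = c and d = d] B c d by blast
  have mats: "BB.LB.is_mat c" "BB.LB.is_mat d" using c d by (simp_all add: BB.LB.is_mat_def)
  have "k ` P.LB.rels cvar dvar = rels_over B (\<lambda>i j. k (cvar i j)) (\<lambda>i j. k (dvar i j))"
    by (rule rels_poly_hom[OF B k])
  also have "\<dots> = rels_over B c d"
    by (rule BB.LB.rels_cong[OF mats kc kd])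
  finally have im: "k ` P.LB.rels cvar dvar \<subseteq> {\<zero>\<^bsub>B\<^esub>}" using rels by simp
  interpret K: ring_hom_ring poly_alg B k
    by (rule ring_hom_ringI2[OF P.B.ring_axioms BB.B.ring_axioms alg_homD(1)[OF k]])
  have "P.LB.rels cvar dvar \<subseteq> a_kernel poly_alg B k"
    unfolding a_kernel_def' using im rels_carrier by blast
  then have "rel_ideal \<subseteq> a_kernel poly_alg B k"
    unfolding rel_ideal_def by (rule P.B.genideal_minimal[OF K.kernel_is_ideal])
  then have null: "\<And>p. p \<in> rel_ideal \<Longrightarrow> k p = \<zero>\<^bsub>B\<^esub>"
    unfolding a_kernel_def' by blast
  obtain h where h: "h \<in> alg_hom A aut_alg B" "\<And>p. p \<in> carrier poly_alg \<Longrightarrow> h (rel_ideal +>\<^bsub>poly_alg\<^esub> p) = k p"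
    using quot_hom_exists[OF poly_alg_algebra rel_ideal B k null] unfolding aut_alg_def by blast
  show thesis
    by (rule that[OF h(1)]) (simp_all add: cgen_def dgen_def h(2) cvar_closed dvar_closed kc kd)
qed

interpretation Q: lie_fg_base_change A L n e \<phi> aut_alg
  by (rule base_changeI[OF aut_alg_algebra])

lemma gens_mat: "Q.LB.is_mat cgen" "Q.LB.is_mat dgen"
  by (simp_all add: Q.LB.is_mat_def cgen_closed dgen_closed)

lemma gens_rels: "Q.LB.rels cgen dgen \<subseteq> {\<zero>\<^bsub>aut_alg\<^esub>}"
proof -
  have "Q.LB.rels cgen dgen = Q.LB.rels (\<lambda>i j. aut_proj (cvar i j)) (\<lambda>i j. aut_proj (dvar i j))"
    by (rule Q.LB.rels_cong[symmetric, OF gens_mat]) (simp_all add: cvar_closed dvar_closed cgen_def dgen_def)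
  also have "\<dots> = aut_proj ` P.LB.rels cvar dvar"
    by (rule rels_poly_hom[symmetric, OF aut_alg_algebra aut_proj_hom])
  also have "\<dots> \<subseteq> {\<zero>\<^bsub>aut_alg\<^esub>}"
  proof
    fix U assume "U \<in> aut_proj ` P.LB.rels cvar dvar"
    then obtain p where p: "p \<in> P.LB.rels cvar dvar" "U = aut_proj p" by blast
    have pc: "p \<in> carrier poly_alg" using p(1) rels_carrier by blast
    have "p \<in> rel_ideal"
      unfolding rel_ideal_def using P.B.genideal_self[OF rels_carrier] p(1) by blast
    then show "U \<in> {\<zero>\<^bsub>aut_alg\<^esub>}"
      using pc p(2) quot_eq_zero_iff[OF poly_alg_algebra rel_ideal pc] quot_zero(1)[OF poly_alg_algebra rel_ideal]
      by (simp add: aut_alg_def)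
  qed
  finally show ?thesis .
qed

text \<open>The automorphism with generic matrix \<open>cgen\<close>, restricted because members of
  \<open>lie_aut\<close> are extensional.\<close>

definition aut_univ :: "('g \<times> (nat multiset \<Rightarrow> 'a) set) list set \<Rightarrow> ('g \<times> (nat multiset \<Rightarrow> 'a) set) list set"
  where "aut_univ = (\<lambda>U\<in>carrier Q.LB. Q.LB.mat_map cgen U)"

lemma aut_univ_lie_aut: "aut_univ \<in> lie_aut aut_alg (base_change A L aut_alg)"
  unfolding aut_univ_def by (rule Q.LB.rels_lie_aut[OF gens_mat gens_rels])

lemma lie_autD:
  assumes "\<theta> \<in> lie_aut A L"
  shows "endo \<theta>" "bij_betw \<theta> (carrier L) (carrier L)"
    "\<And>x y. \<lbrakk>x \<in> carrier L; y \<in> carrier L\<rbrakk> \<Longrightarrow> \<theta> (lie L x y) = lie L (\<theta> x) (\<theta> y)"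
  using assms by (auto simp: lie_aut_def mod_hom_def endo_def)

text \<open>The matrices of an automorphism and of its inverse solve the relations and so define
  \<open>h\<close>. For uniqueness, compatibility fixes the automorphism as a map, hence also its
  inverse, and the relations recover the matrix entries from the maps.\<close>

theorem represents_Aut_aut_alg: "represents_Aut TYPE('b) A L aut_alg aut_univ"
  unfolding represents_Aut_def
proof (intro conjI allI impI ballI aut_alg_algebra aut_univ_lie_aut)
  fix B :: "('a, 'b) module" and \<theta>
  assume B: "algebra A B" and \<theta>: "\<theta> \<in> lie_aut B (base_change A L B)"
  interpret BB: lie_fg_base_change A L n e \<phi> B by (rule base_changeI[OF B])
  note \<theta>' = BB.LB.lie_autD[OF \<theta>]
  obtain \<delta> where \<delta>: "BB.LB.endo \<delta>" "\<And>x. x \<in> carrier BB.LB \<Longrightarrow> \<theta> (\<delta> x) = x" "\<And>x. x \<in> carrier BB.LB \<Longrightarrow> \<delta> (\<theta> x) = x"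
    and rels: "rels_over B (BB.LB.mat_of \<theta>) (BB.LB.mat_of \<delta>) \<subseteq> {\<zero>\<^bsub>B\<^esub>}"
    using BB.LB.lie_aut_rels[OF \<theta>'] by blast
  note mats = BB.LB.is_mat_of[OF \<theta>'(1)] BB.LB.is_mat_of[OF \<delta>(1)]
  obtain h where h: "h \<in> alg_hom A aut_alg B"
    and hc: "\<And>i j. \<lbrakk>i < n; j < n\<rbrakk> \<Longrightarrow> h (cgen i j) = BB.LB.mat_of \<theta> i j"
    and hd: "\<And>i j. \<lbrakk>i < n; j < n\<rbrakk> \<Longrightarrow> h (dgen i j) = BB.LB.mat_of \<delta> i j"
    using aut_hom_exists[OF B _ _ rels] mats by (auto simp: BB.LB.is_mat_def)
  show "\<exists>!h. h \<in> alg_hom A aut_alg B \<and>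
    (\<forall>U\<in>carrier (base_change A L aut_alg). \<theta> (base_change_map A L B h U) = base_change_map A L B h (aut_univ U))"
  proof (rule ex1I[of _ h], intro conjI ballI h)
    fix U assume U: "U \<in> carrier Q.LB"
    interpret H: lie_fg_base_change_hom A L n e \<phi> aut_alg B h
      by (rule base_change_homI[OF aut_alg_algebra B h])
    have "H.bc (aut_univ U) = BB.LB.mat_map (\<lambda>i j. h (cgen i j)) (H.bc U)"
      using U by (simp add: aut_univ_def H.bc_mat_map[OF gens_mat(1)])
    also have "\<dots> = BB.LB.mat_map (BB.LB.mat_of \<theta>) (H.bc U)"
      using U by (intro BB.LB.mat_map_cong mats hc H.bc_closed)
    also have "\<dots> = \<theta> (H.bc U)"
      using U by (intro BB.LB.mat_map_mat_of \<theta>' H.bc_closed)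
    finally show "\<theta> (H.bc U) = H.bc (aut_univ U)" by simp
  next
    fix k assume k: "k \<in> alg_hom A aut_alg B \<and>
      (\<forall>U\<in>carrier Q.LB. \<theta> (base_change_map A L B k U) = base_change_map A L B k (aut_univ U))"
    interpret K: lie_fg_base_change_hom A L n e \<phi> aut_alg B k
      using base_change_homI[OF aut_alg_algebra B] k by blast
    have kc_mat: "BB.LB.is_mat (\<lambda>i j. k (cgen i j))" "BB.LB.is_mat (\<lambda>i j. k (dgen i j))"
      by (intro K.is_mat_hom gens_mat)+
    have \<theta>k: "\<theta> (K.bc U) = BB.LB.mat_map (\<lambda>i j. k (cgen i j)) (K.bc U)" if "U \<in> carrier Q.LB" for U
      using k that K.bc_mat_map[OF gens_mat(1) that] by (simp add: aut_univ_def)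
    have rels_k: "BB.LB.rels (\<lambda>i j. k (cgen i j)) (\<lambda>i j. k (dgen i j)) \<subseteq> {\<zero>\<^bsub>B\<^esub>}"
      using image_mono[OF gens_rels, of k] K.rels_hom[OF gens_mat] K.h_zero by simp
    note ex = BB.LB.rels_exact[OF kc_mat rels_k]
    \<comment> \<open>Compatibility speaks only about elements coming from \<open>aut_alg\<close>.
      Their images include the generators \<open>eB\<close>, which suffices by linearity.\<close>
    have \<theta>_eq: "\<theta> V = BB.LB.mat_map (\<lambda>i j. k (cgen i j)) V" if "V \<in> carrier BB.LB" for V
    proof (rule BB.LB.endo_eqI[OF \<theta>'(1) BB.LB.endo_mat_map[OF kc_mat(1)] _ that])
      fix j assume "j < n"
      then show "\<theta> (BB.eB j) = BB.LB.mat_map (\<lambda>i j. k (cgen i j)) (BB.eB j)"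
        using \<theta>k[of "Q.eB j"] K.bc_eB Q.eB_closed by simp
    qed
    have \<delta>_eq: "\<delta> V = BB.LB.mat_map (\<lambda>i j. k (dgen i j)) V" if V: "V \<in> carrier BB.LB" for V
    proof -
      have W: "BB.LB.mat_map (\<lambda>i j. k (dgen i j)) V \<in> carrier BB.LB"
        by (rule BB.LB.mat_map_closed[OF kc_mat(2) V])
      have "\<delta> V = \<delta> (\<theta> (BB.LB.mat_map (\<lambda>i j. k (dgen i j)) V))"
        using ex(3)[OF V] \<theta>_eq[OF W] by simp
      then show ?thesis using \<delta>(3)[OF W] by simp
    qed
    show "k = h"
    proof (rule aut_hom_eqI[OF _ h])
      show "k \<in> alg_hom A aut_alg B" using k by blast
      fix i j assume ij: "i < n" "j < n"
      \<comment> \<open>Equal maps give equal entries here because \<open>rels_exact\<close> says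
        that these entries are the matrix of the map they define.\<close>
      show "k (cgen i j) = h (cgen i j)"
        using ex(1)[OF ij] hc[OF ij] ij by (simp add: BB.LB.mat_of_def \<theta>_eq BB.eB_closed)
      show "k (dgen i j) = h (dgen i j)"
        using ex(2)[OF ij] hd[OF ij] ij by (simp add: BB.LB.mat_of_def \<delta>_eq BB.eB_closed)
    qed
  qed
qed

theorem finitely_presented_aut_alg: "finitely_presented_algebra A aut_alg"
  unfolding finitely_presented_algebra_def
proof (intro conjI aut_alg_algebra exI[of _ "n * n + n * n"] bexI[of _ aut_proj] exI[of _ "P.LB.rels cvar dvar"])
  show "aut_proj \<in> alg_hom A (mpoly_ring A (n * n + n * n)) aut_alg"
    using aut_proj_hom by (simp add: poly_alg_def)
  show "aut_proj ` carrier (mpoly_ring A (n * n + n * n)) = carrier aut_alg"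
    by (auto simp: aut_alg_def quot_carrier[OF poly_alg_algebra rel_ideal] simp flip: poly_alg_def)
  show "finite (P.LB.rels cvar dvar)" by (rule P.LB.finite_rels)
  show "P.LB.rels cvar dvar \<subseteq> carrier (mpoly_ring A (n * n + n * n))"
    using rels_carrier by (simp add: poly_alg_def)
  have "a_kernel poly_alg aut_alg aut_proj = rel_ideal"
    using quot_eq_zero_iff[OF poly_alg_algebra rel_ideal] quot_zero(1)[OF poly_alg_algebra rel_ideal]
      additive_subgroup.a_subset[OF ideal.axioms(1)[OF rel_ideal]]
    by (auto simp: a_kernel_def' aut_alg_def)
  then show "a_kernel (mpoly_ring A (n * n + n * n)) aut_alg aut_proj
    = genideal (mpoly_ring A (n * n + n * n)) (P.LB.rels cvar dvar)"
    by (simp add: rel_ideal_def poly_alg_def)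
qed

text \<open>A homomorphism into the quotient by \<open>J\<close> is a solution there. Its entries
  are lifted arbitrarily to \<open>B\<close>, where the relations hold modulo \<open>J\<close>, and
  \<open>lift_solution\<close> corrects them.\<close>

theorem formally_smooth_aut_alg:
  assumes cas: "casimir e'"
  shows "formally_smooth_algebra TYPE('b) A aut_alg"
  unfolding formally_smooth_algebra_def
proof (intro conjI allI impI ballI aut_alg_algebra)
  fix B :: "('a, 'b) module" and J h
  assume asm: "algebra A B \<and> ideal J B \<and> (\<forall>x\<in>J. \<forall>y\<in>J. x \<otimes>\<^bsub>B\<^esub> y = \<zero>\<^bsub>B\<^esub>)"
    and h: "h \<in> alg_hom A aut_alg (quot_algebra B J)"
  then have B: "algebra A B" and J: "ideal J B" and J2: "\<And>x y. \<lbrakk>x \<in> J; y \<in> J\<rbrakk> \<Longrightarrow> x \<otimes>\<^bsub>B\<^esub> y = \<zero>\<^bsub>B\<^esub>"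
    by auto
  interpret BB: lie_fg_base_change A L n e \<phi> B by (rule base_changeI[OF B])
  let ?C = "quot_algebra B J"
  have C: "algebra A ?C" by (rule quot_algebra_algebra[OF B J])
  let ?\<pi> = "\<lambda>x\<in>carrier B. J +>\<^bsub>B\<^esub> x"
  have \<pi>: "?\<pi> \<in> alg_hom A B ?C" by (rule quot_proj_hom[OF B J])
  have rep: "\<exists>b\<in>carrier B. U = J +>\<^bsub>B\<^esub> b" if "U \<in> carrier ?C" for U
    using that by (rule quot_cases[OF B J]) blast
  define lift where "lift U = (SOME b. b \<in> carrier B \<and> h U = J +>\<^bsub>B\<^esub> b)" for U
  have lift: "lift U \<in> carrier B" "J +>\<^bsub>B\<^esub> lift U = h U" if U: "U \<in> carrier aut_alg" for U
  proof -
    have "lift U \<in> carrier B \<and> h U = J +>\<^bsub>B\<^esub> lift U"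
    proof -
      obtain b where "b \<in> carrier B \<and> h U = J +>\<^bsub>B\<^esub> b" using rep[OF alg_homD(2)[OF h U]] by blast
      then show ?thesis unfolding lift_def by (rule someI[where P = "\<lambda>b. b \<in> carrier B \<and> h U = J +>\<^bsub>B\<^esub> b"])
    qed
    then show "lift U \<in> carrier B" "J +>\<^bsub>B\<^esub> lift U = h U" by auto
  qed
  define c where "c i j = lift (cgen i j)" for i j
  define d where "d i j = lift (dgen i j)" for i j
  have c: "c i j \<in> carrier B" "J +>\<^bsub>B\<^esub> c i j = h (cgen i j)" if "i < n" "j < n" for i j
    using lift[OF cgen_closed[OF that]] by (auto simp: c_def)
  have d: "d i j \<in> carrier B" "J +>\<^bsub>B\<^esub> d i j = h (dgen i j)" if "i < n" "j < n" for i j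
    using lift[OF dgen_closed[OF that]] by (auto simp: d_def)
  have mats: "BB.LB.is_mat c" "BB.LB.is_mat d" using c d by (simp_all add: BB.LB.is_mat_def)
  obtain k where k: "k \<in> alg_hom A poly_alg B"
    and kc: "\<And>i j. \<lbrakk>i < n; j < n\<rbrakk> \<Longrightarrow> k (cvar i j) = c i j" and kd: "\<And>i j. \<lbrakk>i < n; j < n\<rbrakk> \<Longrightarrow> k (dvar i j) = d i j"
    using poly_hom_exists[where B = B and c = c and d = d] B c d by blast
  \<comment> \<open>Evaluation at the lifted entries followed by reduction agrees with
    \<open>h\<close> on the variables, hence everywhere; so the relations evaluate into
    \<open>J\<close>.\<close>
  have eq: "(\<lambda>p\<in>carrier poly_alg. ?\<pi> (k p)) = (\<lambda>p\<in>carrier poly_alg. h (aut_proj p))"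
    by (rule poly_hom_unique[OF alg_hom_comp[OF poly_alg_algebra k \<pi>] alg_hom_comp[OF poly_alg_algebra aut_proj_hom h]])
      (simp_all add: cvar_closed dvar_closed c d kc kd flip: cgen_def dgen_def)
  have "k ` P.LB.rels cvar dvar \<subseteq> J"
  proof
    fix b assume "b \<in> k ` P.LB.rels cvar dvar"
    then obtain p where p: "p \<in> P.LB.rels cvar dvar" "b = k p" by blast
    have pc: "p \<in> carrier poly_alg" using p(1) rels_carrier by blast
    have "p \<in> rel_ideal"
      unfolding rel_ideal_def using P.B.genideal_self[OF rels_carrier] p(1) by blast
    then have "aut_proj p = \<zero>\<^bsub>aut_alg\<^esub>"
      using pc quot_eq_zero_iff[OF poly_alg_algebra rel_ideal pc] quot_zero(1)[OF poly_alg_algebra rel_ideal]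
      by (simp add: aut_alg_def)
    moreover have "h \<zero>\<^bsub>aut_alg\<^esub> = \<zero>\<^bsub>?C\<^esub>"
      using lie_fg_base_change_hom.h_zero[OF base_change_homI[OF aut_alg_algebra C h]] .
    ultimately have "J +>\<^bsub>B\<^esub> k p = J"
      using fun_cong[OF eq, of p] pc alg_homD(2)[OF k pc] quot_zero(1)[OF B J] by simp
    then show "b \<in> J" using quot_eq_zero_iff[OF B J alg_homD(2)[OF k pc]] p(2) by simp
  qed
  moreover have "k ` P.LB.rels cvar dvar = BB.LB.rels c d"
    using rels_poly_hom[OF B k] BB.LB.rels_cong[OF mats kc kd] by simp
  ultimately have "BB.LB.rels c d \<subseteq> J" by simp
  then obtain c' d' where c': "BB.LB.is_mat c'" and d': "BB.LB.is_mat d'" and rels': "BB.LB.rels c' d' \<subseteq> {\<zero>\<^bsub>B\<^esub>}"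
    and cc: "\<And>i j. \<lbrakk>i < n; j < n\<rbrakk> \<Longrightarrow> c' i j \<ominus>\<^bsub>B\<^esub> c i j \<in> J" and dd: "\<And>i j. \<lbrakk>i < n; j < n\<rbrakk> \<Longrightarrow> d' i j \<ominus>\<^bsub>B\<^esub> d i j \<in> J"
    using BB.LB.lift_solution[OF J J2 BB.casimir_base_change[OF cas] mats] by blast
  have cl': "c' i j \<in> carrier B" "d' i j \<in> carrier B" if "i < n" "j < n" for i j
    using c' d' that by (auto simp: BB.LB.is_mat_def)
  obtain g where g: "g \<in> alg_hom A aut_alg B"
    and gc: "\<And>i j. \<lbrakk>i < n; j < n\<rbrakk> \<Longrightarrow> g (cgen i j) = c' i j" and gd: "\<And>i j. \<lbrakk>i < n; j < n\<rbrakk> \<Longrightarrow> g (dgen i j) = d' i j"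
    using aut_hom_exists[OF B cl' rels'] by blast
  \<comment> \<open>The corrected entries differ from the lifted ones by elements of
    \<open>J\<close>, so both homomorphisms agree on the generators.\<close>
  have "(\<lambda>r\<in>carrier aut_alg. ?\<pi> (g r)) = h"
  proof (rule aut_hom_eqI[OF alg_hom_comp[OF aut_alg_algebra g \<pi>] h])
    fix i j assume ij: "i < n" "j < n"
    show "(\<lambda>r\<in>carrier aut_alg. ?\<pi> (g r)) (cgen i j) = h (cgen i j)"
      using cc[OF ij] cl'[OF ij] c[OF ij] quot_eq_iff[OF B J, of "c' i j" "c i j"] by (simp add: cgen_closed ij gc)
    show "(\<lambda>r\<in>carrier aut_alg. ?\<pi> (g r)) (dgen i j) = h (dgen i j)"
      using dd[OF ij] cl'[OF ij] d[OF ij] quot_eq_iff[OF B J, of "d' i j" "d i j"] by (simp add: dgen_closed ij gd)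
  qed
  then have "J +>\<^bsub>B\<^esub> g r = h r" if "r \<in> carrier aut_alg" for r
    using that alg_homD(2)[OF g that] by (auto dest: fun_cong[of _ _ r])
  then show "\<exists>k\<in>alg_hom A aut_alg B. \<forall>r\<in>carrier aut_alg. J +>\<^bsub>B\<^esub> k r = h r"
    using g by blast
qed

end

section \<open>Uniqueness of the representing algebra\<close>

text \<open>The condition by which \<open>represents_Aut\<close> expresses that \<open>v\<close> is
  the base change of \<open>u\<close> along \<open>h\<close>.\<close>

definition compatible ::
  "('a, 'm) ring_scheme \<Rightarrow> ('a, 'g, 'k) lie_alg_scheme \<Rightarrow> ('a, 'b, 'l) module_scheme \<Rightarrow> ('a, 'c, 'j) module_scheme \<Rightarrow>
    (('g \<times> 'b) list set \<Rightarrow> ('g \<times> 'b) list set) \<Rightarrow> (('g \<times> 'c) list set \<Rightarrow> ('g \<times> 'c) list set) \<Rightarrow> ('b \<Rightarrow> 'c) \<Rightarrow> bool"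
  where "compatible A L B C u v h \<longleftrightarrow>
    (\<forall>U\<in>carrier (base_change A L B). v (base_change_map A L C h U) = base_change_map A L C h (u U))"

text \<open>The lifting problem for \<open>R'\<close> is pulled back along \<open>f\<close>, and the
  solution over \<open>R\<close> is composed with \<open>g\<close>; since
  \<open>f (g x) = x\<close>, it lifts the original map.\<close>

lemma formally_smooth_iso:
  assumes R': "algebra A R'" and f: "f \<in> alg_hom A R R'" and g: "g \<in> alg_hom A R' R"
    and fg: "\<And>x. x \<in> carrier R' \<Longrightarrow> f (g x) = x"
    and smooth: "formally_smooth_algebra TYPE('b) A R"
  shows "formally_smooth_algebra TYPE('b) A R'"
  unfolding formally_smooth_algebra_def
proof (intro conjI allI impI ballI R')
  fix B :: "('a, 'b) module" and J h
  assume B: "algebra A B \<and> ideal J B \<and> (\<forall>x\<in>J. \<forall>y\<in>J. x \<otimes>\<^bsub>B\<^esub> y = \<zero>\<^bsub>B\<^esub>)"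
    and h: "h \<in> alg_hom A R' (quot_algebra B J)"
  have R: "algebra A R" using smooth by (simp add: formally_smooth_algebra_def)
  obtain k where k: "k \<in> alg_hom A R B" "\<And>r. r \<in> carrier R \<Longrightarrow> J +>\<^bsub>B\<^esub> k r = (\<lambda>x\<in>carrier R. h (f x)) r"
    using smooth[unfolded formally_smooth_algebra_def, THEN conjunct2, THEN spec, THEN spec, THEN mp, OF B,
        THEN bspec, OF alg_hom_comp[OF R f h]] by (elim bexE) simp
  have "J +>\<^bsub>B\<^esub> (\<lambda>x\<in>carrier R'. k (g x)) r = h r" if "r \<in> carrier R'" for r
    using that k(2)[OF alg_homD(2)[OF g that]] alg_homD(2)[OF g that] by (simp add: fg)
  then show "\<exists>k\<in>alg_hom A R' B. \<forall>r\<in>carrier R'. J +>\<^bsub>B\<^esub> k r = h r"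
    using alg_hom_comp[OF R' g k(1)] by blast
qed

text \<open>Following the presentation of \<open>R\<close> by \<open>f\<close> keeps it surjective
  and, as \<open>f\<close> is injective, leaves the kernel unchanged.\<close>

lemma finitely_presented_iso:
  assumes R': "algebra A R'" and f: "f \<in> alg_hom A R R'" and g: "g \<in> alg_hom A R' R"
    and gf: "\<And>x. x \<in> carrier R \<Longrightarrow> g (f x) = x" and fg: "\<And>x. x \<in> carrier R' \<Longrightarrow> f (g x) = x"
    and fp: "finitely_presented_algebra A R"
  shows "finitely_presented_algebra A R'"
proof -
  have R: "algebra A R" using fp by (simp add: finitely_presented_algebra_def)
  interpret R: algebra A R by (rule R)
  interpret R': algebra A R' by (rule R')
  obtain n h F where h: "h \<in> alg_hom A (mpoly_ring A n) R" "h ` carrier (mpoly_ring A n) = carrier R"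
    and F: "finite F" "F \<subseteq> carrier (mpoly_ring A n)" "a_kernel (mpoly_ring A n) R h = genideal (mpoly_ring A n) F"
    using fp unfolding finitely_presented_algebra_def by blast
  let ?P = "mpoly_ring A n" and ?k = "\<lambda>x\<in>carrier (mpoly_ring A n). f (h x)"
  have P: "algebra A ?P" by (rule R.R.mpoly_algebra)
  have k: "?k \<in> alg_hom A ?P R'" by (rule alg_hom_comp[OF P h(1) f])
  have "f ` carrier R = carrier R'"
  proof
    show "f ` carrier R \<subseteq> carrier R'" using alg_homD(2)[OF f] by blast
    show "carrier R' \<subseteq> f ` carrier R" using alg_homD(2)[OF g] fg by (metis image_eqI subsetI)
  qed
  then have im: "?k ` carrier ?P = carrier R'"
    using h(2) by (simp add: image_image[symmetric])
  have zero: "f x = \<zero>\<^bsub>R'\<^esub> \<longleftrightarrow> x = \<zero>\<^bsub>R\<^esub>" if "x \<in> carrier R" for x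
  proof -
    have "f \<zero>\<^bsub>R\<^esub> = \<zero>\<^bsub>R'\<^esub>"
      by (rule ring_hom_zero[OF alg_homD(1)[OF f] R.ring_axioms R'.ring_axioms])
    then show ?thesis using gf that by (metis R.zero_closed)
  qed
  have "a_kernel ?P R' ?k = a_kernel ?P R h"
    unfolding a_kernel_def' using zero alg_homD(2)[OF h(1)] by auto
  then show ?thesis
    unfolding finitely_presented_algebra_def using R' k im F by (metis (no_types, lifting))
qed

context lie_fg
begin

lemma base_change_map_comp:
  assumes B: "algebra A B" and C: "algebra A C" and D: "algebra A D"
    and h: "h \<in> alg_hom A B C" and k: "k \<in> alg_hom A C D" and U: "U \<in> carrier (base_change A L B)"
  shows "base_change_map A L D (\<lambda>x\<in>carrier B. k (h x)) U = base_change_map A L D k (base_change_map A L C h U)"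
proof -
  interpret H: lie_fg_base_change_hom A L n e \<phi> B C h by (rule base_change_homI[OF B C h])
  interpret K: lie_fg_base_change_hom A L n e \<phi> C D k by (rule base_change_homI[OF C D k])
  interpret HK: lie_fg_base_change_hom A L n e \<phi> B D "\<lambda>x\<in>carrier B. k (h x)"
    by (rule base_change_homI[OF B D alg_hom_comp[OF B h k]])
  show ?thesis
    using U by (intro K.C.LB_eqI) (simp_all add: HK.bc_closed K.bc_closed H.bc_closed HK.Phi_bc K.Phi_bc H.Phi_bc)
qed

lemma base_change_map_id:
  assumes B: "algebra A B" and U: "U \<in> carrier (base_change A L B)"
  shows "base_change_map A L B (\<lambda>x\<in>carrier B. x) U = U"
proof -
  interpret H: lie_fg_base_change_hom A L n e \<phi> B B "\<lambda>x\<in>carrier B. x"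
    by (rule base_change_homI[OF B B alg_hom_id[OF B]])
  show ?thesis using U by (intro H.B.LB_eqI) (simp_all add: H.bc_closed H.Phi_bc)
qed

lemma compatible_comp:
  assumes B: "algebra A B" and C: "algebra A C" and D: "algebra A D"
    and h: "h \<in> alg_hom A B C" and k: "k \<in> alg_hom A C D"
    and u: "u \<in> lie_aut B (base_change A L B)"
    and hu: "compatible A L B C u v h" and kv: "compatible A L C D v w k"
  shows "compatible A L B D u w (\<lambda>x\<in>carrier B. k (h x))"
  unfolding compatible_def
proof
  fix U assume U: "U \<in> carrier (base_change A L B)"
  interpret H: lie_fg_base_change_hom A L n e \<phi> B C h by (rule base_change_homI[OF B C h])
  have uU: "u U \<in> carrier (base_change A L B)"
    using H.B.LB.endo_closed[OF H.B.LB.lie_autD(1)[OF u] U] .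
  show "w (base_change_map A L D (\<lambda>x\<in>carrier B. k (h x)) U) = base_change_map A L D (\<lambda>x\<in>carrier B. k (h x)) (u U)"
    using hu kv U uU H.bc_closed[OF U]
    by (simp add: base_change_map_comp[OF B C D h k] compatible_def)
qed

lemma represents_AutD:
  assumes "represents_Aut TYPE('b) A L R u"
  shows "algebra A R" "u \<in> lie_aut R (base_change A L R)"
    and "\<And>B :: ('a, 'b) module. \<And>v. \<lbrakk>algebra A B; v \<in> lie_aut B (base_change A L B)\<rbrakk> \<Longrightarrow>
      \<exists>!h. h \<in> alg_hom A R B \<and> compatible A L R B u v h"
  using assms by (simp_all add: represents_Aut_def compatible_def)

lemma represents_unique:
  fixes B :: "('a, 'b) module"
  assumes "represents_Aut TYPE('b) A L R u" "algebra A B" "v \<in> lie_aut B (base_change A L B)"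
    and "h \<in> alg_hom A R B" "compatible A L R B u v h" "k \<in> alg_hom A R B" "compatible A L R B u v k"
  shows "h = k"
  using represents_AutD(3)[OF assms(1-3)] assms(4-7) by blast

text \<open>The Yoneda argument: the identity also carries \<open>u\<close> to itself. The test
  algebras must range over the type of \<open>R\<close>, so that \<open>R\<close> is one of
  them.\<close>

lemma represents_endo_id:
  fixes R :: "('a, 'r) module"
  assumes rep: "represents_Aut TYPE('r) A L R u" and h: "h \<in> alg_hom A R R" "compatible A L R R u u h"
    and x: "x \<in> carrier R"
  shows "h x = x"
proof -
  note R = represents_AutD[OF rep]
  interpret RR: lie_fg_base_change A L n e \<phi> R by (rule base_changeI[OF R(1)])
  have "compatible A L R R u u (\<lambda>x\<in>carrier R. x)"
    using RR.LB.endo_closed[OF RR.LB.lie_autD(1)[OF R(2)]]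
    by (simp add: compatible_def base_change_map_id[OF R(1)])
  then have "h = (\<lambda>x\<in>carrier R. x)"
    by (intro represents_unique[OF rep R(1,2) h] alg_hom_id[OF R(1)])
  then show ?thesis using x by simp
qed

lemma represents_iso:
  fixes R R' :: "('a, 'r) module"
  assumes rep: "represents_Aut TYPE('r) A L R u" and rep': "represents_Aut TYPE('r) A L R' u'"
  obtains f g where "f \<in> alg_hom A R R'" "g \<in> alg_hom A R' R"
    "compatible A L R R' u u' f" "compatible A L R' R u' u g"
    "\<And>x. x \<in> carrier R \<Longrightarrow> g (f x) = x" "\<And>x. x \<in> carrier R' \<Longrightarrow> f (g x) = x"
proof -
  note R = represents_AutD[OF rep] and R' = represents_AutD[OF rep']
  obtain f where f: "f \<in> alg_hom A R R'" "compatible A L R R' u u' f" using R(3)[OF R'(1,2)] by blast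
  obtain g where g: "g \<in> alg_hom A R' R" "compatible A L R' R u' u g" using R'(3)[OF R(1,2)] by blast
  have "g (f x) = x" if "x \<in> carrier R" for x
    using represents_endo_id[OF rep alg_hom_comp[OF R(1) f(1) g(1)] compatible_comp[OF R(1) R'(1) R(1) f(1) g(1) R(2) f(2) g(2)] that] that
    by simp
  moreover have "f (g x) = x" if "x \<in> carrier R'" for x
    using represents_endo_id[OF rep' alg_hom_comp[OF R'(1) g(1) f(1)] compatible_comp[OF R'(1) R(1) R'(1) g(1) f(1) R'(2) g(2) f(2)] that] that
    by simp
  ultimately show thesis using that f g by blast
qed

text \<open>The classifying map for \<open>R'\<close> is the one for \<open>R\<close> preceded by
  \<open>g\<close>; a competitor, preceded by \<open>f\<close>, is classified by \<open>R\<close>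
  and therefore unique.\<close>

lemma represents_transfer:
  assumes rep: "represents_Aut TYPE('b) A L R u"
    and R': "algebra A R'" "u' \<in> lie_aut R' (base_change A L R')"
    and f: "f \<in> alg_hom A R R'" "compatible A L R R' u u' f" and g: "g \<in> alg_hom A R' R" "compatible A L R' R u' u g"
    and fg: "\<And>x. x \<in> carrier R' \<Longrightarrow> f (g x) = x"
  shows "represents_Aut TYPE('b) A L R' u'"
  unfolding represents_Aut_def compatible_def[symmetric]
proof (intro conjI allI impI ballI R')
  fix B :: "('a, 'b) module" and v
  assume B: "algebra A B" and v: "v \<in> lie_aut B (base_change A L B)"
  note R = represents_AutD[OF rep]
  obtain h where h: "h \<in> alg_hom A R B" "compatible A L R B u v h" using R(3)[OF B v] by blast
  show "\<exists>!h. h \<in> alg_hom A R' B \<and> compatible A L R' B u' v h"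
  proof (rule ex1I[of _ "\<lambda>x\<in>carrier R'. h (g x)"], intro conjI)
    show "(\<lambda>x\<in>carrier R'. h (g x)) \<in> alg_hom A R' B" by (rule alg_hom_comp[OF R'(1) g(1) h(1)])
    show "compatible A L R' B u' v (\<lambda>x\<in>carrier R'. h (g x))"
      by (rule compatible_comp[OF R'(1) R(1) B g(1) h(1) R'(2) g(2) h(2)])
    fix k assume "k \<in> alg_hom A R' B \<and> compatible A L R' B u' v k"
    then have k: "k \<in> alg_hom A R' B" "compatible A L R' B u' v k" by auto
    have "(\<lambda>x\<in>carrier R. k (f x)) = h"
      by (rule represents_unique[OF rep B v alg_hom_comp[OF R(1) f(1) k(1)]
            compatible_comp[OF R(1) R'(1) B f(1) k(1) R(2) f(2) k(2)] h])
    then have "h (g x) = k x" if "x \<in> carrier R'" for x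
      using alg_homD(2)[OF g(1) that] fg[OF that] by (auto dest: fun_cong[of _ _ "g x"])
    then show "k = (\<lambda>x\<in>carrier R'. h (g x))"
      by (intro alg_hom_eqI[OF k(1) alg_hom_comp[OF R'(1) g(1) h(1)]]) simp
  qed
qed

text \<open>\<open>aut_alg\<close> lives in the same type as \<open>R\<close>, so universality
  within that type alone makes the two isomorphic. Properties of \<open>aut_alg\<close> tested
  against an arbitrary type \<open>'b\<close> then pass to \<open>R\<close>.\<close>

lemma Aut_smooth:
  fixes R :: "('a, 'a fin_type_alg) module"
  assumes cas: "casimir e'" and rep: "represents_Aut TYPE('a fin_type_alg) A L R u"
  shows "represents_Aut TYPE('b) A L R u \<and> smooth_algebra TYPE('b) A R \<and> finitely_presented_algebra A R"
proof -
  note R = represents_AutD[OF rep]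
  obtain f g where f: "f \<in> alg_hom A aut_alg R" and g: "g \<in> alg_hom A R aut_alg"
    and cf: "compatible A L aut_alg R aut_univ u f" and cg: "compatible A L R aut_alg u aut_univ g"
    and gf: "\<And>x. x \<in> carrier aut_alg \<Longrightarrow> g (f x) = x" and fg: "\<And>x. x \<in> carrier R \<Longrightarrow> f (g x) = x"
    by (rule represents_iso[OF represents_Aut_aut_alg rep]) (rule that; (assumption | simp))
  have "finitely_presented_algebra A R"
    by (rule finitely_presented_iso[OF R(1) f g gf fg finitely_presented_aut_alg])
  moreover have "formally_smooth_algebra TYPE('b) A R"
    by (rule formally_smooth_iso[OF R(1) f g fg formally_smooth_aut_alg[OF cas]])
  moreover have "represents_Aut TYPE('b) A L R u"
    by (rule represents_transfer[OF represents_Aut_aut_alg R(1,2) f cf g cg fg])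
  ultimately show ?thesis by (simp add: smooth_algebra_def)
qed

end

section \<open>Finite generation\<close>

text \<open>By Zorn there is a maximal member among the ideals that contain \<open>I\<close> and
  avoid 1; it is a maximal ideal, hence prime.\<close>

lemma (in cring) proper_ideal_in_prime:
  assumes I: "ideal I R" and one: "\<one> \<notin> I"
  obtains P where "primeideal P R" "I \<subseteq> P"
proof -
  let ?S = "{J. ideal J R \<and> I \<subseteq> J \<and> \<one> \<notin> J}"
  have "\<exists>M\<in>?S. \<forall>J\<in>?S. M \<subseteq> J \<longrightarrow> J = M"
  proof (rule subset_Zorn_nonempty)
    show "?S \<noteq> {}" using I one by blast
    fix C assume C: "C \<noteq> {}" "subset.chain ?S C"
    then have CS: "C \<subseteq> ?S" by (simp add: pred_on.chain_def)
    then have "subset.chain {J. ideal J R} C" using C(2) unfolding pred_on.chain_def by blast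
    then have "ideal (\<Union>C) R" using chain_Union_is_ideal[of C] C(1) by simp
    moreover have "I \<subseteq> \<Union>C"
    proof -
      obtain K where "K \<in> C" using C(1) by (auto simp flip: ex_in_conv)
      moreover from this have "I \<subseteq> K" using CS by (simp add: subset_iff)
      ultimately show ?thesis by (simp add: Sup_upper2)
    qed
    moreover have "\<one> \<notin> \<Union>C"
    proof
      assume "\<one> \<in> \<Union>C"
      then obtain K where K: "K \<in> C" "\<one> \<in> K" by (rule UnionE)
      then show False using subsetD[OF CS K(1)] by simp
    qed
    ultimately show "\<Union>C \<in> ?S" by simp
  qed
  then obtain M where MS: "M \<in> ?S" and max: "\<forall>J\<in>?S. M \<subseteq> J \<longrightarrow> J = M" by (rule bexE)
  then have M: "ideal M R" "I \<subseteq> M" "\<one> \<notin> M" by simp_all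
  have "maximalideal M R"
  proof (rule maximalidealI[OF M(1)])
    show "carrier R \<noteq> M" using M(3) by auto
    fix J assume J: "ideal J R" "M \<subseteq> J" "J \<subseteq> carrier R"
    show "J = M \<or> J = carrier R"
    proof (cases "\<one> \<in> J")
      case True
      then show ?thesis using ideal.one_imp_carrier[OF J(1)] by simp
    next
      case False
      then have "J \<in> ?S" using J M(2) by simp
      then show ?thesis using max J(2) by simp
    qed
  qed
  then show thesis by (intro that[of M] maximalideal_prime M(2))
qed

lemma (in primeideal) pow_mem_imp_mem:
  assumes "a \<in> carrier R" "a [^] (k::nat) \<in> I"
  shows "a \<in> I"
  using assms(2)
proof (induct k)
  case 0
  then show ?case using one_imp_carrier assms(1) by simp
next
  case (Suc k)
  then show ?case using I_prime[of "a [^] k" a] assms(1) by auto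
qed

section \<open>Fractions, localized modules and the finiteness of supports\<close>

context module
begin

context
  fixes f assumes f: "f \<in> carrier R"
begin

abbreviation fpow :: "nat \<Rightarrow> 'a"
  where "fpow k \<equiv> f [^] k"

abbreviation frac :: "'c \<Rightarrow> nat \<Rightarrow> ('c \<times> nat) set"
  where "frac \<equiv> fraction R M f"

lemma fpow_closed: "fpow k \<in> carrier R"
  using f by simp

lemma fpow_smult: "x \<in> carrier M \<Longrightarrow> fpow k \<odot>\<^bsub>M\<^esub> (fpow l \<odot>\<^bsub>M\<^esub> x) = fpow (k + l) \<odot>\<^bsub>M\<^esub> x"
  using f by (simp add: R.nat_pow_mult flip: smult_assoc1)

lemma frac_mem_iff: "(n, j) \<in> frac m i \<longleftrightarrow> n \<in> carrier M \<and> (\<exists>k. fpow (k + j) \<odot>\<^bsub>M\<^esub> m = fpow (k + i) \<odot>\<^bsub>M\<^esub> n)"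
  by (simp add: fraction_def)

lemma frac_self: "m \<in> carrier M \<Longrightarrow> (m, i) \<in> frac m i"
  by (simp add: frac_mem_iff)

lemma frac_trans:
  assumes "m \<in> carrier M" "(n, j) \<in> frac m i" "(q, p) \<in> frac n j"
  shows "(q, p) \<in> frac m i"
proof -
  obtain k l where n: "n \<in> carrier M" and q: "q \<in> carrier M"
    and k: "fpow (k + j) \<odot>\<^bsub>M\<^esub> m = fpow (k + i) \<odot>\<^bsub>M\<^esub> n" and l: "fpow (l + p) \<odot>\<^bsub>M\<^esub> n = fpow (l + j) \<odot>\<^bsub>M\<^esub> q"
    using assms(2,3) by (auto simp: frac_mem_iff)
  have "fpow (k + l + j + p) \<odot>\<^bsub>M\<^esub> m = fpow (l + p) \<odot>\<^bsub>M\<^esub> (fpow (k + j) \<odot>\<^bsub>M\<^esub> m)"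
    using assms(1) by (simp add: fpow_smult add.commute add.left_commute)
  also have "\<dots> = fpow (k + i) \<odot>\<^bsub>M\<^esub> (fpow (l + p) \<odot>\<^bsub>M\<^esub> n)"
    unfolding k using n by (simp add: fpow_smult add.commute add.left_commute)
  also have "\<dots> = fpow (k + l + j + i) \<odot>\<^bsub>M\<^esub> q"
    unfolding l using q by (simp add: fpow_smult add.commute add.left_commute)
  finally show ?thesis using q by (auto simp: frac_mem_iff)
qed

lemma frac_sym: "\<lbrakk>m \<in> carrier M; (n, j) \<in> frac m i\<rbrakk> \<Longrightarrow> (m, i) \<in> frac n j"
  by (auto simp: frac_mem_iff dest: HOL.sym)

lemma frac_eqI:
  assumes "m \<in> carrier M" "(n, j) \<in> frac m i"
  shows "frac m i = frac n j"
proof -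
  have "n \<in> carrier M" using assms(2) by (simp add: frac_mem_iff)
  then show ?thesis using frac_trans[OF _ frac_sym[OF assms]] frac_trans[OF assms] by (auto simp del: split_paired_Ex)
qed

abbreviation LM where "LM \<equiv> loc_module R M f"

lemma loc_carrier: "U \<in> carrier LM \<longleftrightarrow> (\<exists>m i. m \<in> carrier M \<and> U = frac m i)"
  by (auto simp: loc_module_def)

text \<open>Addition of classes is a union over all representatives. It collapses to one class
  because different representatives, after multiplication by suitable powers of \<open>f\<close>,
  give the same fraction.\<close>

lemma loc_add:
  assumes m: "m \<in> carrier M" and n: "n \<in> carrier M"
  shows "frac m i \<oplus>\<^bsub>LM\<^esub> frac n j = frac (fpow j \<odot>\<^bsub>M\<^esub> m \<oplus>\<^bsub>M\<^esub> fpow i \<odot>\<^bsub>M\<^esub> n) (i + j)"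
proof -
  have "frac (fpow j' \<odot>\<^bsub>M\<^esub> m' \<oplus>\<^bsub>M\<^esub> fpow i' \<odot>\<^bsub>M\<^esub> n') (i' + j') = frac (fpow j \<odot>\<^bsub>M\<^esub> m \<oplus>\<^bsub>M\<^esub> fpow i \<odot>\<^bsub>M\<^esub> n) (i + j)"
    if mm: "(m', i') \<in> frac m i" and nn: "(n', j') \<in> frac n j" for m' i' n' j'
  proof (rule frac_eqI[symmetric])
    obtain k l where m': "m' \<in> carrier M" and n': "n' \<in> carrier M"
      and k: "fpow (k + i') \<odot>\<^bsub>M\<^esub> m = fpow (k + i) \<odot>\<^bsub>M\<^esub> m'" and l: "fpow (l + j') \<odot>\<^bsub>M\<^esub> n = fpow (l + j) \<odot>\<^bsub>M\<^esub> n'"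
      using mm nn by (auto simp: frac_mem_iff)
    note ac = add.commute add.left_commute
    have "fpow (k + l + (i' + j')) \<odot>\<^bsub>M\<^esub> (fpow j \<odot>\<^bsub>M\<^esub> m \<oplus>\<^bsub>M\<^esub> fpow i \<odot>\<^bsub>M\<^esub> n)
      = fpow (l + j' + j) \<odot>\<^bsub>M\<^esub> (fpow (k + i') \<odot>\<^bsub>M\<^esub> m) \<oplus>\<^bsub>M\<^esub> fpow (k + i' + i) \<odot>\<^bsub>M\<^esub> (fpow (l + j') \<odot>\<^bsub>M\<^esub> n)"
      using m n f by (simp add: smult_r_distr fpow_smult ac)
    also have "\<dots> = fpow (k + l + (i + j)) \<odot>\<^bsub>M\<^esub> (fpow j' \<odot>\<^bsub>M\<^esub> m' \<oplus>\<^bsub>M\<^esub> fpow i' \<odot>\<^bsub>M\<^esub> n')"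
      unfolding k l using m' n' f by (simp add: smult_r_distr fpow_smult ac)
    finally show "(fpow j' \<odot>\<^bsub>M\<^esub> m' \<oplus>\<^bsub>M\<^esub> fpow i' \<odot>\<^bsub>M\<^esub> n', i' + j') \<in> frac (fpow j \<odot>\<^bsub>M\<^esub> m \<oplus>\<^bsub>M\<^esub> fpow i \<odot>\<^bsub>M\<^esub> n) (i + j)"
      using m' n' f by (auto simp: frac_mem_iff)
  qed (use m n f in auto)
  then have "{z. \<exists>(m', i')\<in>frac m i. \<exists>(n', j')\<in>frac n j. z \<in> frac (fpow j' \<odot>\<^bsub>M\<^esub> m' \<oplus>\<^bsub>M\<^esub> fpow i' \<odot>\<^bsub>M\<^esub> n') (i' + j')}
    = frac (fpow j \<odot>\<^bsub>M\<^esub> m \<oplus>\<^bsub>M\<^esub> fpow i \<odot>\<^bsub>M\<^esub> n) (i + j)"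
    using frac_self[OF m, of i] frac_self[OF n, of j] by blast
  then show ?thesis by (simp add: loc_module_def)
qed

lemma loc_smult:
  assumes a: "a \<in> carrier R" and m: "m \<in> carrier M"
  shows "fraction R (self_module R) f a i \<odot>\<^bsub>LM\<^esub> frac m j = frac (a \<odot>\<^bsub>M\<^esub> m) (i + j)"
proof -
  have "frac (a' \<odot>\<^bsub>M\<^esub> m') (i' + j') = frac (a \<odot>\<^bsub>M\<^esub> m) (i + j)"
    if aa: "(a', i') \<in> fraction R (self_module R) f a i" and mm: "(m', j') \<in> frac m j" for a' i' m' j'
  proof (rule frac_eqI[symmetric])
    obtain k l where a': "a' \<in> carrier R" and m': "m' \<in> carrier M"
      and k: "fpow (k + i') \<otimes> a = fpow (k + i) \<otimes> a'" and l: "fpow (l + j') \<odot>\<^bsub>M\<^esub> m = fpow (l + j) \<odot>\<^bsub>M\<^esub> m'"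
      using aa mm by (auto simp: fraction_def self_module_def)
    have *: "fpow (k + l + (p + q)) \<odot>\<^bsub>M\<^esub> (b \<odot>\<^bsub>M\<^esub> x) = (fpow (k + p) \<otimes> b) \<odot>\<^bsub>M\<^esub> (fpow (l + q) \<odot>\<^bsub>M\<^esub> x)"
      if "b \<in> carrier R" "x \<in> carrier M" for b x p q
    proof -
      have "fpow (k + l + (p + q)) = fpow (k + p) \<otimes> fpow (l + q)"
        using f by (simp add: R.nat_pow_mult add.commute add.left_commute)
      then show ?thesis using that f by (simp add: R.m_ac flip: smult_assoc1)
    qed
    have "fpow (k + l + (i' + j')) \<odot>\<^bsub>M\<^esub> (a \<odot>\<^bsub>M\<^esub> m) = fpow (k + l + (i + j)) \<odot>\<^bsub>M\<^esub> (a' \<odot>\<^bsub>M\<^esub> m')"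
      using a m a' m' by (simp add: * k l)
    then show "(a' \<odot>\<^bsub>M\<^esub> m', i' + j') \<in> frac (a \<odot>\<^bsub>M\<^esub> m) (i + j)"
      using a' m' by (auto simp: frac_mem_iff)
  qed (use a m in auto)
  moreover have "(a, i) \<in> fraction R (self_module R) f a i"
    using a by (auto simp: fraction_def self_module_def)
  ultimately have "{z. \<exists>(a', i')\<in>fraction R (self_module R) f a i. \<exists>(m', j')\<in>frac m j. z \<in> frac (a' \<odot>\<^bsub>M\<^esub> m') (i' + j')}
    = frac (a \<odot>\<^bsub>M\<^esub> m) (i + j)"
    using frac_self[OF m, of j] by blast
  then show ?thesis by (simp add: loc_module_def)
qed

text \<open>Gives the finite sums in \<open>free_of_finite_rank\<close> their usual laws.\<close>

lemma loc_abelian_monoid: "abelian_monoid LM"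
proof (rule abelian_monoidI)
  have zero: "\<zero>\<^bsub>LM\<^esub> = frac \<zero>\<^bsub>M\<^esub> 0" by (simp add: loc_module_def)
  show "\<zero>\<^bsub>LM\<^esub> \<in> carrier LM" unfolding zero loc_carrier by blast
  fix U V W assume U: "U \<in> carrier LM" and V: "V \<in> carrier LM"
  obtain m i where m: "m \<in> carrier M" "U = frac m i" using U by (auto simp: loc_carrier)
  obtain n j where n: "n \<in> carrier M" "V = frac n j" using V by (auto simp: loc_carrier)
  show "U \<oplus>\<^bsub>LM\<^esub> V \<in> carrier LM"
  proof -
    have "U \<oplus>\<^bsub>LM\<^esub> V = frac (fpow j \<odot>\<^bsub>M\<^esub> m \<oplus>\<^bsub>M\<^esub> fpow i \<odot>\<^bsub>M\<^esub> n) (i + j)" using m n by (simp add: loc_add)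
    moreover have "fpow j \<odot>\<^bsub>M\<^esub> m \<oplus>\<^bsub>M\<^esub> fpow i \<odot>\<^bsub>M\<^esub> n \<in> carrier M" using m n f by simp
    ultimately show ?thesis unfolding loc_carrier by blast
  qed
  show "\<zero>\<^bsub>LM\<^esub> \<oplus>\<^bsub>LM\<^esub> U = U" using m by (simp add: zero loc_add f)
  show "U \<oplus>\<^bsub>LM\<^esub> V = V \<oplus>\<^bsub>LM\<^esub> U"
    using m n f by (simp add: loc_add M.a_comm add.commute)
  assume W: "W \<in> carrier LM"
  obtain q p where q: "q \<in> carrier M" "W = frac q p" using W by (auto simp: loc_carrier)
  show "U \<oplus>\<^bsub>LM\<^esub> V \<oplus>\<^bsub>LM\<^esub> W = U \<oplus>\<^bsub>LM\<^esub> (V \<oplus>\<^bsub>LM\<^esub> W)"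
    using m n q f by (simp add: loc_add smult_r_distr fpow_smult M.a_assoc add.commute add.left_commute)
qed

text \<open>\<open>g\<close> stands for the coordinates of an embedding into a free module.\<close>

lemma free_localization_finite_support:
  assumes free: "free_of_finite_rank (loc_ring R f) LM"
    and g_closed: "\<And>x i. x \<in> carrier M \<Longrightarrow> g x i \<in> carrier R"
    and g_add: "\<And>x y i. \<lbrakk>x \<in> carrier M; y \<in> carrier M\<rbrakk> \<Longrightarrow> g (x \<oplus>\<^bsub>M\<^esub> y) i = g x i \<oplus> g y i"
    and g_smult: "\<And>a x i. \<lbrakk>a \<in> carrier R; x \<in> carrier M\<rbrakk> \<Longrightarrow> g (a \<odot>\<^bsub>M\<^esub> x) i = a \<otimes> g x i"
    and g_fin: "\<And>x. x \<in> carrier M \<Longrightarrow> finite {i. g x i \<noteq> \<zero>}"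
  obtains I0 where "finite I0" "\<And>x. x \<in> carrier M \<Longrightarrow> \<exists>k. \<forall>i. i \<notin> I0 \<longrightarrow> fpow k \<otimes> g x i = \<zero>"
proof -
  interpret LM: abelian_monoid LM by (rule loc_abelian_monoid)
  obtain n :: nat and e where n: "\<forall>i<n. e i \<in> carrier LM"
    "\<forall>U\<in>carrier LM. \<exists>!c. c \<in> {..<n} \<rightarrow>\<^sub>E carrier (loc_ring R f) \<and> U = (\<Oplus>\<^bsub>LM\<^esub>i\<in>{..<n}. c i \<odot>\<^bsub>LM\<^esub> e i)"
    using free unfolding free_of_finite_rank_def by (elim exE conjE)
  note e = n(1)[rule_format] and ex = ex1_implies_ex[OF bspec[OF n(2)]]
  have "\<forall>i<n. \<exists>m t. m \<in> carrier M \<and> e i = frac m t" using e by (simp add: loc_carrier)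
  then obtain m t where m: "\<And>i. i < n \<Longrightarrow> m i \<in> carrier M" and mt: "\<And>i. i < n \<Longrightarrow> e i = frac (m i) (t i)" by metis
  \<comment> \<open>The supports of the numerators of a local basis; there are finitely many and
    each is finite.\<close>
  define I0 where "I0 = (\<Union>i<n. {l. g (m i) l \<noteq> \<zero>})"
  \<comment> \<open>The exponent may depend on \<open>x\<close> but not on the coordinate, so that
    it survives sums and the clearing of denominators.\<close>
  define good where "good x \<longleftrightarrow> (\<exists>k. \<forall>l. l \<notin> I0 \<longrightarrow> fpow k \<otimes> g x l = \<zero>)" for x
  have fin: "finite I0" unfolding I0_def using g_fin m by auto
  have good_add: "good (x \<oplus>\<^bsub>M\<^esub> y)" if "x \<in> carrier M" "y \<in> carrier M" and g: "good x" "good y" for x y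
  proof -
    obtain k l where k: "\<And>i. i \<notin> I0 \<Longrightarrow> fpow k \<otimes> g x i = \<zero>" and l: "\<And>i. i \<notin> I0 \<Longrightarrow> fpow l \<otimes> g y i = \<zero>"
      using g by (auto simp: good_def)
    have "fpow (k + l) \<otimes> g (x \<oplus>\<^bsub>M\<^esub> y) i = \<zero>" if i: "i \<notin> I0" for i
    proof -
      have "fpow (k + l) \<otimes> g (x \<oplus>\<^bsub>M\<^esub> y) i = fpow l \<otimes> (fpow k \<otimes> g x i) \<oplus> fpow k \<otimes> (fpow l \<otimes> g y i)"
        using \<open>x \<in> carrier M\<close> \<open>y \<in> carrier M\<close> f g_closed
        by (simp add: g_add R.r_distr R.m_lcomm flip: R.nat_pow_mult R.m_assoc)
      then show ?thesis using f by (simp add: k[OF i] l[OF i])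
    qed
    then show ?thesis unfolding good_def by blast
  qed
  have good_smult: "good (a \<odot>\<^bsub>M\<^esub> x)" if "a \<in> carrier R" "x \<in> carrier M" and g: "good x" for a x
  proof -
    obtain k where k: "\<And>i. i \<notin> I0 \<Longrightarrow> fpow k \<otimes> g x i = \<zero>" using g by (auto simp: good_def)
    have "fpow k \<otimes> g (a \<odot>\<^bsub>M\<^esub> x) i = \<zero>" if i: "i \<notin> I0" for i
    proof -
      have "fpow k \<otimes> g (a \<odot>\<^bsub>M\<^esub> x) i = a \<otimes> (fpow k \<otimes> g x i)"
        using \<open>a \<in> carrier R\<close> \<open>x \<in> carrier M\<close> f g_closed by (simp add: g_smult R.m_lcomm)
      then show ?thesis using \<open>a \<in> carrier R\<close> by (simp add: k[OF i])
    qed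
    then show ?thesis unfolding good_def by blast
  qed
  have good_pow: "good x" if "x \<in> carrier M" and g: "good (fpow k \<odot>\<^bsub>M\<^esub> x)" for x k
  proof -
    obtain l where l: "\<And>i. i \<notin> I0 \<Longrightarrow> fpow l \<otimes> g (fpow k \<odot>\<^bsub>M\<^esub> x) i = \<zero>" using g by (auto simp: good_def)
    have "fpow (l + k) \<otimes> g x i = \<zero>" if "i \<notin> I0" for i
      using l[OF that] \<open>x \<in> carrier M\<close> f g_closed by (simp add: g_smult R.m_assoc flip: R.nat_pow_mult)
    then show ?thesis unfolding good_def by blast
  qed
  have good_frac: "good n'" if x: "x \<in> carrier M" "good x" and fr: "(n', j) \<in> frac x i" for x n' i j
  proof -
    obtain k where n': "n' \<in> carrier M" and k: "fpow (k + j) \<odot>\<^bsub>M\<^esub> x = fpow (k + i) \<odot>\<^bsub>M\<^esub> n'"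
      using fr by (auto simp: frac_mem_iff)
    have "good (fpow (k + i) \<odot>\<^bsub>M\<^esub> n')" using good_smult[OF fpow_closed x, of "k + j"] k by simp
    then show ?thesis using n' good_pow by blast
  qed
  \<comment> \<open>Fractions with a good numerator are closed under sums and contain the multiples
    of the local basis, so they exhaust the localized module. By \<open>good_frac\<close> goodness
    does not depend on the representative, so every \<open>x\<close> is good.\<close>
  define Q where "Q = {frac x i | x i. x \<in> carrier M \<and> good x}"
  have Q_carrier: "Q \<subseteq> carrier LM"
  proof
    fix U assume "U \<in> Q"
    then show "U \<in> carrier LM" unfolding Q_def loc_carrier by blast
  qed
  have "finsum LM h F \<in> Q" if "finite F" "\<And>i. i \<in> F \<Longrightarrow> h i \<in> Q" for F and h :: "nat \<Rightarrow> ('c \<times> nat) set"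
    using that
  proof (induct F)
    case empty
    have "good \<zero>\<^bsub>M\<^esub>" using good_smult[of \<zero> "\<zero>\<^bsub>M\<^esub>"] g_smult[of \<zero> "\<zero>\<^bsub>M\<^esub>"] g_closed[of "\<zero>\<^bsub>M\<^esub>"]
      by (auto simp: good_def intro!: exI[of _ 0])
    then have "frac \<zero>\<^bsub>M\<^esub> 0 \<in> Q" unfolding Q_def by blast
    moreover have "\<zero>\<^bsub>LM\<^esub> = frac \<zero>\<^bsub>M\<^esub> 0" by (simp add: loc_module_def)
    ultimately show ?case by (simp only: LM.finsum_empty)
  next
    case (insert i F)
    then have "h i \<in> Q" "finsum LM h F \<in> Q" by auto
    then obtain x p y q where x: "x \<in> carrier M" "good x" "h i = frac x p"
      and y: "y \<in> carrier M" "good y" "finsum LM h F = frac y q" unfolding Q_def by blast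
    have "finsum LM h (insert i F) = frac x p \<oplus>\<^bsub>LM\<^esub> frac y q"
    proof -
      have "h \<in> F \<rightarrow> carrier LM" "h i \<in> carrier LM" using insert(4) Q_carrier by blast+
      then show ?thesis using LM.finsum_insert[OF insert(1,2)] x(3) y(3) by simp
    qed
    also have "\<dots> = frac (fpow q \<odot>\<^bsub>M\<^esub> x \<oplus>\<^bsub>M\<^esub> fpow p \<odot>\<^bsub>M\<^esub> y) (p + q)" using x y by (simp add: loc_add)
    also have "\<dots> \<in> Q"
    proof -
      have c: "fpow q \<odot>\<^bsub>M\<^esub> x \<in> carrier M" "fpow p \<odot>\<^bsub>M\<^esub> y \<in> carrier M"
        using x(1) y(1) fpow_closed by auto
      have "good (fpow q \<odot>\<^bsub>M\<^esub> x \<oplus>\<^bsub>M\<^esub> fpow p \<odot>\<^bsub>M\<^esub> y)"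
        by (intro good_add c good_smult fpow_closed x y)
      then show ?thesis unfolding Q_def using M.a_closed[OF c] by blast
    qed
    finally show ?case .
  qed
  note Q_finsum = this
  have gm: "good (m i)" if "i < n" for i
    unfolding good_def using that f m g_closed by (intro exI[of _ 0]) (auto simp: I0_def)
  have Q_smult: "c \<odot>\<^bsub>LM\<^esub> e i \<in> Q" if c: "c \<in> carrier (loc_ring R f)" and i: "i < n" for c i
  proof -
    obtain a p where a: "a \<in> carrier R" "c = fraction R (self_module R) f a p"
      using c by (auto simp: loc_ring_def)
    have "c \<odot>\<^bsub>LM\<^esub> e i = frac (a \<odot>\<^bsub>M\<^esub> m i) (p + t i)"
      using i a m by (simp add: mt loc_smult)
    moreover have "good (a \<odot>\<^bsub>M\<^esub> m i)" using good_smult a m i gm by blast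
    ultimately show ?thesis unfolding Q_def using a m i by blast
  qed
  show thesis
  proof (rule that[OF fin])
    fix x assume x: "x \<in> carrier M"
    then have "frac x 0 \<in> carrier LM" unfolding loc_carrier by blast
    then obtain c where "c \<in> {..<n} \<rightarrow>\<^sub>E carrier (loc_ring R f)" "frac x 0 = (\<Oplus>\<^bsub>LM\<^esub>i\<in>{..<n}. c i \<odot>\<^bsub>LM\<^esub> e i)"
      using ex by blast
    then have "frac x 0 \<in> Q" using Q_finsum[of "{..<n}" "\<lambda>i. c i \<odot>\<^bsub>LM\<^esub> e i"] Q_smult by auto
    then obtain y i where y: "y \<in> carrier M" "good y" "frac x 0 = frac y i" unfolding Q_def by blast
    then have "good x" using good_frac[OF y(1,2)] frac_self[OF x, of 0] by simp
    then show "\<exists>k. \<forall>i. i \<notin> I0 \<longrightarrow> fpow k \<otimes> g x i = \<zero>" by (simp add: good_def)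
  qed
qed

end

text \<open>Locally the supports of all \<open>g x\<close> lie in one finite set. Finitely many of these local sets suffice,
  since otherwise some prime ideal would contain every \<open>f\<close> that admits such a set.\<close>

lemma finite_support:
  assumes loc: "locally_of_finite_rank R M"
    and g_closed: "\<And>x i. x \<in> carrier M \<Longrightarrow> g x i \<in> carrier R"
    and g_add: "\<And>x y i. \<lbrakk>x \<in> carrier M; y \<in> carrier M\<rbrakk> \<Longrightarrow> g (x \<oplus>\<^bsub>M\<^esub> y) i = g x i \<oplus> g y i"
    and g_smult: "\<And>a x i. \<lbrakk>a \<in> carrier R; x \<in> carrier M\<rbrakk> \<Longrightarrow> g (a \<odot>\<^bsub>M\<^esub> x) i = a \<otimes> g x i"
    and g_fin: "\<And>x. x \<in> carrier M \<Longrightarrow> finite {i. g x i \<noteq> \<zero>}"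
  obtains I0 where "finite I0" "\<And>x i. \<lbrakk>x \<in> carrier M; i \<notin> I0\<rbrakk> \<Longrightarrow> g x i = \<zero>"
proof -
  \<comment> \<open>The elements that admit a finite support set after localization; by the
    hypothesis no prime ideal contains them all.\<close>
  define G where "G = {f \<in> carrier R. \<exists>I0. finite I0 \<and> (\<forall>x\<in>carrier M. \<exists>k::nat. \<forall>i. i \<notin> I0 \<longrightarrow> f [^] k \<otimes> g x i = \<zero>)}"
  have G: "\<exists>f\<in>G. f \<notin> P" if P: "primeideal P R" for P
  proof -
    obtain f where f: "f \<in> carrier R" "f \<notin> P" "free_of_finite_rank (loc_ring R f) (loc_module R M f)"
      using loc P unfolding locally_of_finite_rank_def by blast
    obtain I0 where "finite I0" "\<And>x. x \<in> carrier M \<Longrightarrow> \<exists>k::nat. \<forall>i. i \<notin> I0 \<longrightarrow> f [^] k \<otimes> g x i = \<zero>"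
      by (rule free_localization_finite_support[OF f(1,3), of g]) (use g_closed g_add g_smult g_fin in auto)
    then show ?thesis using f by (auto simp: G_def)
  qed
  have GR: "G \<subseteq> carrier R" by (auto simp: G_def)
  have "\<exists>G0. finite G0 \<and> G0 \<subseteq> G \<and> \<one> \<in> Idl G0"
  proof (rule ccontr)
    assume none: "\<not> ?thesis"
    \<comment> \<open>The ideal generated by \<open>G\<close>, written as a directed union over
      finite subsets: if 1 belonged to it, finitely many elements would already generate 1.\<close>
    define J where "J = (\<Union>G0\<in>{G0. finite G0 \<and> G0 \<subseteq> G}. Idl G0)"
    have idl: "ideal (Idl G0) R" if "G0 \<subseteq> G" for G0 using that GR by (intro genideal_ideal) auto
    have mono: "Idl G0 \<subseteq> Idl G1" if "G0 \<subseteq> G1" "G1 \<subseteq> G" for G0 G1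
      using that GR genideal_self[of G1] by (intro genideal_minimal idl) auto
    have J: "ideal J R"
    proof (rule idealI[OF R.ring_axioms])
      show "subgroup J (add_monoid R)"
      proof (rule R.add.subgroupI)
        show "J \<subseteq> carrier R"
          unfolding J_def using additive_subgroup.a_subset[OF ideal.axioms(1)[OF idl]] by blast
        show "J \<noteq> {}"
          unfolding J_def using additive_subgroup.zero_closed[OF ideal.axioms(1)[OF idl[of "{}"]]] by blast
        show "\<ominus> a \<in> J" if "a \<in> J" for a
        proof -
          obtain G0 where *: "finite G0" "G0 \<subseteq> G" "a \<in> Idl G0" using \<open>a \<in> J\<close> unfolding J_def by blast
          then have "\<ominus> a \<in> Idl G0" using additive_subgroup.a_inv_closed[OF ideal.axioms(1)[OF idl[OF *(2)]]] by simp
          then show ?thesis unfolding J_def using * by blast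
        qed
        fix a b assume "a \<in> J" "b \<in> J"
        then obtain G0 G1 where *: "finite G0" "G0 \<subseteq> G" "a \<in> Idl G0" "finite G1" "G1 \<subseteq> G" "b \<in> Idl G1"
          unfolding J_def by blast
        have "a \<in> Idl (G0 \<union> G1)" "b \<in> Idl (G0 \<union> G1)"
          using * mono[of G0 "G0 \<union> G1"] mono[of G1 "G0 \<union> G1"] by auto
        then have "a \<oplus> b \<in> Idl (G0 \<union> G1)"
          using * by (intro additive_subgroup.a_closed[OF ideal.axioms(1)[OF idl]]) auto
        then show "a \<oplus> b \<in> J" unfolding J_def using * by blast
      qed
    next
      fix a x assume "a \<in> J" "x \<in> carrier R"
      then obtain G0 where *: "finite G0" "G0 \<subseteq> G" "a \<in> Idl G0" unfolding J_def by blast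
      then have "x \<otimes> a \<in> Idl G0" "a \<otimes> x \<in> Idl G0"
        using ideal.I_l_closed[OF idl[OF *(2)]] ideal.I_r_closed[OF idl[OF *(2)]] \<open>x \<in> carrier R\<close> by simp_all
      then show "x \<otimes> a \<in> J" "a \<otimes> x \<in> J" unfolding J_def using * by blast+
    qed
    have "\<one> \<notin> J" using none unfolding J_def by blast
    then obtain P where P: "primeideal P R" "J \<subseteq> P" using R.proper_ideal_in_prime[OF J] by blast
    obtain f where f: "f \<in> G" "f \<notin> P" using G[OF P(1)] by blast
    have "f \<in> Idl {f}" using f(1) GR genideal_self[of "{f}"] by auto
    then have "f \<in> J" unfolding J_def using f(1) by blast
    then show False using f(2) P(2) by blast
  qed
  then obtain G0 where G0: "finite G0" "G0 \<subseteq> G" "\<one> \<in> Idl G0" by blast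
  have "\<forall>f\<in>G0. \<exists>I0. finite I0 \<and> (\<forall>x\<in>carrier M. \<exists>k::nat. \<forall>i. i \<notin> I0 \<longrightarrow> f [^] k \<otimes> g x i = \<zero>)"
    using G0(2) by (auto simp: G_def)
  then obtain I where I: "\<And>f. f \<in> G0 \<Longrightarrow> finite (I f)"
    "\<And>f x. \<lbrakk>f \<in> G0; x \<in> carrier M\<rbrakk> \<Longrightarrow> \<exists>k::nat. \<forall>i. i \<notin> I f \<longrightarrow> f [^] k \<otimes> g x i = \<zero>"
    by metis
  show thesis
  proof (rule that[of "\<Union>f\<in>G0. I f"])
    show "finite (\<Union>f\<in>G0. I f)" using G0(1) I(1) by blast
    fix x i assume x: "x \<in> carrier M" and i: "i \<notin> (\<Union>f\<in>G0. I f)"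
    \<comment> \<open>The annihilator of one coordinate outside all the local support sets. It
      contains a power of each element of \<open>G0\<close>, so a prime ideal above it would contain
      \<open>G0\<close> and hence 1.\<close>
    define N where "N = {r \<in> carrier R. r \<otimes> g x i = \<zero>}"
    have N: "ideal N R"
    proof (rule idealI[OF R.ring_axioms])
      show "subgroup N (add_monoid R)"
        using g_closed[OF x, of i] by (intro R.add.subgroupI) (auto simp: N_def R.l_distr R.l_minus)
    next
      fix a r assume a: "a \<in> N" and r: "r \<in> carrier R"
      then have "r \<otimes> a \<otimes> g x i = r \<otimes> (a \<otimes> g x i)" "a \<otimes> r = r \<otimes> a"
        using g_closed[OF x, of i] by (auto simp: N_def R.m_assoc R.m_comm[of a r])
      then show "r \<otimes> a \<in> N" "a \<otimes> r \<in> N" using a r by (auto simp: N_def)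
    qed
    have "\<one> \<in> N"
    proof (rule ccontr)
      assume "\<one> \<notin> N"
      then obtain P where P: "primeideal P R" "N \<subseteq> P" using R.proper_ideal_in_prime[OF N] by blast
      have "f \<in> P" if f: "f \<in> G0" for f
      proof -
        obtain k :: nat where "f [^] k \<otimes> g x i = \<zero>" using I(2)[OF f x] i f by blast
        moreover have "f \<in> carrier R" using f G0(2) GR by blast
        ultimately show ?thesis
          using P primeideal.pow_mem_imp_mem[OF P(1), of f k] by (auto simp: N_def)
      qed
      then have "Idl G0 \<subseteq> P"
        using primeideal.axioms(1)[OF P(1)] by (intro genideal_minimal) auto
      then have "\<one> \<in> P" using G0(3) by blast
      then show False
        using primeideal.I_notcarr[OF P(1)] ideal.one_imp_carrier[OF primeideal.axioms(1)[OF P(1)]] by blast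
    qed
    then show "g x i = \<zero>" using g_closed[OF x, of i] by (simp add: N_def)
  qed
qed

end

text \<open>Let s and p exhibit \<open>L\<close> as a summand of a free module. The functionals are
  the coordinates of s, the generators are the images under p of the unit vectors, and
  \<open>finite_support\<close> leaves only finitely many of them.\<close>

lemma (in lie_algebra) dual_basis_exists:
  assumes proj: "projective_module A L" and loc: "locally_of_finite_rank A L"
  obtains n e \<phi> where "lie_fg A L n e \<phi>"
proof -
  obtain I :: "'g set" and s p where s: "s \<in> mod_hom A L (free_module A I)"
    and p: "p \<in> mod_hom A (free_module A I) L" and ps: "\<And>x. x \<in> carrier L \<Longrightarrow> p (s x) = x"
    using proj unfolding projective_module_def by blast
  let ?F = "free_module A I"
  have s_carrier: "s x \<in> carrier ?F" if "x \<in> carrier L" for x using s that by (auto simp: mod_hom_def)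
  have s_add: "s (x \<oplus>\<^bsub>L\<^esub> y) i = s x i \<oplus> s y i" if "x \<in> carrier L" "y \<in> carrier L" for x y i
    using s that by (simp add: mod_hom_def free_module_def)
  have s_smult: "s (a \<odot>\<^bsub>L\<^esub> x) i = a \<otimes> s x i" if "a \<in> carrier A" "x \<in> carrier L" for a x i
    using s that by (simp add: mod_hom_def free_module_def)
  have s_closed: "s x i \<in> carrier A" if "x \<in> carrier L" for x i
    using s_carrier[OF that] by (cases "i \<in> I") (auto simp: free_module_def)
  have s_fin: "finite {i. s x i \<noteq> \<zero>}" if "x \<in> carrier L" for x
    using s_carrier[OF that] by (simp add: free_module_def)
  obtain I0 where I0: "finite I0" "\<And>x i. \<lbrakk>x \<in> carrier L; i \<notin> I0\<rbrakk> \<Longrightarrow> s x i = \<zero>"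
    using finite_support[OF loc s_closed s_add s_smult s_fin] by blast
  define unit where "unit i = (\<lambda>k. if k = i then \<one> else \<zero>)" for i :: 'g
  have unit: "unit i \<in> carrier ?F" if "i \<in> I" for i
    using that by (auto simp: free_module_def unit_def)
  have p_closed: "p c \<in> carrier L" if "c \<in> carrier ?F" for c using p that by (auto simp: mod_hom_def)
  have p_add: "p (\<lambda>i. c i \<oplus> d i) = p c \<oplus>\<^bsub>L\<^esub> p d" if "c \<in> carrier ?F" "d \<in> carrier ?F" for c d
    using p that by (auto simp: mod_hom_def free_module_def)
  have p_smult: "p (\<lambda>i. a \<otimes> c i) = a \<odot>\<^bsub>L\<^esub> p c" if "a \<in> carrier A" "c \<in> carrier ?F" for a c
    using p that by (auto simp: mod_hom_def free_module_def)
  \<comment> \<open>Induction on a set containing the support: the coordinate at \<open>i\<close> is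
    split off as a multiple of a unit vector, and the rest is the function with that coordinate set
    to zero.\<close>
  have p_sum: "p c = (\<Oplus>\<^bsub>L\<^esub>i\<in>S. c i \<odot>\<^bsub>L\<^esub> p (unit i))"
    if "finite S" "S \<subseteq> I" "c \<in> carrier ?F" "{i. c i \<noteq> \<zero>} \<subseteq> S" for S c
    using that
  proof (induct S arbitrary: c)
    case empty
    then have c: "(\<lambda>i. \<zero> \<otimes> c i) = c" by auto
    have "p c = \<zero>\<^bsub>L\<^esub>" using p_smult[of \<zero> c] p_closed empty unfolding c by simp
    then show ?case by (simp only: M.finsum_empty)
  next
    case (insert i S)
    let ?d = "c(i := \<zero>)"
    have c: "c k \<in> carrier A" for k using insert(5) by (cases "k \<in> I") (auto simp: free_module_def)
    have "{k. ?d k \<noteq> \<zero>} \<subseteq> {k. c k \<noteq> \<zero>}" by auto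
    moreover have "finite {k. c k \<noteq> \<zero>}" using insert(5) by (simp add: free_module_def)
    ultimately have "finite {k. ?d k \<noteq> \<zero>}" by (rule finite_subset)
    then have d: "?d \<in> carrier ?F" using insert(5) by (auto simp: free_module_def)
    have i: "i \<in> I" using insert by blast
    have u: "(\<lambda>k. c i \<otimes> unit i k) \<in> carrier ?F"
      using c i by (auto simp: free_module_def unit_def)
    have "c = (\<lambda>k. c i \<otimes> unit i k \<oplus> ?d k)" using c by (auto simp: unit_def)
    then have "p c = p (\<lambda>k. c i \<otimes> unit i k) \<oplus>\<^bsub>L\<^esub> p ?d" using p_add[OF u d] by simp
    also have "p (\<lambda>k. c i \<otimes> unit i k) = c i \<odot>\<^bsub>L\<^esub> p (unit i)" by (rule p_smult[OF c unit[OF i]])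
    also have "p ?d = (\<Oplus>\<^bsub>L\<^esub>k\<in>S. ?d k \<odot>\<^bsub>L\<^esub> p (unit k))"
    proof (rule insert(3)[OF _ d])
      show "S \<subseteq> I" using insert(4) by blast
      show "{k. ?d k \<noteq> \<zero>} \<subseteq> S" using insert(6) by auto
    qed
    also have "\<dots> = (\<Oplus>\<^bsub>L\<^esub>k\<in>S. c k \<odot>\<^bsub>L\<^esub> p (unit k))"
      using insert c p_closed[OF unit] by (intro M.finsum_cong_closed) auto
    also have "c i \<odot>\<^bsub>L\<^esub> p (unit i) \<oplus>\<^bsub>L\<^esub> \<dots> = (\<Oplus>\<^bsub>L\<^esub>k\<in>insert i S. c k \<odot>\<^bsub>L\<^esub> p (unit k))"
      using insert c p_closed[OF unit] by (subst M.finsum_insert) auto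
    finally show ?case .
  qed
  \<comment> \<open>Unit vectors lie in the free module only for indices in \<open>I\<close>, so the
    finite support set is cut down to \<open>I\<close>.\<close>
  define S where "S = I0 \<inter> I"
  have S: "finite S" "S \<subseteq> I" using I0(1) by (auto simp: S_def)
  have x_sum: "(\<Oplus>\<^bsub>L\<^esub>i\<in>S. s x i \<odot>\<^bsub>L\<^esub> p (unit i)) = x" if x: "x \<in> carrier L" for x
  proof -
    have "{i. s x i \<noteq> \<zero>} \<subseteq> S"
      using I0(2)[OF x] s_carrier[OF x] by (auto simp: S_def free_module_def)
    then show ?thesis using p_sum[OF S s_carrier[OF x]] ps[OF x] by simp
  qed
  obtain b where b: "bij_betw b {0..<card S} S" using ex_bij_betw_nat_finite[OF S(1)] by blast
  then have bS: "b i \<in> S" if "i < card S" for i using that by (auto simp: bij_betw_def)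
  have "lie_fg A L (card S) (\<lambda>i. p (unit (b i))) (\<lambda>i x. s x (b i))"
  proof (intro lie_fg.intro lie_fg_axioms.intro lie_algebra_axioms)
    fix x assume x: "x \<in> carrier L"
    have "(\<Oplus>\<^bsub>L\<^esub>i\<in>S. s x i \<odot>\<^bsub>L\<^esub> p (unit i)) = (\<Oplus>\<^bsub>L\<^esub>i\<in>b ` {..<card S}. s x i \<odot>\<^bsub>L\<^esub> p (unit i))"
      using b by (simp add: bij_betw_def atLeast0LessThan)
    also have "\<dots> = (\<Oplus>\<^bsub>L\<^esub>i\<in>{..<card S}. s x (b i) \<odot>\<^bsub>L\<^esub> p (unit (b i)))"
      using b bS S(2) s_closed[OF x] p_closed[OF unit]
      by (intro M.finsum_reindex) (auto simp: bij_betw_def atLeast0LessThan)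
    finally show "(\<Oplus>\<^bsub>L\<^esub>i\<in>{..<card S}. s x (b i) \<odot>\<^bsub>L\<^esub> p (unit (b i))) = x" using x_sum[OF x] by simp
  qed (use s_closed s_add s_smult in \<open>auto intro!: p_closed unit subsetD[OF S(2)] bS\<close>)
  then show thesis by (rule that)
qed

text \<open>The existence part makes the universal part non-vacuous. In the latter, an algebra that
  is universal for test algebras in one type large enough for all algebras of finite type is shown
  to be universal and smooth with respect to test algebras in any type \<open>'b\<close>.\<close>

theorem theorem3p3:
  fixes A :: "('a, 'm) ring_scheme" and \<gg> :: "('a, 'g, 'k) lie_alg_scheme"
  assumes "cring A"
    and "lie_algebra A \<gg>"
    and "projective_module A \<gg>"
    and "locally_of_finite_rank A \<gg>"
    and "perfect_killing_form A \<gg>"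
  shows "(\<exists>R u. represents_Aut TYPE('a fin_type_alg) A \<gg> R
                  (u :: ('g \<times> 'a fin_type_alg) list set \<Rightarrow> _)) \<and>
    (\<forall>(R :: ('a, 'a fin_type_alg) module) u. represents_Aut TYPE('a fin_type_alg) A \<gg> R u \<longrightarrow>
        represents_Aut TYPE('b) A \<gg> R u \<and>
        smooth_algebra TYPE('b) A R \<and> finitely_presented_algebra A R)"
proof -
  interpret lie_algebra A \<gg> by fact
  obtain n e \<phi> where "lie_fg A \<gg> n e \<phi>"
    using dual_basis_exists[OF assms(3,4)] .
  then interpret lie_fg A \<gg> n e \<phi> .
  obtain e' where "casimir e'"
    using casimir_exists[OF assms(5)] by blast
  then show ?thesis
    using represents_Aut_aut_alg Aut_smooth by blast
qed

end
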